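(* Let $\alpha\in(0,1)$, $\theta>0$, let $H$ be a nonatomic probability measure on a Polish space $\mathbb{X}$ and $f:\mathbb{X}\to\mathbb{R}^+$ measurable with $\int f^\alpha dH<\infty$. Let $\tilde P_{\alpha,\theta}$ be a PD$(\alpha,\theta)$ random probability measure with mean $H$, put $\eta=H\circ f^{-1}$ and $C_\eta$ the convex hull of the support of $\eta$. Define $$\Delta_{\alpha,\theta}(t)=\frac{1}{2\pi i}\lim_{\varepsilon\downarrow0}\big\{\mathcal S_\theta[-t-i\varepsilon;\tilde P_{\alpha,\theta}(f)]-\mathcal S_\theta[-t+i\varepsilon;\tilde P_{\alpha,\theta}(f)]\big\}.$$ Then the density function $q_{\alpha,\theta}$ of $\tilde P_{\alpha,\theta}(f)$, evaluated at a point $y\in C_\eta$, coincides with $$q_{\alpha,\theta}(y)=\int_0^y (y-t)^{\theta-1}\Delta'_{\alpha,\theta}(t)\,dt.$$ When $\theta>1$ this can be rewritten as $q_{\alpha,\theta}(y)=(\theta-1)\int_0^y(y-t)^{\theta-2}\Delta_{\alpha,\theta}(t)\,dt$.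
   Context: A PD$(\alpha,\theta)$ random probability measure with mean $H$ is $\sum_{k\ge1}W_k\delta_{Z_k}$ with $V_k$ independent $\mathrm{Beta}(1-\alpha,\theta+k\alpha)$, $W_1=V_1$, $W_k=V_k\prod_{j<k}(1-V_j)$, $Z_k$ i.i.d. with law $H$ independent of $(V_k)$; $\tilde P_{\alpha,\theta}(f)=\sum_k W_k f(Z_k)$. For a nonnegative random variable $X$ and $\theta>0$, the generalized Cauchy–Stieltjes transform of order $\theta$ is $\mathcal S_\theta[z;X]=\mathbb{E}[(z+X)^{-\theta}]$ for $z\in\mathbb{C}$ with $|\arg z|<\pi$ (principal branch). $\Delta'_{\alpha,\theta}$ denotes the derivative of $\Delta_{\alpha,\theta}$. *)

theory Defs
  imports "HOL-Probability.Probability"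
begin

definition beta_density :: "real \<Rightarrow> real \<Rightarrow> real \<Rightarrow> real" where
  "beta_density a b x =
     (if 0 < x \<and> x < 1 then x powr (a - 1) * (1 - x) powr (b - 1) / Beta a b else 0)"

definition beta_measure :: "real \<Rightarrow> real \<Rightarrow> real measure" where
  "beta_measure a b = density lborel (\<lambda>x. ennreal (beta_density a b x))"

definition stick_weights :: "(nat \<Rightarrow> 'a \<Rightarrow> real) \<Rightarrow> nat \<Rightarrow> 'a \<Rightarrow> real" where
  "stick_weights V k \<omega> = V k \<omega> * (\<Prod>j<k. 1 - V j \<omega>)"

definition PD_functional ::
    "(nat \<Rightarrow> 'a \<Rightarrow> real) \<Rightarrow> (nat \<Rightarrow> 'a \<Rightarrow> 'x) \<Rightarrow> ('x \<Rightarrow> real) \<Rightarrow> 'a \<Rightarrow> real" where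
  "PD_functional V Z f \<omega> = (\<Sum>k. stick_weights V k \<omega> * f (Z k \<omega>))"

definition PD_representation ::
    "'a measure \<Rightarrow> real \<Rightarrow> real \<Rightarrow> 'x measure \<Rightarrow> (nat \<Rightarrow> 'a \<Rightarrow> real) \<Rightarrow> (nat \<Rightarrow> 'a \<Rightarrow> 'x) \<Rightarrow> bool" where
  "PD_representation M \<alpha> \<theta> H V Z \<longleftrightarrow>
     prob_space M \<and>
     (\<forall>k. V k \<in> borel_measurable M) \<and>
     (\<forall>k. Z k \<in> measurable M H) \<and>
     (\<forall>k. distr M borel (V k) = beta_measure (1 - \<alpha>) (\<theta> + real (Suc k) * \<alpha>)) \<and>
     (\<forall>k. distr M H (Z k) = H) \<and>
     prob_space.indep_vars M (\<lambda>_. borel) V UNIV \<and>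
     prob_space.indep_vars M (\<lambda>_. H) Z UNIV \<and>
     prob_space.indep_set M
        (sets (vimage_algebra (space M) (\<lambda>\<omega> k. V k \<omega>) (PiM UNIV (\<lambda>_. borel))))
        (sets (vimage_algebra (space M) (\<lambda>\<omega> k. Z k \<omega>) (PiM UNIV (\<lambda>_. H))))"

text \<open>Generalized Cauchy--Stieltjes transform of order theta: E[(z + X)^(-theta)], principal branch.\<close>
definition gen_stieltjes :: "'a measure \<Rightarrow> real \<Rightarrow> ('a \<Rightarrow> real) \<Rightarrow> complex \<Rightarrow> complex" where
  "gen_stieltjes M \<theta> X z = (LINT \<omega>|M. (z + complex_of_real (X \<omega>)) powr (- complex_of_real \<theta>))"

definition Delta_fun :: "'a measure \<Rightarrow> real \<Rightarrow> ('a \<Rightarrow> real) \<Rightarrow> real \<Rightarrow> complex" where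
  "Delta_fun M \<theta> X t =
     Lim (at_right (0::real))
       (\<lambda>\<epsilon>. (gen_stieltjes M \<theta> X (- complex_of_real t - \<i> * complex_of_real \<epsilon>)
             - gen_stieltjes M \<theta> X (- complex_of_real t + \<i> * complex_of_real \<epsilon>))
            / (2 * complex_of_real pi * \<i>))"

definition measure_support :: "real measure \<Rightarrow> real set" where
  "measure_support \<mu> = {x. \<forall>e>0. emeasure \<mu> (ball x e) > 0}"

end

theory Submission
  imports Defs "HOL-Real_Asymp.Real_Asymp" "HOL-Complex_Analysis.Complex_Analysis"
begin

text \<open>
Write \<open>X\<close> for the random mean, \<open>\<eta>\<close> for the law of \<open>f\<close> under \<open>H\<close> and
\<open>m z = \<integral> (z + y) powr \<alpha> d\<eta>\<close>. The proof rests on the identity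
\<open>E (z + X) powr (-\<theta>) = m z powr (-\<theta>/\<alpha>)\<close>. With \<open>X'\<close> for the mean at parameter \<open>\<theta> + \<alpha>\<close>,
removing the first stick gives \<open>X = V f(Z) + (1 - V) X'\<close>, and integrating out the Beta variable gives
\<open>E (z + X) powr (-\<theta>-1) = E (z + f) powr (\<alpha>-1) * E (z + X') powr (-\<theta>-\<alpha>)\<close>. Regarded as a function of
\<open>m z\<close>, the transform of \<open>X\<close> therefore has as \<open>n\<close>-th derivative a multiple of the transform at parameter
\<open>\<theta> + n\<alpha>\<close>, and for bounded \<open>f\<close> its Taylor series at a far away point is squeezed between two
binomial series. Truncation removes the boundedness of \<open>f\<close>.

Analytic continuation extends the identity to the plane slit along the negative axis, where the right hand
side has continuous boundary values because \<open>m\<close> does not vanish there; so \<open>\<Delta>\<close> is continuous. Since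
\<open>\<integral> ((w + u) powr (-\<theta>) - (w' + u) powr (-\<theta>)) u powr (\<theta>-1) du = Ln w' - Ln w\<close> over \<open>u > 0\<close> and
\<open>Im Ln\<close> jumps by \<open>\<pi>\<close> at \<open>0\<close> along the axis, taking expectations with \<open>w = X - c + i\<epsilon>\<close> and letting
\<open>\<epsilon>\<close> tend to zero gives \<open>P (X \<le> c) = \<integral> (c - t) powr (\<theta>-1) \<Delta>(t) dt\<close> over \<open>[0, c]\<close>. Finally
\<open>\<Delta>\<close> is the primitive of a locally integrable function, by dominated convergence from the derivative of the
transform slightly above the axis; both density formulas then follow from the theorems of Fubini and of
Lebesgue on differentiation.
\<close>

text \<open>Three obstacles shape the development. The random mean is a \<open>suminf\<close>,
  unspecified where the series diverges, so almost sure convergence has to be derived from the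
  moment condition; the behaviour of the transform at infinity supplies it. A law \<eta>
  concentrated at one point t would give m a zero at -t; it is excluded because X would then be
  constant and could not have a density. Finally, (w + u) powr (-\<theta>) alone is not integrable
  against u powr (\<theta>-1) at infinity, which is why the kernel identity carries the reference
  point w'. With w' = X + 1 + i\<epsilon> its logarithm becomes real in the limit, and only the jump
  at c survives. The derivative of \<Delta> is controlled only almost everywhere. It is therefore
  introduced as an explicit function \<open>\<delta>'\<close>, and each density formula is proved by
  comparing primitives in y, where the order of integration can be exchanged.\<close>

abbreviation cr :: "real \<Rightarrow> complex" where "cr \<equiv> complex_of_real"

abbreviation cpt :: "real \<Rightarrow> real \<Rightarrow> complex" where "cpt x y \<equiv> cr x + \<i> * cr y"

abbreviation spw :: "complex \<Rightarrow> real \<Rightarrow> real \<Rightarrow> complex" where "spw z p x \<equiv> (z + cr x) powr cr p"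

section \<open>Lebesgue differentiation on the line\<close>

text \<open>Outer regularity gives an open set U around A of small \<mu>-mass. Every bad point is
  the centre of a ball inside U whose mass exceeds e times its radius. Vitali's covering lemma
  extracts disjoint balls whose fivefold enlargements still cover, so Lebesgue measure is controlled
  by the mass of U.\<close>

lemma negligible_upper_density:
  fixes \<mu> :: "real measure"
  assumes fin: "finite_measure \<mu>" and sets: "sets \<mu> = sets borel"
    and A: "A \<in> sets borel" and null: "emeasure \<mu> A = 0" and e: "e > 0"
  shows "negligible {x\<in>A. \<forall>d>0. \<exists>r. 0 < r \<and> r < d \<and> measure \<mu> (cball x r) > e * r}"
    (is "negligible ?N")
  unfolding negligible_outer_le
proof (intro allI impI)
  interpret finite_measure \<mu> by fact
  fix \<delta> :: real assume \<delta>: "\<delta> > 0"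
  \<comment> \<open>The enlarged ball \<open>cball i (5 * r i)\<close> has length
    \<open>10 * r i\<close>, and \<open>r i\<close> is less than 1/e times the mass of the original
    ball; this leaves a factor 10 / e to compensate.\<close>
  define \<eta> where "\<eta> = \<delta> * e / 10"
  have \<eta>: "\<eta> > 0" using \<delta> e by (simp add: \<eta>_def)
  have "(INF U\<in>{U. A \<subseteq> U \<and> open U}. emeasure \<mu> U) = 0"
    using outer_regular[OF sets _ A] emeasure_finite null by simp
  then have "(INF U\<in>{U. A \<subseteq> U \<and> open U}. emeasure \<mu> U) < ennreal \<eta>"
    using \<eta> by simp
  then obtain U where U: "A \<subseteq> U" "open U" "emeasure \<mu> U < ennreal \<eta>"
    unfolding INF_less_iff by auto
  have U': "measure \<mu> U < \<eta>"
    using U(3) \<eta> by (simp add: emeasure_eq_measure ennreal_less_iff)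
  have "\<forall>x\<in>?N. \<exists>r. 0 < r \<and> r < 1 \<and> cball x r \<subseteq> U \<and> measure \<mu> (cball x r) > e * r"
  proof
    fix x assume x: "x \<in> ?N"
    then have "x \<in> U" using U by auto
    then obtain d where d: "d > 0" "ball x d \<subseteq> U" using U(2) by (meson openE)
    have "min 1 d > 0" using d by simp
    then obtain r where "0 < r" "r < min 1 d" "measure \<mu> (cball x r) > e * r" using x by blast
    then show "\<exists>r. 0 < r \<and> r < 1 \<and> cball x r \<subseteq> U \<and> measure \<mu> (cball x r) > e * r"
      using d(2) by (intro exI[of _ r]) (auto simp: subset_iff dist_real_def)
  qed
  from bchoice[OF this] obtain r where r: "\<And>x. x \<in> ?N \<Longrightarrow> 0 < r x \<and> r x < 1 \<and> cball x (r x) \<subseteq> U \<and> measure \<mu> (cball x (r x)) > e * r x"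
    by blast
  have cov: "?N \<subseteq> (\<Union>i\<in>?N. cball i (r i))" using r by force
  have rle: "0 < r x \<and> r x \<le> 1" if "x \<in> ?N" for x using r[OF that] by simp
  obtain C where C: "countable C" "C \<subseteq> ?N"
     "pairwise (\<lambda>i j. disjnt (cball i (r i)) (cball j (r j))) C"
     "?N \<subseteq> (\<Union>i\<in>C. cball i (5 * r i))"
    by (rule Vitali_covering_lemma_cballs[OF cov rle])
  have bound: "measure lebesgue (\<Union>i\<in>I. cball i (5 * r i)) \<le> \<delta>" if I: "I \<subseteq> C" "finite I" for I
  proof -
    have rI: "0 < r i \<and> r i < 1 \<and> cball i (r i) \<subseteq> U \<and> measure \<mu> (cball i (r i)) > e * r i" if "i \<in> I" for i
      using that I C(2) r by blast
    have "measure lebesgue (\<Union>i\<in>I. cball i (5 * r i)) \<le> (\<Sum>i\<in>I. measure lebesgue (cball i (5 * r i)))"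
      using I by (intro measure_UNION_le) auto
    also have "\<dots> = (\<Sum>i\<in>I. 10 * r i)"
      using rI by (intro sum.cong refl) (auto simp: cball_eq_atLeastAtMost dest: less_imp_le)
    also have "\<dots> \<le> (\<Sum>i\<in>I. 10 / e * measure \<mu> (cball i (r i)))"
      using rI e by (intro sum_mono) (auto simp: field_simps dest: less_imp_le)
    also have "\<dots> = 10 / e * measure \<mu> (\<Union>i\<in>I. cball i (r i))"
      using I C(3) unfolding sum_distrib_left[symmetric]
      by (subst finite_measure_finite_Union)
         (auto simp: sets disjoint_family_on_def pairwise_def disjnt_def)
    also have "\<dots> \<le> 10 / e * measure \<mu> U"
      using e rI U(2) by (intro mult_left_mono finite_measure_mono) (auto simp: sets)
    also have "\<dots> \<le> \<delta>" using U' e by (simp add: \<eta>_def field_simps)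
    finally show ?thesis .
  qed
  show "\<exists>T. ?N \<subseteq> T \<and> T \<in> lmeasurable \<and> measure lebesgue T \<le> \<delta>"
    using C(4) fmeasurable_UN_bound[OF C(1) _ bound] measure_UN_bound[OF C(1) _ bound]
    by (intro exI[of _ "\<Union>i\<in>C. cball i (5 * r i)"]) auto
qed

lemma negligible_AE_lborel:
  assumes "negligible N" shows "AE x in lborel. x \<notin> N"
proof -
  have "AE x in lebesgue. x \<notin> N"
    using assms by (intro AE_not_in) (simp add: negligible_iff_null_sets)
  then show ?thesis by (simp add: AE_completion_iff)
qed

lemma AE_density_tendsto_zero:
  fixes \<mu> :: "real measure"
  assumes fin: "finite_measure \<mu>" and sets: "sets \<mu> = sets borel"
    and A: "A \<in> sets borel" and null: "emeasure \<mu> A = 0"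
  shows "AE x in lborel. x \<in> A \<longrightarrow> (\<forall>e>0. \<exists>d>0. \<forall>r. 0 < r \<longrightarrow> r < d \<longrightarrow> measure \<mu> (cball x r) \<le> e * r)"
proof -
  have "AE x in lborel. \<forall>n. x \<notin> {x\<in>A. \<forall>d>0. \<exists>r. 0 < r \<and> r < d \<and> measure \<mu> (cball x r) > (1 / real (Suc n)) * r}"
    unfolding AE_all_countable
    by (intro allI negligible_AE_lborel negligible_upper_density assms) auto
  then show ?thesis
  proof eventually_elim
    case (elim x)
    show ?case
    proof (intro impI allI)
      fix e :: real assume xA: "x \<in> A" and e: "e > 0"
      then obtain n where n: "1 / real (Suc n) < e" using nat_approx_posE by blast
      from elim xA obtain d where d: "d > 0"
        "\<And>r. 0 < r \<Longrightarrow> r < d \<Longrightarrow> measure \<mu> (cball x r) \<le> (1 / real (Suc n)) * r"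
        by (auto simp: not_less) (metis not_less)
      show "\<exists>d>0. \<forall>r. 0 < r \<longrightarrow> r < d \<longrightarrow> measure \<mu> (cball x r) \<le> e * r"
      proof (intro exI[of _ d] conjI allI impI)
        fix r assume r: "0 < r" "r < d"
        have "measure \<mu> (cball x r) \<le> (1 / real (Suc n)) * r" using d r by blast
        also have "\<dots> \<le> e * r" using n r by (intro mult_right_mono) auto
        finally show "measure \<mu> (cball x r) \<le> e * r" .
      qed (use d in auto)
    qed
  qed
qed

text \<open>The measure whose density is the positive part of f - c gives no mass to the set where f
  < c, so \<open>AE_density_tendsto_zero\<close> makes it of smaller order than the length at almost
  every point there. On an interval the integral of f is at most c times the length plus that
  mass.\<close>

lemma AE_upper_derivative_le:
  fixes f :: "real \<Rightarrow> real"
  assumes f: "integrable lborel f"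
  shows "AE x in lborel. f x < c \<longrightarrow> (\<forall>e>0. \<exists>d>0. \<forall>a b. a \<le> x \<longrightarrow> x \<le> b \<longrightarrow> a < b \<longrightarrow> b - a < d \<longrightarrow>
     (LINT t:{a<..b}|lborel. f t) \<le> (c + e) * (b - a))"
proof -
  have [measurable]: "f \<in> borel_measurable borel" using f by auto
  define g where "g t = max 0 (f t - c)" for t
  define B where "B = {t. f t < c}"
  have [measurable]: "B \<in> sets borel" "g \<in> borel_measurable borel" unfolding B_def g_def by measurable
  have gint: "AE x in lborel. x \<in> B \<inter> ball 0 n \<longrightarrow> (\<forall>e>0. \<exists>d>0. \<forall>a b. a \<le> x \<longrightarrow> x \<le> b \<longrightarrow> a < b \<longrightarrow> b - a < d \<longrightarrow>
     (LINT t:{a<..b}|lborel. f t) \<le> (c + e) * (b - a))" for n :: nat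
  proof -
    \<comment> \<open>The restriction to a ball makes the measure finite: for negative
      \<open>c\<close> the function \<open>g\<close> is not integrable over the whole line.\<close>
    define h where "h t = indicator (ball 0 (real n)) t * g t" for t
    have [measurable]: "ball 0 (real n) \<in> sets (borel :: real measure)" by simp
    have [measurable]: "h \<in> borel_measurable borel" unfolding h_def by measurable
    have hint: "integrable lborel h"
    proof (rule Bochner_Integration.integrable_bound)
      show "integrable lborel (\<lambda>t. \<bar>f t\<bar> + \<bar>c\<bar> * indicator (ball 0 (real n)) t)"
        using f by (intro Bochner_Integration.integrable_add integrable_mult_right integrable_abs)
          (auto simp: integrable_real_indicator ball_eq_greaterThanLessThan emeasure_lborel_Ioo)
      show "AE x in lborel. norm (h x) \<le> norm (\<bar>f x\<bar> + \<bar>c\<bar> * indicator (ball 0 (real n)) x)"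
        by (auto simp: h_def g_def indicator_def)
    qed auto
    define \<mu> where "\<mu> = density lborel (\<lambda>t. ennreal (h t))"
    have hnn: "h t \<ge> 0" for t by (auto simp: h_def g_def)
    have em: "emeasure \<mu> S = ennreal (LINT t:S|lborel. h t)" if "S \<in> sets borel" for S
    proof -
      have "set_integrable lborel S h"
        unfolding set_integrable_def using hint that by (intro integrable_mult_indicator[of S]) auto
      then have "integrable lborel (\<lambda>t. indicator S t * h t)" by (simp add: set_integrable_def)
      then have "(\<integral>\<^sup>+t. ennreal (indicator S t * h t) \<partial>lborel) = ennreal (LINT t:S|lborel. h t)"
        unfolding set_lebesgue_integral_def
        by (subst nn_integral_eq_integral) (auto simp: hnn)
      moreover have "emeasure \<mu> S = (\<integral>\<^sup>+t. ennreal (indicator S t * h t) \<partial>lborel)"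
        using that by (simp add: \<mu>_def emeasure_density)
          (intro nn_integral_cong, auto simp: indicator_def)
      ultimately show ?thesis by simp
    qed
    have fin: "finite_measure \<mu>"
      by standard (use em[of UNIV] in \<open>simp add: \<mu>_def\<close>)
    have null: "emeasure \<mu> (B \<inter> ball 0 (real n)) = 0"
    proof -
      have "(\<lambda>t. indicat_real (B \<inter> ball 0 (real n)) t *\<^sub>R h t) = (\<lambda>t. 0)"
        by (auto simp: h_def g_def B_def indicator_def fun_eq_iff)
      then have "(LINT t:(B \<inter> ball 0 (real n))|lborel. h t) = 0"
        by (simp add: set_lebesgue_integral_def)
      then show ?thesis by (subst em) auto
    qed
    have meas: "measure \<mu> S = (LINT t:S|lborel. h t)" if "S \<in> sets borel" for S
      using em[OF that] by (simp add: measure_def set_lebesgue_integral_def hnn)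
    have "AE x in lborel. x \<in> B \<inter> ball 0 (real n) \<longrightarrow> (\<forall>e>0. \<exists>d>0. \<forall>r. 0 < r \<longrightarrow> r < d \<longrightarrow> measure \<mu> (cball x r) \<le> e * r)"
      by (rule AE_density_tendsto_zero[OF fin _ _ null]) (auto simp: \<mu>_def)
    then show ?thesis
    proof eventually_elim
      case (elim x)
      show ?case
      proof (intro impI allI)
        fix e :: real assume x: "x \<in> B \<inter> ball 0 (real n)" and e: "e > 0"
        from elim x e obtain d where d: "d > 0"
          "\<And>r. 0 < r \<Longrightarrow> r < d \<Longrightarrow> measure \<mu> (cball x r) \<le> e * r" by blast
        from x obtain d' where d': "d' > 0" "ball x d' \<subseteq> ball 0 (real n)"
          by (meson IntD2 open_ball openE)
        show "\<exists>d>0. \<forall>a b. a \<le> x \<longrightarrow> x \<le> b \<longrightarrow> a < b \<longrightarrow> b - a < d \<longrightarrow>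
           (LINT t:{a<..b}|lborel. f t) \<le> (c + e) * (b - a)"
        proof (intro exI[of _ "min d d'"] conjI allI impI)
          fix a b assume ab: "a \<le> x" "x \<le> b" "a < b" "b - a < min d d'"
          have sub: "{a<..b} \<subseteq> ball x d'" using ab by (auto simp: dist_real_def)
          then have sub': "{a<..b} \<subseteq> ball 0 (real n)" using d' by blast
          have fs: "set_integrable lborel S f" if "S \<in> sets borel" for S
            unfolding set_integrable_def using f that by (intro integrable_mult_indicator) auto
          have hs: "set_integrable lborel S h" if "S \<in> sets borel" for S
            unfolding set_integrable_def using hint that by (intro integrable_mult_indicator) auto
          have cs: "set_integrable lborel {a<..b} (\<lambda>_. c)"
            using ab by (simp add: set_integrable_def integrable_real_indicator)
          have "(LINT t:{a<..b}|lborel. f t) \<le> (LINT t:{a<..b}|lborel. c + h t)"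
          proof (rule set_integral_mono)
            show "f t \<le> c + h t" if "t \<in> {a<..b}" for t
              using that sub' by (auto simp: h_def g_def subset_iff)
          qed (auto intro!: fs set_integral_add(1) hs cs)
          also have "\<dots> = c * (b - a) + measure \<mu> {a<..b}"
            using ab by (subst set_integral_add) (auto intro!: hs cs simp: meas set_lebesgue_integral_def)
          also have "measure \<mu> {a<..b} \<le> measure \<mu> (cball x (b - a))"
            using ab by (intro finite_measure.finite_measure_mono[OF fin]) (auto simp: \<mu>_def dist_real_def)
          also have "\<dots> \<le> e * (b - a)" using ab d by auto
          finally show "(LINT t:{a<..b}|lborel. f t) \<le> (c + e) * (b - a)" by (simp add: algebra_simps)
        qed (use d d' in auto)
      qed
    qed
  qed
  have "AE x in lborel. \<forall>n::nat. x \<in> B \<inter> ball 0 n \<longrightarrow> (\<forall>e>0. \<exists>d>0. \<forall>a b. a \<le> x \<longrightarrow> x \<le> b \<longrightarrow> a < b \<longrightarrow> b - a < d \<longrightarrow>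
     (LINT t:{a<..b}|lborel. f t) \<le> (c + e) * (b - a))"
    unfolding AE_all_countable using gint by blast
  then show ?thesis
  proof eventually_elim
    case (elim x)
    obtain n :: nat where "\<bar>x\<bar> < real n" using reals_Archimedean2 by blast
    then have "x \<in> ball 0 (real n)" by (simp add: dist_real_def)
    with elim[rule_format, of n] show ?case by (auto simp: B_def)
  qed
qed

text \<open>The null set of \<open>AE_upper_derivative_le\<close> depends on \<open>c\<close>.
  Countably many rational values suffice, since one of them lies between f x and f x + e/2.\<close>

lemma AE_upper_derivative_le':
  fixes f :: "real \<Rightarrow> real"
  assumes f: "integrable lborel f"
  shows "AE x in lborel. \<forall>e>0. \<exists>d>0. \<forall>a b. a \<le> x \<longrightarrow> x \<le> b \<longrightarrow> a < b \<longrightarrow> b - a < d \<longrightarrow>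
     (LINT t:{a<..b}|lborel. f t) \<le> (f x + e) * (b - a)"
proof -
  have "AE x in lborel. \<forall>c\<in>\<rat>. f x < c \<longrightarrow> (\<forall>e>0. \<exists>d>0. \<forall>a b. a \<le> x \<longrightarrow> x \<le> b \<longrightarrow> a < b \<longrightarrow> b - a < d \<longrightarrow>
     (LINT t:{a<..b}|lborel. f t) \<le> (c + e) * (b - a))"
    by (subst AE_ball_countable[OF countable_rat]) (intro ballI AE_upper_derivative_le f)
  then show ?thesis
  proof eventually_elim
    case (elim x)
    show ?case
    proof (intro allI impI)
      fix e :: real assume e: "e > 0"
      obtain c where c: "c \<in> \<rat>" "f x < c" "c < f x + e / 2" using Rats_dense_in_real[of "f x" "f x + e/2"] e by auto
      obtain d where d: "d > 0" "\<And>a b. a \<le> x \<Longrightarrow> x \<le> b \<Longrightarrow> a < b \<Longrightarrow> b - a < d \<Longrightarrow>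
          (LINT t:{a<..b}|lborel. f t) \<le> (c + e / 2) * (b - a)"
        using elim c e by (metis half_gt_zero)
      show "\<exists>d>0. \<forall>a b. a \<le> x \<longrightarrow> x \<le> b \<longrightarrow> a < b \<longrightarrow> b - a < d \<longrightarrow>
          (LINT t:{a<..b}|lborel. f t) \<le> (f x + e) * (b - a)"
      proof (intro exI[of _ d] conjI allI impI)
        fix a b assume ab: "a \<le> x" "x \<le> b" "a < b" "b - a < d"
        have "(LINT t:{a<..b}|lborel. f t) \<le> (c + e / 2) * (b - a)" using d ab by blast
        also have "\<dots> \<le> (f x + e) * (b - a)" using c ab by (intro mult_right_mono) auto
        finally show "(LINT t:{a<..b}|lborel. f t) \<le> (f x + e) * (b - a)" .
      qed (use d in auto)
    qed
  qed
qed

text \<open>The upper bound applied to f and to -f encloses the difference quotient. The intervals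
  there only have to contain x, possibly as an end point, which covers increments of either
  sign.\<close>

theorem lebesgue_differentiation:
  fixes f :: "real \<Rightarrow> real"
  assumes f: "integrable lborel f"
  shows "AE x in lborel. ((\<lambda>y. LINT t:{..y}|lborel. f t) has_real_derivative f x) (at x)"
proof -
  have f': "integrable lborel (\<lambda>t. - f t)" using f by simp
  from AE_upper_derivative_le'[OF f] AE_upper_derivative_le'[OF f'] show ?thesis
  proof eventually_elim
    case (elim x)
    define F where "F y = (LINT t:{..y}|lborel. f t)" for y
    have fs: "set_integrable lborel S f" if "S \<in> sets borel" for S
      unfolding set_integrable_def using f that by (intro integrable_mult_indicator) auto
    have Fd: "F b - F a = (LINT t:{a<..b}|lborel. f t)" if "a < b" for a b
    proof -
      have "{..b} = {..a} \<union> {a<..b}" using that by auto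
      then have "F b = F a + (LINT t:{a<..b}|lborel. f t)"
        unfolding F_def by (simp only:) (subst set_integral_Un, auto intro!: fs)
      then show ?thesis by simp
    qed
    have "\<exists>d>0. \<forall>h. h \<noteq> 0 \<and> norm (h - 0) < d \<longrightarrow> norm ((F (x + h) - F x) / h - f x) < e" if e: "e > 0" for e
    proof -
      obtain d1 where d1: "d1 > 0" "\<And>a b. a \<le> x \<Longrightarrow> x \<le> b \<Longrightarrow> a < b \<Longrightarrow> b - a < d1 \<Longrightarrow>
          (LINT t:{a<..b}|lborel. f t) \<le> (f x + e / 2) * (b - a)" using elim(1) e by (metis half_gt_zero)
      obtain d2 where d2: "d2 > 0" "\<And>a b. a \<le> x \<Longrightarrow> x \<le> b \<Longrightarrow> a < b \<Longrightarrow> b - a < d2 \<Longrightarrow>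
          (LINT t:{a<..b}|lborel. - f t) \<le> (- f x + e / 2) * (b - a)" using elim(2) e by (metis half_gt_zero)
      have *: "\<bar>(F b - F a) / (b - a) - f x\<bar> < e" if ab: "a \<le> x" "x \<le> b" "a < b" "b - a < min d1 d2" for a b
      proof -
        have "F b - F a \<le> (f x + e / 2) * (b - a)" using d1 ab by (simp add: Fd)
        then have 1: "(F b - F a) / (b - a) \<le> f x + e / 2" using ab by (simp add: divide_le_eq)
        have "- (F b - F a) \<le> (- f x + e / 2) * (b - a)" using d2(2)[of a b] ab by (simp add: Fd set_lebesgue_integral_def)
        then have "- ((F b - F a) / (b - a)) * (b - a) \<le> (- f x + e / 2) * (b - a)"
          using ab by simp
        then have "- ((F b - F a) / (b - a)) \<le> - f x + e / 2"
          using ab by (meson diff_gt_0_iff_gt mult_right_le_imp_le)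
        with 1 e show ?thesis by linarith
      qed
      show ?thesis
      proof (intro exI[of _ "min d1 d2"] conjI allI impI)
        fix h :: real assume h: "h \<noteq> 0 \<and> norm (h - 0) < min d1 d2"
        show "norm ((F (x + h) - F x) / h - f x) < e"
        proof (cases "h > 0")
          case True
          then show ?thesis using *[of x "x + h"] h by auto
        next
          case False
          have "(F (x + h) - F x) / h = (F x - F (x + h)) / (x - (x + h))" using h by (simp add: field_simps)
          then show ?thesis using *[of "x + h" x] h False by auto
        qed
      qed (use d1 d2 in auto)
    qed
    then show ?case
      unfolding F_def[symmetric] DERIV_def LIM_def by (auto simp: dist_norm)
  qed
qed

section \<open>Integrals depending on a parameter\<close>

lemma integral_dominated_convergence_within:
  fixes s :: "'z::first_countable_topology \<Rightarrow> 'b \<Rightarrow> 'c::{banach,second_countable_topology}"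
  assumes f: "f \<in> borel_measurable M" and s: "\<And>z. s z \<in> borel_measurable M" and w: "integrable M w"
    and lim: "AE x in M. ((\<lambda>z. s z x) \<longlongrightarrow> f x) (at z0 within S)"
    and bound: "\<forall>\<^sub>F z in at z0 within S. AE x in M. norm (s z x) \<le> w x"
  shows "((\<lambda>z. integral\<^sup>L M (s z)) \<longlongrightarrow> integral\<^sup>L M f) (at z0 within S)"
  unfolding tendsto_at_iff_sequentially comp_def
proof (intro allI impI)
  fix X :: "nat \<Rightarrow> 'z" assume X: "\<forall>i. X i \<in> S - {z0}" "X \<longlonglongrightarrow> z0"
  have "filterlim X (at z0 within S) sequentially"
    using X by (simp add: filterlim_at)
  from eventually_compose_filterlim[OF bound this] obtain N
    where N: "\<And>n. n \<ge> N \<Longrightarrow> AE x in M. norm (s (X n) x) \<le> w x"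
    by (auto simp: eventually_sequentially)
  show "(\<lambda>n. integral\<^sup>L M (s (X n))) \<longlonglongrightarrow> integral\<^sup>L M f"
  proof (rule LIMSEQ_offset, rule integral_dominated_convergence[OF f _ w])
    show "AE x in M. norm (s (X (n + N)) x) \<le> w x" for n by (rule N) auto
    show "AE x in M. (\<lambda>n. s (X (n + N)) x) \<longlonglongrightarrow> f x"
      using lim
    proof eventually_elim
      case (elim x)
      have "(\<lambda>n. s (X n) x) \<longlonglongrightarrow> f x"
        using elim X unfolding tendsto_at_iff_sequentially comp_def by blast
      then show ?case by (rule LIMSEQ_ignore_initial_segment)
    qed
  qed (rule s)
qed

text \<open>The abstract field lets the lemma serve both real derivatives on the positive axis and
  complex ones off the cut. On the ball, which is convex, the mean value inequality turns the bound
  \<open>K\<close> on the derivative into a bound on the difference quotients.\<close>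

lemma has_field_derivative_integral:
  fixes F F' :: "'z::{real_normed_field,banach,second_countable_topology} \<Rightarrow> 'b \<Rightarrow> 'z"
  assumes r: "r > 0"
    and F: "\<And>z. F z \<in> borel_measurable M" "\<And>z. z \<in> ball z0 r \<Longrightarrow> integrable M (F z)"
    and F': "F' z0 \<in> borel_measurable M"
    and deriv: "AE x in M. \<forall>z\<in>ball z0 r. ((\<lambda>z. F z x) has_field_derivative F' z x) (at z) \<and> norm (F' z x) \<le> K x"
    and K: "integrable M K"
  shows "((\<lambda>z. \<integral>x. F z x \<partial>M) has_field_derivative (\<integral>x. F' z0 x \<partial>M)) (at z0)"
proof -
  have "((\<lambda>z. \<integral>x. (F z x - F z0 x) / (z - z0) \<partial>M) \<longlongrightarrow> (\<integral>x. F' z0 x \<partial>M)) (at z0)"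
  proof (rule integral_dominated_convergence_within[OF F' _ K])
    show "(\<lambda>x. (F z x - F z0 x) / (z - z0)) \<in> borel_measurable M" for z
      using F(1) by measurable
    show "AE x in M. ((\<lambda>z. (F z x - F z0 x) / (z - z0)) \<longlongrightarrow> F' z0 x) (at z0)"
      using deriv by eventually_elim (use r in \<open>auto simp: has_field_derivative_iff\<close>)
    have "\<forall>\<^sub>F z in at z0. z \<in> ball z0 r - {z0}"
      using r by (intro eventually_at_in_open) auto
    then show "\<forall>\<^sub>F z in at z0. AE x in M. norm ((F z x - F z0 x) / (z - z0)) \<le> K x"
    proof eventually_elim
      case (elim z)
      show ?case using deriv
      proof eventually_elim
        case (elim x)
        have "norm (F z x - F z0 x) \<le> K x * norm (z - z0)"
          by (rule field_differentiable_bound[where S = "ball z0 r" and f' = "\<lambda>z. F' z x"])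
            (use elim \<open>z \<in> ball z0 r - {z0}\<close> r in \<open>auto intro: has_field_derivative_at_within\<close>)
        then show ?case using \<open>z \<in> ball z0 r - {z0}\<close> by (simp add: norm_divide divide_le_eq)
      qed
    qed
  qed
  moreover have "\<forall>\<^sub>F z in at z0. (\<integral>x. (F z x - F z0 x) / (z - z0) \<partial>M) = ((\<integral>x. F z x \<partial>M) - (\<integral>x. F z0 x \<partial>M)) / (z - z0)"
  proof -
    have "\<forall>\<^sub>F z in at z0. z \<in> ball z0 r - {z0}"
      using r by (intro eventually_at_in_open) auto
    then show ?thesis
      by eventually_elim (use F r in \<open>auto simp: Bochner_Integration.integral_diff\<close>)
  qed
  ultimately show ?thesis
    unfolding has_field_derivative_iff by (rule Lim_transform_eventually)
qed

section \<open>Uniqueness for the recursion of transforms\<close>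

text \<open>This is the binomial series with its signs absorbed into rising factorials, so that for
  \<rho> > 0 all terms are nonnegative and it can be compared with another series term by
  term.\<close>

lemma sum_nonneg_binomial:
  fixes a d \<rho> :: real
  assumes "0 < a" "0 \<le> d" "d < a"
  shows "(\<lambda>k. pochhammer \<rho> k / fact k * a powr (- \<rho> - real k) * d ^ k) sums ((a - d) powr (- \<rho>))"
proof -
  have "(\<lambda>n. ((-\<rho>) gchoose n) * a powr (-\<rho> - real n) * (-d) ^ n) sums (a + (-d)) powr (-\<rho>)"
    using assms by (intro gen_binomial_real'') simp
  moreover have "((-\<rho>) gchoose n) * a powr (-\<rho> - real n) * (-d) ^ n
      = pochhammer \<rho> n / fact n * a powr (- \<rho> - real n) * d ^ n" for n
    by (simp add: gbinomial_pochhammer power_minus[of d])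
  ultimately show ?thesis by simp
qed

text \<open>Since pochhammer \<rho> (N+1) = \<rho> * pochhammer (\<rho>+1) N, these are, up to the
  factor \<rho>, the terms of the convergent binomial series with exponent -(\<rho>+1). They will
  bound a Taylor remainder.\<close>

lemma pochhammer_geometric_tendsto_0:
  fixes \<rho> \<kappa> :: real
  assumes "0 \<le> \<kappa>" "\<kappa> < 1"
  shows "(\<lambda>N. pochhammer \<rho> (Suc N) / fact N * \<kappa> ^ N) \<longlonglongrightarrow> 0"
proof -
  have "(\<lambda>k. pochhammer (\<rho>+1) k / fact k * 1 powr (- (\<rho>+1) - real k) * \<kappa> ^ k) sums ((1 - \<kappa>) powr (- (\<rho>+1)))"
    using assms by (intro sum_nonneg_binomial) auto
  then have "(\<lambda>k. pochhammer (\<rho>+1) k / fact k * \<kappa> ^ k) \<longlonglongrightarrow> 0"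
    by (intro summable_LIMSEQ_zero) (simp add: sums_iff)
  then have "(\<lambda>k. \<rho> * (pochhammer (\<rho>+1) k / fact k * \<kappa> ^ k)) \<longlonglongrightarrow> \<rho> * 0" by (intro tendsto_intros)
  then show ?thesis by (simp add: pochhammer_rec mult.assoc)
qed

text \<open>With \<open>\<rho> = \<theta>/\<alpha>\<close>, the sum \<open>T N\<close> below is the Taylor polynomial at \<open>m z\<close> of \<open>u 0\<close> regarded
  as a function of \<open>m z\<close>, evaluated at \<open>m z0\<close>; its derivative in \<open>z\<close> telescopes.\<close>

lemma stieltjes_recursion_unique:
  fixes u :: "nat \<Rightarrow> real \<Rightarrow> real" and m h :: "real \<Rightarrow> real"
  assumes \<alpha>: "0 < \<alpha>" "\<alpha> < 1" and \<theta>: "0 < \<theta>" and B: "0 \<le> B"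
    and u_bounds: "\<And>n z. z > 0 \<Longrightarrow> (z + B) powr (- (\<theta> + real n * \<alpha>)) \<le> u n z"
                  "\<And>n z. z > 0 \<Longrightarrow> u n z \<le> z powr (- (\<theta> + real n * \<alpha>))"
    and u_deriv: "\<And>n z. z > 0 \<Longrightarrow> (u n has_real_derivative (- (\<theta> + real n * \<alpha>) * h z * u (Suc n) z)) (at z)"
    and m_deriv: "\<And>z. z > 0 \<Longrightarrow> (m has_real_derivative (\<alpha> * h z)) (at z)"
    and h_bounds: "\<And>z. z > 0 \<Longrightarrow> 0 \<le> h z" "\<And>z. z > 0 \<Longrightarrow> h z \<le> z powr (\<alpha> - 1)"
    and m_bounds: "\<And>z. z > 0 \<Longrightarrow> z powr \<alpha> \<le> m z" "\<And>z. z > 0 \<Longrightarrow> m z \<le> (z + B) powr \<alpha>"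
    and m_diff: "\<And>z w. 0 < z \<Longrightarrow> z \<le> w \<Longrightarrow> m w - m z \<le> w powr \<alpha> - z powr \<alpha>"
    and z0: "0 < z0"
  shows "u 0 z0 = m z0 powr (- \<theta> / \<alpha>)"
proof -
  define \<rho> where "\<rho> = \<theta> / \<alpha>"
  have \<rho>: "\<rho> > 0" "\<theta> = \<rho> * \<alpha>" using \<alpha> \<theta> by (auto simp: \<rho>_def)
  have th: "\<theta> + real n * \<alpha> = \<alpha> * (\<rho> + real n)" for n by (simp add: \<rho>(2) algebra_simps)
  have m_mono: "m z \<le> m w" if "0 < z" "z \<le> w" for z w
  proof (rule DERIV_nonneg_imp_nondecreasing[OF that(2)])
    fix x assume "z \<le> x"
    then have "x > 0" using that by simp
    then show "\<exists>y. (m has_real_derivative y) (at x) \<and> 0 \<le> y"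
      using m_deriv h_bounds \<alpha> by (intro exI[of _ "\<alpha> * h x"]) auto
  qed
  have m_pos: "m z > 0" if "z > 0" for z using m_bounds(1)[OF that] that powr_gt_zero[of z \<alpha>] by linarith
  have u_nonneg: "0 \<le> u n z" if "z > 0" for n z using u_bounds(1)[OF that, of n] by (rule order.trans[OF powr_ge_zero])
  define T where "T N z = (\<Sum>k<N. pochhammer \<rho> k / fact k * u k z * (m z - m z0) ^ k)" for N z
  have T_deriv: "(T (Suc N) has_real_derivative
      - (\<alpha> * h z * (pochhammer \<rho> (Suc N) / fact N) * u (Suc N) z * (m z - m z0) ^ N)) (at z)" if z: "z > 0" for N z
  proof (induction N)
    case 0
    have "T (Suc 0) = u 0" by (simp add: T_def fun_eq_iff)
    then show ?case using u_deriv[OF z, of 0] by (simp add: \<rho>(2) mult_ac)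
  next
    case (Suc N)
    have "T (Suc (Suc N)) = (\<lambda>z. T (Suc N) z + pochhammer \<rho> (Suc N) / fact (Suc N) * u (Suc N) z * (m z - m z0) ^ Suc N)"
      by (simp add: T_def fun_eq_iff)
    moreover have "((\<lambda>z. T (Suc N) z + pochhammer \<rho> (Suc N) / fact (Suc N) * u (Suc N) z * (m z - m z0) ^ Suc N)
      has_real_derivative
       - (\<alpha> * h z * (pochhammer \<rho> (Suc N) / fact N) * u (Suc N) z * (m z - m z0) ^ N)
       + (pochhammer \<rho> (Suc N) / fact (Suc N) * (- (\<theta> + real (Suc N) * \<alpha>) * h z * u (Suc (Suc N)) z) * (m z - m z0) ^ Suc N
          + pochhammer \<rho> (Suc N) / fact (Suc N) * u (Suc N) z * (real (Suc N) * (m z - m z0) ^ N * (\<alpha> * h z)))) (at z)"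
      by (rule derivative_eq_intros Suc.IH u_deriv[OF z] m_deriv[OF z] refl)+ simp
    \<comment> \<open>The telescoping: differentiating the power in the new summand cancels the
      derivative of the old sum, and differentiating its factor \<open>u\<close> leaves the next
      remainder.\<close>
    moreover have "pochhammer \<rho> (Suc N) / fact (Suc N) * u (Suc N) z * (real (Suc N) * (m z - m z0) ^ N * (\<alpha> * h z))
       = \<alpha> * h z * (pochhammer \<rho> (Suc N) / fact N) * u (Suc N) z * (m z - m z0) ^ N"
      by (simp add: fact_Suc field_simps del: of_nat_Suc)
    moreover have "pochhammer \<rho> (Suc N) / fact (Suc N) * (- (\<theta> + real (Suc N) * \<alpha>) * h z * u (Suc (Suc N)) z) * (m z - m z0) ^ Suc N
       = - (\<alpha> * h z * (pochhammer \<rho> (Suc (Suc N)) / fact (Suc N)) * u (Suc (Suc N)) z * (m z - m z0) ^ (Suc N))"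
      unfolding th pochhammer_Suc[of \<rho> "Suc N"] by (simp only: mult_ac times_divide_eq_left times_divide_eq_right mult_minus_left mult_minus_right minus_divide_left)
    ultimately show ?case by simp
  qed
  have T_z0: "T (Suc N) z0 = u 0 z0" for N
    unfolding T_def by (subst sum.lessThan_Suc_shift) simp
  have T_lim: "(\<lambda>N. T N z1) \<longlonglongrightarrow> u 0 z0" if z1: "z0 < z1" for z1
  proof -
    \<comment> \<open>For the mean value point \<xi> between z0 and z1, which varies with N,
      \<open>m_diff\<close> bounds (m \<xi> - m z0) / \<xi> powr \<alpha> by 1 - (z0 / \<xi>) powr
      \<alpha>; this increases with \<xi> and stays below \<open>\<kappa>\<close>.\<close>
    define \<kappa> where "\<kappa> = 1 - (z0 / z1) powr \<alpha>"
    have \<kappa>: "0 \<le> \<kappa>" "\<kappa> < 1"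
      using z0 z1 \<alpha> by (auto simp: \<kappa>_def powr_le1)
    define C where "C = (z1 - z0) * \<alpha> * z0 powr (\<alpha> - 1) * z0 powr (- \<alpha> * (\<rho> + 1))"
    have bound: "\<bar>T (Suc N) z1 - u 0 z0\<bar> \<le> C * (pochhammer \<rho> (Suc N) / fact N * \<kappa> ^ N)" for N
    proof -
      have "\<exists>\<xi>>z0. \<xi> < z1 \<and> T (Suc N) z1 - T (Suc N) z0 = (z1 - z0) * - (\<alpha> * h \<xi> * (pochhammer \<rho> (Suc N) / fact N) * u (Suc N) \<xi> * (m \<xi> - m z0) ^ N)"
        by (rule MVT2[OF z1]) (use z0 T_deriv in auto)
      then obtain \<xi> where \<xi>: "z0 < \<xi>" "\<xi> < z1"
        "T (Suc N) z1 - u 0 z0 = (z1 - z0) * - (\<alpha> * h \<xi> * (pochhammer \<rho> (Suc N) / fact N) * u (Suc N) \<xi> * (m \<xi> - m z0) ^ N)"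
        unfolding T_z0 by blast
      have p: "0 \<le> pochhammer \<rho> (Suc N) / fact N" using \<rho> by (simp add: pochhammer_nonneg)
      have p': "0 \<le> pochhammer \<rho> (Suc N)" using \<rho> by (intro pochhammer_nonneg)
      have md: "0 \<le> m \<xi> - m z0" using m_mono[OF z0] \<xi> by simp
      \<comment> \<open>The N-th power of \<xi> powr (-\<alpha>) is kept apart, to be paired with
        the N-th power of m \<xi> - m z0. The remaining power of \<xi> is replaced by that of z0, so
        that \<open>C\<close> depends neither on \<xi> nor on N.\<close>
      have "u (Suc N) \<xi> \<le> \<xi> powr (- \<alpha> * (\<rho> + real (Suc N)))" using u_bounds(2)[of \<xi> "Suc N", unfolded th] z0 \<xi> by simp
      also have "\<dots> = \<xi> powr (- \<alpha> * (\<rho> + 1)) * (\<xi> powr (-\<alpha>)) ^ N"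
        using z0 \<xi> by (simp add: powr_powr powr_add[symmetric] algebra_simps flip: powr_realpow)
      also have "\<dots> \<le> z0 powr (- \<alpha> * (\<rho> + 1)) * (\<xi> powr (-\<alpha>)) ^ N"
        using z0 \<xi> \<alpha> \<rho> by (intro mult_right_mono powr_mono2') (auto intro: mult_nonneg_nonneg)
      finally have u1: "u (Suc N) \<xi> \<le> z0 powr (- \<alpha> * (\<rho> + 1)) * (\<xi> powr (-\<alpha>)) ^ N" .
      have h1: "h \<xi> \<le> z0 powr (\<alpha> - 1)"
        using h_bounds(2)[of \<xi>] powr_mono2'[of "\<alpha> - 1" z0 \<xi>] z0 \<xi> \<alpha> by simp
      have "\<xi> powr (-\<alpha>) * (m \<xi> - m z0) \<le> \<xi> powr (-\<alpha>) * (\<xi> powr \<alpha> - z0 powr \<alpha>)"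
        using m_diff[OF z0, of \<xi>] \<xi> by (intro mult_left_mono) auto
      also have "\<dots> = 1 - (z0 / \<xi>) powr \<alpha>"
        using z0 \<xi> by (simp add: algebra_simps powr_divide powr_minus field_simps)
      also have "\<dots> \<le> \<kappa>"
        unfolding \<kappa>_def using z0 \<xi> \<alpha> by (intro diff_left_mono powr_mono2) (auto intro: divide_left_mono)
      finally have k1: "\<xi> powr (-\<alpha>) * (m \<xi> - m z0) \<le> \<kappa>" .
      have "\<bar>T (Suc N) z1 - u 0 z0\<bar> = (z1 - z0) * \<alpha> * h \<xi> * (pochhammer \<rho> (Suc N) / fact N) * u (Suc N) \<xi> * (m \<xi> - m z0) ^ N"
        unfolding \<xi>(3) abs_mult using z1 z0 \<xi> \<alpha> p p' md h_bounds(1)[of \<xi>] u_nonneg[of \<xi> "Suc N"]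
        by (simp add: abs_mult mult.assoc)
      also have "\<dots> \<le> (z1 - z0) * \<alpha> * z0 powr (\<alpha> - 1) * (pochhammer \<rho> (Suc N) / fact N) * (z0 powr (- \<alpha> * (\<rho> + 1)) * (\<xi> powr (-\<alpha>)) ^ N) * (m \<xi> - m z0) ^ N"
        using z1 z0 \<xi> \<alpha> p md h_bounds(1)[of \<xi>] u_nonneg[of \<xi> "Suc N"] u1 h1
        by (intro mult_mono mult_nonneg_nonneg order.refl) auto
      also have "\<dots> = C * (pochhammer \<rho> (Suc N) / fact N * (\<xi> powr (-\<alpha>) * (m \<xi> - m z0)) ^ N)"
        by (simp only: C_def power_mult_distrib mult_ac)
      also have "\<dots> \<le> C * (pochhammer \<rho> (Suc N) / fact N * \<kappa> ^ N)"
        using z1 \<alpha> p md k1 by (intro mult_left_mono power_mono) (auto simp: C_def)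
      finally show ?thesis .
    qed
    have lim: "(\<lambda>N. C * (pochhammer \<rho> (Suc N) / fact N * \<kappa> ^ N)) \<longlonglongrightarrow> 0"
      using pochhammer_geometric_tendsto_0[OF \<kappa>, of \<rho>] by (rule tendsto_mult_right_zero)
    have "(\<lambda>N. T (Suc N) z1 - u 0 z0) \<longlonglongrightarrow> 0"
    proof (rule Lim_null_comparison[OF _ lim])
      show "\<forall>\<^sub>F N in sequentially. norm (T (Suc N) z1 - u 0 z0) \<le> C * (pochhammer \<rho> (Suc N) / fact N * \<kappa> ^ N)"
        unfolding real_norm_def by (intro always_eventually allI bound)
    qed
    then have "(\<lambda>N. T (Suc N) z1) \<longlonglongrightarrow> u 0 z0" by (rule LIM_zero_cancel)
    then show ?thesis by (subst (asm) filterlim_sequentially_Suc)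
  qed
  \<comment> \<open>Inserting the two bounds on \<open>u k z1\<close> into the Taylor series gives
    binomial series in m z1 - m z0, with sums in closed form. They converge because
    \<open>m_diff\<close> keeps m z1 - m z0 below z1 powr \<alpha>.\<close>
  have sandwich: "((z1 + B) powr \<alpha> - m z1 + m z0) powr (- \<rho>) \<le> u 0 z0 \<and> u 0 z0 \<le> (z1 powr \<alpha> - m z1 + m z0) powr (- \<rho>)"
    if z1: "z0 < z1" for z1
  proof -
    have "0 < z0 powr \<alpha>" using z0 by simp
    then have d: "0 \<le> m z1 - m z0" "m z1 - m z0 < z1 powr \<alpha>"
      using m_mono[OF z0 less_imp_le[OF z1]] m_diff[OF z0 less_imp_le[OF z1]] by linarith+
    have zB: "z1 powr \<alpha> \<le> (z1 + B) powr \<alpha>" using z0 z1 B \<alpha> by (intro powr_mono2) auto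
    have p: "0 \<le> pochhammer \<rho> N / fact N" for N using \<rho> by (simp add: pochhammer_nonneg)
    have pow: "x powr (- (\<theta> + real k * \<alpha>)) = (x powr \<alpha>) powr (- \<rho> - real k)" for x k
      unfolding th powr_powr by (simp add: algebra_simps)
    have l1: "(\<lambda>k. pochhammer \<rho> k / fact k * ((z1 + B) powr \<alpha>) powr (- \<rho> - real k) * (m z1 - m z0) ^ k) sums
      (((z1 + B) powr \<alpha> - (m z1 - m z0)) powr (- \<rho>))"
      using d zB z0 z1 by (intro sum_nonneg_binomial) auto
    have l2: "(\<lambda>k. pochhammer \<rho> k / fact k * (z1 powr \<alpha>) powr (- \<rho> - real k) * (m z1 - m z0) ^ k) sums
      ((z1 powr \<alpha> - (m z1 - m z0)) powr (- \<rho>))"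
      using d z0 z1 by (intro sum_nonneg_binomial) auto
    have l3: "(\<lambda>k. pochhammer \<rho> k / fact k * u k z1 * (m z1 - m z0) ^ k) sums u 0 z0"
      using T_lim[OF z1] unfolding sums_def T_def .
    have "((z1 + B) powr \<alpha> - (m z1 - m z0)) powr (- \<rho>) \<le> u 0 z0"
      by (rule sums_le[OF _ l1 l3]) (unfold pow[symmetric], intro mult_right_mono mult_left_mono zero_le_power, use d p u_bounds(1) z0 z1 in auto)
    moreover have "u 0 z0 \<le> (z1 powr \<alpha> - (m z1 - m z0)) powr (- \<rho>)"
      by (rule sums_le[OF _ l3 l2]) (unfold pow[symmetric], intro mult_right_mono mult_left_mono zero_le_power, use d p u_bounds(2) z0 z1 in auto)
    ultimately show ?thesis by (simp add: algebra_simps)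
  qed
  \<comment> \<open>For \<alpha> < 1 the increment of the power over the fixed length B vanishes at
    infinity, and m z lies between the two powers. Both ends of the sandwich therefore tend to m z0
    powr (-\<rho>).\<close>
  have lim0: "((\<lambda>z. (z + B) powr \<alpha> - z powr \<alpha>) \<longlongrightarrow> 0) at_top"
    using \<alpha> by real_asymp
  have "((\<lambda>z. (z + B) powr \<alpha> - m z) \<longlongrightarrow> 0) at_top"
    by (rule tendsto_sandwich[OF _ _ tendsto_const lim0])
       (auto intro!: eventually_at_top_linorderI[of 1] simp: m_bounds)
  then have l1: "((\<lambda>z. ((z + B) powr \<alpha> - m z + m z0) powr (- \<rho>)) \<longlongrightarrow> (0 + m z0) powr (- \<rho>)) at_top"
    using m_pos[OF z0] by (intro tendsto_intros) auto
  have lim0': "((\<lambda>z. - ((z + B) powr \<alpha> - z powr \<alpha>)) \<longlongrightarrow> - 0) at_top"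
    using lim0 by (intro tendsto_intros)
  have "((\<lambda>z. z powr \<alpha> - m z) \<longlongrightarrow> 0) at_top"
    by (rule tendsto_sandwich[OF _ _ lim0'[simplified] tendsto_const])
       (auto intro!: eventually_at_top_linorderI[of 1] simp: m_bounds)
  then have l2: "((\<lambda>z. (z powr \<alpha> - m z + m z0) powr (- \<rho>)) \<longlongrightarrow> (0 + m z0) powr (- \<rho>)) at_top"
    using m_pos[OF z0] by (intro tendsto_intros) auto
  have "m z0 powr (-\<rho>) \<le> u 0 z0"
    by (rule tendsto_upperbound[OF l1[simplified]]) (use sandwich in \<open>auto intro!: eventually_at_top_linorderI[of "z0 + 1"]\<close>)
  moreover have "u 0 z0 \<le> m z0 powr (-\<rho>)"
    by (rule tendsto_lowerbound[OF l2[simplified]]) (use sandwich in \<open>auto intro!: eventually_at_top_linorderI[of "z0 + 1"]\<close>)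
  ultimately show ?thesis by (simp add: \<rho>_def)
qed

section \<open>Stick breaking and the transform identity on the positive axis\<close>

lemma beta_density_nonneg: "beta_density a b v \<ge> 0" if "a > 0" "b > 0"
  using that by (auto simp: beta_density_def Beta_def intro!: divide_nonneg_nonneg mult_nonneg_nonneg Gamma_real_nonneg)

lemma borel_measurable_beta_density [measurable]: "beta_density a b \<in> borel_measurable borel"
  unfolding beta_density_def by measurable

lemma beta_measure_AE: "AE v in beta_measure a b. 0 < v \<and> v < 1"
  unfolding beta_measure_def by (subst AE_density) (auto simp: beta_density_def)

text \<open>The Moebius substitution \<open>w = v x / (v x + (1 - v) y)\<close>.\<close>
lemma beta_measure_mixture_powr:
  assumes a: "a > 0" and b: "b > 0" and x: "x > 0" and y: "y > 0"
    and prob: "prob_space (beta_measure a b)"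
  shows "(\<integral>\<^sup>+v. ennreal ((v * x + (1 - v) * y) powr (-(a + b))) \<partial>beta_measure a b)
    = ennreal (x powr (-a) * y powr (-b))"
proof -
  define D where "D v = v * x + (1 - v) * y" for v
  define g where "g v = v * x / D v" for v
  define g' where "g' v = x * y / (D v)\<^sup>2" for v
  have D_pos: "D v > 0" if "v \<in> {0..1}" for v
  proof (cases "v = 0")
    case False
    then have "v * x > 0" "(1 - v) * y \<ge> 0" using that x y by auto
    then show ?thesis by (simp add: D_def)
  qed (use y in \<open>simp add: D_def\<close>)
  have [measurable]: "D \<in> borel_measurable borel" unfolding D_def by measurable
  \<comment> \<open>The normalisation is read off \<open>prob\<close>; the Beta integral is never
    evaluated.\<close>
  have one: "(\<integral>\<^sup>+v. ennreal (beta_density a b v) \<partial>lborel) = 1"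
    using prob_space.emeasure_space_1[OF prob] by (simp add: beta_measure_def emeasure_density)
  have "(\<integral>\<^sup>+w. ennreal (beta_density a b w * indicator {g 0..g 1} w) \<partial>lborel) =
     (\<integral>\<^sup>+v. ennreal (beta_density a b (g v) * g' v * indicator {0..1} v) \<partial>lborel)"
  proof (rule nn_integral_substitution)
    show "(g has_real_derivative g' v) (at v)" if "v \<in> {0..1}" for v
    proof -
      have "(g has_real_derivative ((x * D v - v * x * (x - y)) / (D v * D v))) (at v)"
        unfolding g_def using D_pos[OF that]
        by (intro DERIV_divide) (auto intro!: derivative_eq_intros simp: D_def)
      moreover have "x * D v - v * x * (x - y) = x * y" by (simp add: D_def algebra_simps)
      ultimately show ?thesis by (simp add: g'_def power2_eq_square)
    qed
    have "v * x + (1 - v) * y \<noteq> 0" if "v \<in> {0..1}" for v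
      using D_pos[OF that] by (simp add: D_def)
    then show "continuous_on {0..1} g'"
      unfolding g'_def D_def by (intro continuous_intros) auto
  qed (use x y in \<open>auto simp: g'_def set_borel_measurable_def\<close>)
  moreover have "g 0 = 0" "g 1 = 1" using x by (auto simp: g_def D_def)
  moreover have "beta_density a b w * indicator {0..1} w = beta_density a b w" for w
    by (auto simp: beta_density_def indicator_def)
  ultimately have "1 = (\<integral>\<^sup>+v. ennreal (beta_density a b (g v) * g' v * indicator {0..1} v) \<partial>lborel)"
    by (simp add: one)
  also have "\<dots> = (\<integral>\<^sup>+v. ennreal (x powr a * y powr b) * (ennreal (beta_density a b v) * ennreal (D v powr (-(a + b)))) \<partial>lborel)"
  proof (rule nn_integral_cong)
    fix v :: real
    have "beta_density a b (g v) * g' v * indicator {0..1} v = x powr a * y powr b * (beta_density a b v * D v powr (-(a + b)))"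
    proof (cases "0 < v \<and> v < 1")
      case True
      have D: "D v > 0" using D_pos True by auto
      have "1 - g v = (1 - v) * y / D v" using D by (simp add: g_def field_simps) (simp add: D_def algebra_simps)
      moreover have "0 < g v" using True D x by (simp add: g_def)
      moreover have "0 < (1 - v) * y / D v" using True D y by simp
      ultimately have "beta_density a b (g v) = (v * x / D v) powr (a - 1) * ((1 - v) * y / D v) powr (b - 1) / Beta a b"
        by (simp add: beta_density_def) (simp add: g_def)
      also have "\<dots> = v powr (a - 1) * (1 - v) powr (b - 1) / Beta a b * (x powr (a - 1) * y powr (b - 1) / (D v powr (a - 1) * D v powr (b - 1)))"
        using True D x y by (simp add: powr_mult powr_divide mult_ac)
      also have "x powr (a - 1) * y powr (b - 1) / (D v powr (a - 1) * D v powr (b - 1)) = x powr a * y powr b * D v powr (-(a + b)) / g' v"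
        using x y D by (simp add: g'_def powr_diff powr_minus powr_add power2_eq_square field_simps)
      finally show ?thesis using True x y D by (simp add: beta_density_def g'_def)
    next
      case False
      then have "g' v = 0 \<or> \<not> (0 < g v \<and> g v < 1) \<or> v \<notin> {0..1}"
        using x y D_pos by (cases "v = 0 \<or> v = 1") (auto simp: g_def D_def)
      then show ?thesis using False by (auto simp: beta_density_def)
    qed
    then show "ennreal (beta_density a b (g v) * g' v * indicator {0..1} v) =
        ennreal (x powr a * y powr b) * (ennreal (beta_density a b v) * ennreal (D v powr (-(a + b))))"
      using beta_density_nonneg[OF a b] by (simp add: ennreal_mult'')
  qed
  also have "\<dots> = ennreal (x powr a * y powr b) * (\<integral>\<^sup>+v. ennreal (D v powr (-(a + b))) \<partial>beta_measure a b)"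
    unfolding beta_measure_def by (subst nn_integral_cmult) (auto simp: nn_integral_density)
  finally have eq: "ennreal (x powr a * y powr b) * (\<integral>\<^sup>+v. ennreal (D v powr (-(a + b))) \<partial>beta_measure a b) = 1" by simp
  have "(\<integral>\<^sup>+v. ennreal (D v powr (-(a + b))) \<partial>beta_measure a b)
    = ennreal (x powr (-a) * y powr (-b)) * ennreal (x powr a * y powr b) * (\<integral>\<^sup>+v. ennreal (D v powr (-(a + b))) \<partial>beta_measure a b)"
    using x y by (simp add: ennreal_mult''[symmetric] powr_minus field_simps)
  also have "\<dots> = ennreal (x powr (-a) * y powr (-b))" unfolding mult.assoc eq by simp
  finally show ?thesis by (simp add: D_def)
qed

section \<open>Joint independence and sums over the sticks\<close>

context prob_space begin

text \<open>A finite index set splits into a stick part and an atom part. The product formula holds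
  inside each part, and the two resulting events lie in the pulled-back \<sigma>-algebras that are
  independent of each other. A single family over the sum type later allows any disjoint blocks of
  coordinates to be separated.\<close>

lemma indep_vars_case_sum:
  fixes V :: "nat \<Rightarrow> 'a \<Rightarrow> real" and Z :: "nat \<Rightarrow> 'a \<Rightarrow> 'x" and f :: "'x \<Rightarrow> real"
  assumes V: "indep_vars (\<lambda>_. borel) V UNIV" and Z: "indep_vars (\<lambda>_. H) Z UNIV"
    and f: "f \<in> borel_measurable H"
    and VZ: "indep_set (sets (vimage_algebra (space M) (\<lambda>\<omega> k. V k \<omega>) (PiM UNIV (\<lambda>_. borel))))
        (sets (vimage_algebra (space M) (\<lambda>\<omega> k. Z k \<omega>) (PiM UNIV (\<lambda>_. H))))"
  shows "indep_vars (\<lambda>_. borel) (case_sum V (\<lambda>k \<omega>. f (Z k \<omega>))) UNIV"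
proof -
  define Y where "Y k \<omega> = f (Z k \<omega>)" for k \<omega>
  have Y: "indep_vars (\<lambda>_. borel) Y UNIV"
    unfolding Y_def by (rule indep_vars_compose2[OF Z]) (use f in auto)
  have rvV: "random_variable borel (V k)" and rvZ: "random_variable H (Z k)" and rvY: "random_variable borel (Y k)" for k
    using V Z Y by (auto simp: indep_vars_def)
  define U where "U = case_sum V Y"
  have rvU: "random_variable borel (U i)" for i using rvV rvY by (cases i) (auto simp: U_def)
  have "indep_vars (\<lambda>_. borel) U UNIV"
    unfolding indep_vars_def2
  proof (intro conjI ballI indep_setsI)
    fix A J assume J: "J \<noteq> {}" "J \<subseteq> (UNIV :: (nat + nat) set)" "finite J"
      and "\<forall>j\<in>J. A j \<in> {U j -` B \<inter> space M |B. B \<in> sets borel}"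
    then have "\<forall>j\<in>J. \<exists>B. A j = U j -` B \<inter> space M \<and> B \<in> sets borel" by blast
    from bchoice[OF this] obtain B where B: "\<And>j. j \<in> J \<Longrightarrow> A j = U j -` B j \<inter> space M"
      "\<And>j. j \<in> J \<Longrightarrow> B j \<in> sets borel" by blast
    define J1 where "J1 = Inl -` J"
    define J2 where "J2 = Inr -` J"
    have J_eq: "J = Inl ` J1 \<union> Inr ` J2"
    proof (intro equalityI subsetI)
      fix j assume "j \<in> J" then show "j \<in> Inl ` J1 \<union> Inr ` J2" by (cases j) (auto simp: J1_def J2_def)
    qed (auto simp: J1_def J2_def)
    have fin: "finite J1" "finite J2" using J(3) by (auto simp: J1_def J2_def intro!: finite_vimageI)
    define E1 where "E1 = {\<omega>\<in>space M. \<forall>k\<in>J1. V k \<omega> \<in> B (Inl k)}"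
    define E2 where "E2 = {\<omega>\<in>space M. \<forall>k\<in>J2. Y k \<omega> \<in> B (Inr k)}"
    have B1: "B (Inl k) \<in> sets borel" if "k \<in> J1" for k using that B by (auto simp: J1_def)
    have B2: "B (Inr k) \<in> sets borel" if "k \<in> J2" for k using that B by (auto simp: J2_def)
    have E1: "prob E1 = (\<Prod>k\<in>J1. prob (V k -` B (Inl k) \<inter> space M))"
    proof (cases "J1 = {}")
      case True then show ?thesis by (simp add: E1_def prob_space)
    next
      case False
      then have "E1 = (\<Inter>k\<in>J1. V k -` B (Inl k) \<inter> space M)" by (auto simp: E1_def)
      then show ?thesis using indep_varsD[OF V False fin(1)] B1 by auto
    qed
    have E2: "prob E2 = (\<Prod>k\<in>J2. prob (Y k -` B (Inr k) \<inter> space M))"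
    proof (cases "J2 = {}")
      case True then show ?thesis by (simp add: E2_def prob_space)
    next
      case False
      then have "E2 = (\<Inter>k\<in>J2. Y k -` B (Inr k) \<inter> space M)" by (auto simp: E2_def)
      then show ?thesis using indep_varsD[OF Y False fin(2)] B2 by auto
    qed
    have S1: "E1 \<in> sets (vimage_algebra (space M) (\<lambda>\<omega> k. V k \<omega>) (PiM UNIV (\<lambda>_. borel)))"
    proof -
      have "{p\<in>space (PiM UNIV (\<lambda>_. borel)). \<forall>k\<in>J1. p k \<in> B (Inl k)} \<in> sets (PiM UNIV (\<lambda>_. borel :: real measure))"
      proof (rule sets.sets_Collect_finite_All[OF _ fin(1)])
        fix k assume "k \<in> J1"
        then show "{p\<in>space (PiM UNIV (\<lambda>_. borel)). p k \<in> B (Inl k)} \<in> sets (PiM UNIV (\<lambda>_. borel :: real measure))"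
          using measurable_sets[OF measurable_component_singleton[of k UNIV "\<lambda>_. borel :: real measure"] B1]
          by (simp add: vimage_def Int_def conj_commute)
      qed
      moreover have "E1 = (\<lambda>\<omega> k. V k \<omega>) -` {p\<in>space (PiM UNIV (\<lambda>_. borel)). \<forall>k\<in>J1. p k \<in> B (Inl k)} \<inter> space M"
        by (auto simp: E1_def space_PiM)
      ultimately show ?thesis by (simp only:) (rule in_vimage_algebra)
    qed
    have S2: "E2 \<in> sets (vimage_algebra (space M) (\<lambda>\<omega> k. Z k \<omega>) (PiM UNIV (\<lambda>_. H)))"
    proof -
      have "{p\<in>space (PiM UNIV (\<lambda>_. H)). \<forall>k\<in>J2. p k \<in> f -` B (Inr k) \<inter> space H} \<in> sets (PiM UNIV (\<lambda>_. H))"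
      proof (rule sets.sets_Collect_finite_All[OF _ fin(2)])
        fix k assume "k \<in> J2"
        then show "{p\<in>space (PiM UNIV (\<lambda>_. H)). p k \<in> f -` B (Inr k) \<inter> space H} \<in> sets (PiM UNIV (\<lambda>_. H))"
          using measurable_sets[OF measurable_component_singleton[of k UNIV "\<lambda>_. H"] measurable_sets[OF f B2]]
          by (simp add: vimage_def Int_def conj_commute)
      qed
      moreover have "E2 = (\<lambda>\<omega> k. Z k \<omega>) -` {p\<in>space (PiM UNIV (\<lambda>_. H)). \<forall>k\<in>J2. p k \<in> f -` B (Inr k) \<inter> space H} \<inter> space M"
        using rvZ[THEN measurable_space] by (auto simp: E2_def space_PiM Y_def)
      ultimately show ?thesis by (simp only:) (rule in_vimage_algebra)
    qed
    have "(\<Inter>j\<in>J. A j) = {\<omega>\<in>space M. \<forall>j\<in>J. U j \<omega> \<in> B j}"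
      using J(1) B(1) by auto
    also have "\<dots> = E1 \<inter> E2"
      unfolding E1_def E2_def by (subst J_eq) (auto simp: U_def ball_Un)
    finally have "(\<Inter>j\<in>J. A j) = E1 \<inter> E2" .
    then have "prob (\<Inter>j\<in>J. A j) = prob E1 * prob E2"
      using indep_setD[OF VZ S1 S2] by simp
    also have "\<dots> = (\<Prod>j\<in>J. prob (U j -` B j \<inter> space M))"
      unfolding E1 E2 by (subst J_eq, subst prod.union_disjoint) (auto simp: fin prod.reindex U_def)
    also have "\<dots> = (\<Prod>j\<in>J. prob (A j))" using B by auto
    finally show "prob (\<Inter>j\<in>J. A j) = (\<Prod>j\<in>J. prob (A j))" .
  qed (use rvU in auto)
  then show ?thesis by (simp add: U_def Y_def[abs_def])
qed

end

text \<open>The mean built from what remains after the first \<open>n\<close> sticks. In the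
  stick-breaking setting \<open>V (n + k)\<close> has the law of the k-th stick at parameter
  \<theta> + n\<alpha>, so the means at all these parameters live on one probability space.\<close>

definition stick_sum :: "(nat \<Rightarrow> 'a \<Rightarrow> real) \<Rightarrow> (nat \<Rightarrow> 'a \<Rightarrow> real) \<Rightarrow> nat \<Rightarrow> 'a \<Rightarrow> real" where
  "stick_sum V Y n \<omega> = (\<Sum>k. stick_weights (\<lambda>j. V (n + j)) k \<omega> * Y (n + k) \<omega>)"

lemma stick_weights_partial_sum:
  "(\<Sum>k<N. stick_weights V k \<omega>) = 1 - (\<Prod>j<N. 1 - V j \<omega>)"
  by (induction N) (auto simp: stick_weights_def algebra_simps)

lemma stick_weights_nonneg:
  assumes "\<And>k. 0 < V k \<omega> \<and> V k \<omega> < 1"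
  shows "0 \<le> stick_weights V k \<omega>"
  using assms unfolding stick_weights_def
  by (intro mult_nonneg_nonneg prod_nonneg) (auto simp: less_imp_le)

lemma stick_weights_partial_sum_le_1:
  assumes "\<And>k. 0 < V k \<omega> \<and> V k \<omega> < 1"
  shows "(\<Sum>k<N. stick_weights V k \<omega>) \<le> 1"
proof -
  have "0 \<le> (\<Prod>j<N. 1 - V j \<omega>)"
    using assms by (intro prod_nonneg) (auto simp: less_imp_le)
  then show ?thesis by (simp add: stick_weights_partial_sum)
qed

lemma stick_sum_bounded:
  assumes V: "\<And>k. 0 < V k \<omega> \<and> V k \<omega> < 1" and Y: "\<And>k. 0 \<le> Y k \<omega> \<and> Y k \<omega> \<le> B"
  shows "summable (\<lambda>k. stick_weights (\<lambda>j. V (n + j)) k \<omega> * Y (n + k) \<omega>)"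
    and "0 \<le> stick_sum V Y n \<omega>" and "stick_sum V Y n \<omega> \<le> B"
proof -
  define w where "w k = stick_weights (\<lambda>j. V (n + j)) k \<omega>" for k
  have w: "0 \<le> w k" for k unfolding w_def by (intro stick_weights_nonneg V)
  have B: "0 \<le> B" using Y[of 0] by simp
  have le: "(\<Sum>k<N. w k * Y (n + k) \<omega>) \<le> B" for N
  proof -
    have "(\<Sum>k<N. w k * Y (n + k) \<omega>) \<le> (\<Sum>k<N. w k * B)"
      using w Y by (intro sum_mono mult_left_mono) auto
    also have "\<dots> \<le> 1 * B"
      unfolding sum_distrib_right[symmetric] w_def using B
      by (intro mult_right_mono stick_weights_partial_sum_le_1 V)
    finally show ?thesis by simp
  qed
  have nonneg: "0 \<le> w k * Y (n + k) \<omega>" for k using w Y by simp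
  show sm: "summable (\<lambda>k. stick_weights (\<lambda>j. V (n + j)) k \<omega> * Y (n + k) \<omega>)"
    unfolding w_def[symmetric] by (intro summableI_nonneg_bounded[OF nonneg le])
  show "0 \<le> stick_sum V Y n \<omega>"
    unfolding stick_sum_def by (intro suminf_nonneg sm) (use nonneg in \<open>simp add: w_def\<close>)
  show "stick_sum V Y n \<omega> \<le> B"
    unfolding stick_sum_def by (intro suminf_le_const sm) (use le in \<open>simp add: w_def\<close>)
qed

lemma stick_sum_rec:
  assumes V: "\<And>k. 0 < V k \<omega> \<and> V k \<omega> < 1" and Y: "\<And>k. 0 \<le> Y k \<omega> \<and> Y k \<omega> \<le> B"
  shows "stick_sum V Y n \<omega> = V n \<omega> * Y n \<omega> + (1 - V n \<omega>) * stick_sum V Y (Suc n) \<omega>"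
proof -
  have S: "stick_weights (\<lambda>j. V (n + j)) (Suc k) \<omega> = (1 - V n \<omega>) * stick_weights (\<lambda>j. V (Suc n + j)) k \<omega>" for k
    unfolding stick_weights_def by (subst prod.lessThan_Suc_shift) (simp add: mult_ac)
  have "stick_sum V Y n \<omega> = stick_weights (\<lambda>j. V (n + j)) 0 \<omega> * Y n \<omega>
     + (\<Sum>k. stick_weights (\<lambda>j. V (n + j)) (Suc k) \<omega> * Y (n + Suc k) \<omega>)"
    unfolding stick_sum_def
    using suminf_split_head[OF stick_sum_bounded(1)[where n = n and V = V and Y = Y and \<omega> = \<omega>, OF V Y]] by simp
  also have "(\<Sum>k. stick_weights (\<lambda>j. V (n + j)) (Suc k) \<omega> * Y (n + Suc k) \<omega>)
     = (\<Sum>k. (1 - V n \<omega>) * (stick_weights (\<lambda>j. V (Suc n + j)) k \<omega> * Y (Suc n + k) \<omega>))"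
    by (simp add: S mult.assoc)
  also have "\<dots> = (1 - V n \<omega>) * stick_sum V Y (Suc n) \<omega>"
    unfolding stick_sum_def by (intro suminf_mult stick_sum_bounded(1)[where n = "Suc n" and V = V and Y = Y and \<omega> = \<omega>, OF V Y])
  finally show ?thesis by (simp add: stick_weights_def)
qed

lemma borel_measurable_stick_sum [measurable]:
  assumes [measurable]: "\<And>k. V k \<in> borel_measurable M" "\<And>k. Y k \<in> borel_measurable M"
  shows "stick_sum V Y n \<in> borel_measurable M"
  unfolding stick_sum_def[abs_def] stick_weights_def by measurable

text \<open>\<open>Y k\<close> stands for f (Z k) and \<eta> for its law, so that the space of atoms
  disappears from the argument.\<close>

locale stick_breaking = prob_space +
  fixes \<alpha> \<theta> :: real and V Y :: "nat \<Rightarrow> 'a \<Rightarrow> real" and \<eta> :: "real measure"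
  assumes \<alpha>: "0 < \<alpha>" "\<alpha> < 1" and \<theta>: "0 < \<theta>"
    and distr_V: "\<And>k. distr M borel (V k) = beta_measure (1 - \<alpha>) (\<theta> + real (Suc k) * \<alpha>)"
    and distr_Y: "\<And>k. distr M borel (Y k) = \<eta>"
    and indep: "indep_vars (\<lambda>_. borel) (case_sum V Y) UNIV"
    and Y_nonneg: "\<And>k \<omega>. 0 \<le> Y k \<omega>"
begin

lemma rv_V [measurable]: "V k \<in> borel_measurable M"
  using indep unfolding indep_vars_def by (metis UNIV_I sum.case(1))

lemma rv_Y [measurable]: "Y k \<in> borel_measurable M"
  using indep unfolding indep_vars_def by (metis UNIV_I sum.case(2))

lemma AE_V: "AE \<omega> in M. \<forall>k. 0 < V k \<omega> \<and> V k \<omega> < 1"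
  unfolding AE_all_countable
proof
  fix k
  have "AE v in distr M borel (V k). 0 < v \<and> v < 1"
    unfolding distr_V by (rule beta_measure_AE)
  then show "AE \<omega> in M. 0 < V k \<omega> \<and> V k \<omega> < 1"
    by (subst (asm) AE_distr_iff) auto
qed

text \<open>Truncation keeps the series summable and \<open>X B n\<close> almost surely in [0, B],
  which yields the two-sided bounds of \<open>stieltjes_recursion_unique\<close>.\<close>

definition Yt :: "real \<Rightarrow> nat \<Rightarrow> 'a \<Rightarrow> real" where "Yt B k \<omega> = min (Y k \<omega>) B"

abbreviation X :: "real \<Rightarrow> nat \<Rightarrow> 'a \<Rightarrow> real" where "X B \<equiv> stick_sum V (Yt B)"

lemma rv_Yt [measurable]: "Yt B k \<in> borel_measurable M"
  unfolding Yt_def[abs_def] by measurable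

lemma Yt_bounds: "0 \<le> B \<Longrightarrow> 0 \<le> Yt B k \<omega> \<and> Yt B k \<omega> \<le> B"
  using Y_nonneg by (auto simp: Yt_def)

lemma X_measurable [measurable]: "X B n \<in> borel_measurable M"
  by measurable

lemma AE_X_bounds:
  assumes "0 \<le> B" shows "AE \<omega> in M. \<forall>n. 0 \<le> X B n \<omega> \<and> X B n \<omega> \<le> B"
  using AE_V
proof eventually_elim
  case (elim \<omega>)
  show ?case
    using assms stick_sum_bounded(2,3)[of V \<omega> "Yt B" B] elim Yt_bounds by simp
qed

text \<open>The stick \<open>V n\<close>, the value \<open>Yt B n\<close> and the tail from n + 1 on
  are measurable functions of disjoint blocks of the joint family.\<close>

lemma indep_tail:
  "distr M (borel \<Otimes>\<^sub>M (borel \<Otimes>\<^sub>M borel)) (\<lambda>\<omega>. (V n \<omega>, (Yt B n \<omega>, X B (Suc n) \<omega>)))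
    = distr M borel (V n) \<Otimes>\<^sub>M distr M (borel \<Otimes>\<^sub>M borel) (\<lambda>\<omega>. (Yt B n \<omega>, X B (Suc n) \<omega>))"
  "distr M (borel \<Otimes>\<^sub>M borel) (\<lambda>\<omega>. (Yt B n \<omega>, X B (Suc n) \<omega>))
    = distr M borel (Yt B n) \<Otimes>\<^sub>M distr M borel (X B (Suc n))"
proof -
  define U where "U = case_sum V Y"
  define J where "J = (Inl ` {n<..} \<union> Inr ` {n<..} :: (nat + nat) set)"
  \<comment> \<open>\<open>G\<close> rebuilds the tail from a point of the product space. It reads
    only the coordinates in \<open>J\<close>, so restricting to any block that contains
    \<open>J\<close> leaves its value unchanged.\<close>
  define G where "G p = stick_sum (\<lambda>k p. p (Inl k)) (\<lambda>k p. min (p (Inr k)) B) (Suc n) p" for p :: "nat + nat \<Rightarrow> real"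
  have G: "G \<in> borel_measurable (PiM K (\<lambda>_. borel))" if "J \<subseteq> K" for K
  proof -
    have *: "(\<lambda>p. p (Inl (Suc n + k))) \<in> borel_measurable (PiM K (\<lambda>_. borel))"
         "(\<lambda>p. p (Inr (Suc n + k))) \<in> borel_measurable (PiM K (\<lambda>_. borel))" for k
      using that by (intro measurable_component_singleton; force simp: J_def)+
    show ?thesis
      unfolding G_def[abs_def] stick_sum_def stick_weights_def
      using * by measurable
  qed
  have GU: "G (restrict (\<lambda>i. U i \<omega>) K) = X B (Suc n) \<omega>" if "J \<subseteq> K" for K \<omega>
  proof -
    have "Inl (Suc n + k) \<in> K" "Inr (Suc n + k) \<in> K" for k
      using that by (force simp: J_def)+
    then show ?thesis unfolding G_def stick_sum_def stick_weights_def U_def by (simp add: Yt_def)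
  qed
  have rest: "indep_vars (\<lambda>j. PiM (case_bool K1 K2 j) (\<lambda>_. borel)) (\<lambda>j \<omega>. restrict (\<lambda>i. U i \<omega>) (case_bool K1 K2 j)) UNIV"
    if "K1 \<inter> K2 = {}" for K1 K2
    using indep unfolding U_def[symmetric]
    by (rule indep_vars_restrict) (use that in \<open>auto simp: disjoint_family_on_def split: bool.splits\<close>)
  have 2: "distr M (N1 \<Otimes>\<^sub>M N2) (\<lambda>\<omega>. (g1 (restrict (\<lambda>i. U i \<omega>) K1), g2 (restrict (\<lambda>i. U i \<omega>) K2)))
     = distr M N1 (\<lambda>\<omega>. g1 (restrict (\<lambda>i. U i \<omega>) K1)) \<Otimes>\<^sub>M distr M N2 (\<lambda>\<omega>. g2 (restrict (\<lambda>i. U i \<omega>) K2))"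
    if d: "K1 \<inter> K2 = {}" and g: "g1 \<in> measurable (PiM K1 (\<lambda>_. borel)) N1" "g2 \<in> measurable (PiM K2 (\<lambda>_. borel)) N2"
    for K1 K2 and g1 :: "(nat + nat \<Rightarrow> real) \<Rightarrow> 'n1" and g2 :: "(nat + nat \<Rightarrow> real) \<Rightarrow> 'n2"
      and N1 :: "'n1 measure" and N2 :: "'n2 measure"
  proof -
    let ?R = "\<lambda>K \<omega>. restrict (\<lambda>i. U i \<omega>) K"
    let ?P = "\<lambda>K. PiM K (\<lambda>_. borel) :: (nat + nat \<Rightarrow> real) measure"
    have "indep_var (?P K1) (?R K1) (?P K2) (?R K2)"
      unfolding indep_var_def using rest[OF d]
      by (rule indep_vars_cong[THEN iffD1, rotated -1]) (auto split: bool.splits)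
    then have R: "?R K1 \<in> measurable M (?P K1)" "?R K2 \<in> measurable M (?P K2)"
      and eq: "distr M (?P K1) (?R K1) \<Otimes>\<^sub>M distr M (?P K2) (?R K2) = distr M (?P K1 \<Otimes>\<^sub>M ?P K2) (\<lambda>\<omega>. (?R K1 \<omega>, ?R K2 \<omega>))"
      unfolding indep_var_distribution_eq by auto
    have "prob_space (distr M N2 (g2 \<circ> ?R K2))"
      using R g by (intro prob_space_distr) auto
    then have sf: "sigma_finite_measure (distr (distr M (?P K2) (?R K2)) N2 g2)"
      using R g by (simp add: distr_distr prob_space_imp_sigma_finite)
    have "distr M N1 (\<lambda>\<omega>. g1 (?R K1 \<omega>)) \<Otimes>\<^sub>M distr M N2 (\<lambda>\<omega>. g2 (?R K2 \<omega>))
      = distr (distr M (?P K1) (?R K1)) N1 g1 \<Otimes>\<^sub>M distr (distr M (?P K2) (?R K2)) N2 g2"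
      using R g by (simp add: distr_distr comp_def)
    also have "\<dots> = distr (distr M (?P K1 \<Otimes>\<^sub>M ?P K2) (\<lambda>\<omega>. (?R K1 \<omega>, ?R K2 \<omega>))) (N1 \<Otimes>\<^sub>M N2) (\<lambda>(x, y). (g1 x, g2 y))"
      using R g by (subst pair_measure_distr[OF _ _ sf]) (auto simp: eq)
    also have "\<dots> = distr M (N1 \<Otimes>\<^sub>M N2) (\<lambda>\<omega>. (g1 (?R K1 \<omega>), g2 (?R K2 \<omega>)))"
      using R g by (subst distr_distr) (auto simp: comp_def)
    finally show ?thesis by simp
  qed
  have pn: "(\<lambda>p. p i) \<in> borel_measurable (PiM K (\<lambda>_. borel :: real measure))" if "i \<in> K" for i :: "nat + nat" and K
    using that by (intro measurable_component_singleton)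
  show "distr M (borel \<Otimes>\<^sub>M (borel \<Otimes>\<^sub>M borel)) (\<lambda>\<omega>. (V n \<omega>, (Yt B n \<omega>, X B (Suc n) \<omega>)))
    = distr M borel (V n) \<Otimes>\<^sub>M distr M (borel \<Otimes>\<^sub>M borel) (\<lambda>\<omega>. (Yt B n \<omega>, X B (Suc n) \<omega>))"
  proof -
    have "(\<lambda>p. (min (p (Inr n)) B, G p)) \<in> (PiM (insert (Inr n) J) (\<lambda>_. borel)) \<rightarrow>\<^sub>M borel \<Otimes>\<^sub>M borel"
      by (intro measurable_Pair borel_measurable_min pn G) auto
    from 2[OF _ pn[of "Inl n" "{Inl n}"] this]
    show ?thesis using GU[of "insert (Inr n) J"] by (auto simp: U_def Yt_def subset_insertI J_def)
  qed
  show "distr M (borel \<Otimes>\<^sub>M borel) (\<lambda>\<omega>. (Yt B n \<omega>, X B (Suc n) \<omega>))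
    = distr M borel (Yt B n) \<Otimes>\<^sub>M distr M borel (X B (Suc n))"
  proof -
    have "(\<lambda>p. min (p (Inr n)) B) \<in> borel_measurable (PiM {Inr n} (\<lambda>_. borel))"
      by (intro borel_measurable_min pn) auto
    from 2[OF _ this G[of J]]
    show ?thesis using GU[of J] by (auto simp: U_def Yt_def[abs_def] J_def)
  qed
qed

text \<open>The Beta parameters fix the exponent: with b = \<theta> + (n+1)\<alpha> one has
  (1-\<alpha>) + b = \<theta> + n\<alpha> + 1. Integrating out the stick alone then splits the power
  into a factor in \<open>Yt B n\<close> and a factor in the tail, which are independent.\<close>

lemma nn_integral_X_rec:
  assumes B: "0 \<le> B" and z: "0 < z"
  shows "(\<integral>\<^sup>+\<omega>. ennreal ((z + X B n \<omega>) powr (- (\<theta> + real n * \<alpha>) - 1)) \<partial>M)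
    = (\<integral>\<^sup>+\<omega>. ennreal ((z + Yt B n \<omega>) powr (\<alpha> - 1)) \<partial>M)
      * (\<integral>\<^sup>+\<omega>. ennreal ((z + X B (Suc n) \<omega>) powr (- (\<theta> + real (Suc n) * \<alpha>))) \<partial>M)"
proof -
  define b where "b = \<theta> + real (Suc n) * \<alpha>"
  have b: "b > 0" using \<alpha> \<theta> by (auto simp: b_def intro!: add_pos_nonneg)
  define F :: "real \<times> real \<times> real \<Rightarrow> ennreal" where "F = (\<lambda>(v, y, x). ennreal ((v * (z + y) + (1 - v) * (z + x)) powr (-((1 - \<alpha>) + b))))"
  have [measurable]: "F \<in> borel_measurable (borel \<Otimes>\<^sub>M (borel \<Otimes>\<^sub>M borel))" unfolding F_def by measurable
  define YX where "YX = (\<lambda>\<omega>. (Yt B n \<omega>, X B (Suc n) \<omega>))"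
  have [measurable]: "YX \<in> measurable M (borel \<Otimes>\<^sub>M borel)" unfolding YX_def by measurable
  define \<nu> where "\<nu> = distr M (borel \<Otimes>\<^sub>M borel) YX"
  interpret \<nu>: prob_space \<nu> unfolding \<nu>_def by (rule prob_space_distr) measurable
  interpret \<beta>: prob_space "distr M borel (V n)" by (rule prob_space_distr) measurable
  interpret P: pair_sigma_finite "distr M borel (V n)" \<nu> ..
  have "(\<integral>\<^sup>+\<omega>. ennreal ((z + X B n \<omega>) powr (- (\<theta> + real n * \<alpha>) - 1)) \<partial>M) = (\<integral>\<^sup>+\<omega>. F (V n \<omega>, YX \<omega>) \<partial>M)"
  proof (rule nn_integral_cong_AE)
    show "AE \<omega> in M. ennreal ((z + X B n \<omega>) powr (- (\<theta> + real n * \<alpha>) - 1)) = F (V n \<omega>, YX \<omega>)"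
      using AE_V
    proof eventually_elim
      case (elim \<omega>)
      have "z + X B n \<omega> = V n \<omega> * (z + Yt B n \<omega>) + (1 - V n \<omega>) * (z + X B (Suc n) \<omega>)"
        using stick_sum_rec[of V \<omega> "Yt B" B n] elim Yt_bounds[OF B] by (simp add: algebra_simps)
      moreover have "- (\<theta> + real n * \<alpha>) - 1 = -((1 - \<alpha>) + b)" by (simp add: b_def algebra_simps)
      ultimately show ?case by (simp only: F_def YX_def prod.case)
    qed
  qed
  also have "\<dots> = (\<integral>\<^sup>+p. F p \<partial>distr M (borel \<Otimes>\<^sub>M (borel \<Otimes>\<^sub>M borel)) (\<lambda>\<omega>. (V n \<omega>, YX \<omega>)))"
    by (subst nn_integral_distr) auto
  also have "distr M (borel \<Otimes>\<^sub>M (borel \<Otimes>\<^sub>M borel)) (\<lambda>\<omega>. (V n \<omega>, YX \<omega>)) = distr M borel (V n) \<Otimes>\<^sub>M \<nu>"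
    using indep_tail(1)[of n B] unfolding \<nu>_def YX_def .
  also have "(\<integral>\<^sup>+p. F p \<partial>(distr M borel (V n) \<Otimes>\<^sub>M \<nu>)) = (\<integral>\<^sup>+p. \<integral>\<^sup>+v. F (v, p) \<partial>distr M borel (V n) \<partial>\<nu>)"
    by (subst P.nn_integral_snd) (auto simp: \<nu>_def)
  also have "\<dots> = (\<integral>\<^sup>+\<omega>. \<integral>\<^sup>+v. F (v, YX \<omega>) \<partial>distr M borel (V n) \<partial>M)"
    unfolding \<nu>_def by (subst nn_integral_distr) auto
  also have "\<dots> = (\<integral>\<^sup>+\<omega>. ennreal ((z + Yt B n \<omega>) powr (\<alpha> - 1)) * ennreal ((z + X B (Suc n) \<omega>) powr (- b)) \<partial>M)"
  proof (rule nn_integral_cong_AE)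
    show "AE \<omega> in M. (\<integral>\<^sup>+v. F (v, YX \<omega>) \<partial>distr M borel (V n)) = ennreal ((z + Yt B n \<omega>) powr (\<alpha> - 1)) * ennreal ((z + X B (Suc n) \<omega>) powr (- b))"
      using AE_X_bounds[OF B]
    proof eventually_elim
      case (elim \<omega>)
      have "(\<integral>\<^sup>+v. ennreal ((v * (z + Yt B n \<omega>) + (1 - v) * (z + X B (Suc n) \<omega>)) powr (-((1 - \<alpha>) + b))) \<partial>beta_measure (1 - \<alpha>) b)
        = ennreal ((z + Yt B n \<omega>) powr (-(1 - \<alpha>)) * (z + X B (Suc n) \<omega>) powr (-b))"
        using \<alpha> b z elim Yt_bounds[OF B, of n \<omega>] \<beta>.prob_space_axioms
        by (intro beta_measure_mixture_powr) (auto simp: distr_V b_def intro!: add_pos_nonneg)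
      then show ?case by (simp add: F_def YX_def distr_V b_def ennreal_mult'')
    qed
  qed
  also have "\<dots> = (\<integral>\<^sup>+p. ennreal ((z + fst p) powr (\<alpha> - 1)) * ennreal ((z + snd p) powr (- b)) \<partial>\<nu>)"
    unfolding \<nu>_def by (subst nn_integral_distr) (auto simp: YX_def)
  also have "\<nu> = distr M borel (Yt B n) \<Otimes>\<^sub>M distr M borel (X B (Suc n))"
    using indep_tail(2)[of B n] unfolding \<nu>_def YX_def .
  also have "(\<integral>\<^sup>+p. ennreal ((z + fst p) powr (\<alpha> - 1)) * ennreal ((z + snd p) powr (- b)) \<partial>(distr M borel (Yt B n) \<Otimes>\<^sub>M distr M borel (X B (Suc n))))
     = (\<integral>\<^sup>+y. \<integral>\<^sup>+x. ennreal ((z + y) powr (\<alpha> - 1)) * ennreal ((z + x) powr (- b)) \<partial>distr M borel (X B (Suc n)) \<partial>distr M borel (Yt B n))"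
  proof -
    interpret Q: prob_space "distr M borel (X B (Suc n))" by (rule prob_space_distr) measurable
    show ?thesis by (subst Q.nn_integral_fst[symmetric]) auto
  qed
  also have "\<dots> = (\<integral>\<^sup>+\<omega>. ennreal ((z + Yt B n \<omega>) powr (\<alpha> - 1)) \<partial>M) * (\<integral>\<^sup>+\<omega>. ennreal ((z + X B (Suc n) \<omega>) powr (- b)) \<partial>M)"
    by (simp add: nn_integral_cmult nn_integral_multc nn_integral_distr)
  finally show ?thesis by (simp add: b_def)
qed

end

lemma powr_add_le:
  fixes x y p :: real
  assumes "0 \<le> x" "0 \<le> y" "0 \<le> p"
  shows "(x + y) powr p \<le> 2 powr p * (x powr p + y powr p)"
proof -
  have "(x + y) powr p \<le> (2 * max x y) powr p"
    using assms by (intro powr_mono2) auto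
  also have "\<dots> = 2 powr p * (max x y) powr p" using assms by (simp add: powr_mult)
  also have "\<dots> \<le> 2 powr p * (x powr p + y powr p)"
    by (intro mult_left_mono) (auto simp: max_def)
  finally show ?thesis .
qed

text \<open>Concavity: an increment of the power shrinks when it is moved to the right. Integrated
  over y this becomes \<open>m_diff\<close>.\<close>

lemma powr_increment_le:
  fixes z w y \<alpha> :: real
  assumes "0 < z" "z \<le> w" "0 \<le> y" "0 < \<alpha>" "\<alpha> < 1"
  shows "(w + y) powr \<alpha> - (z + y) powr \<alpha> \<le> w powr \<alpha> - z powr \<alpha>"
proof -
  have "(w + y) powr \<alpha> - (z + y) powr \<alpha> \<le> (w + 0) powr \<alpha> - (z + 0) powr \<alpha>"
  proof (rule DERIV_nonpos_imp_nonincreasing[OF assms(3)])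
    fix x :: real assume x: "0 \<le> x"
    have "((\<lambda>y. (w + y) powr \<alpha> - (z + y) powr \<alpha>) has_real_derivative
       \<alpha> * (w + x) powr (\<alpha> - 1) - \<alpha> * (z + x) powr (\<alpha> - 1)) (at x)"
      using assms x by (auto intro!: derivative_eq_intros)
    moreover have "(w + x) powr (\<alpha> - 1) \<le> (z + x) powr (\<alpha> - 1)"
      using assms x by (intro powr_mono2') auto
    then have "\<alpha> * (w + x) powr (\<alpha> - 1) - \<alpha> * (z + x) powr (\<alpha> - 1) \<le> 0" using assms by simp
    ultimately show "\<exists>d. ((\<lambda>y. (w + y) powr \<alpha> - (z + y) powr \<alpha>) has_real_derivative d) (at x) \<and> d \<le> 0" by blast
  qed
  then show ?thesis by simp
qed

lemma eventually_real_ge: "\<forall>\<^sub>F m in sequentially. y \<le> real m"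
  by (rule eventually_sequentiallyI[of "nat \<lceil>y\<rceil>"]) linarith

lemma powr_between:
  fixes z x B p :: real
  assumes "0 < z" "0 \<le> x" "x \<le> B"
  shows "(z + x) powr p \<le> z powr p + (z + B) powr p"
proof (cases "p \<ge> 0")
  case True
  then have "(z + x) powr p \<le> (z + B) powr p" using assms by (intro powr_mono2) auto
  then show ?thesis by (simp add: add_increasing)
next
  case False
  then have "(z + x) powr p \<le> z powr p" using assms by (intro powr_mono2') auto
  then show ?thesis by (simp add: add_increasing2)
qed

context prob_space begin

lemma integrable_shift_powr:
  fixes X :: "'a \<Rightarrow> real"
  assumes [measurable]: "X \<in> borel_measurable M" and X: "AE \<omega> in M. 0 \<le> X \<omega> \<and> X \<omega> \<le> B" and z: "0 < z"
  shows "integrable M (\<lambda>\<omega>. (z + X \<omega>) powr p)"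
proof (rule integrable_const_bound)
  show "AE \<omega> in M. norm ((z + X \<omega>) powr p) \<le> z powr p + (z + B) powr p"
    using X by eventually_elim (use z powr_between in auto)
qed measurable

text \<open>For p \<le> 1 the derivative has exponent p - 1 \<le> 0, so on the ball of radius z/2 it
  is dominated by a constant.\<close>

lemma has_real_derivative_expectation_powr:
  fixes X :: "'a \<Rightarrow> real"
  assumes [measurable]: "X \<in> borel_measurable M" and X: "AE \<omega> in M. 0 \<le> X \<omega> \<and> X \<omega> \<le> B" and z: "0 < z"
    and p: "p \<le> 1"
  shows "((\<lambda>z. expectation (\<lambda>\<omega>. (z + X \<omega>) powr p)) has_real_derivative p * expectation (\<lambda>\<omega>. (z + X \<omega>) powr (p - 1))) (at z)"
proof -
  have "((\<lambda>z. \<integral>\<omega>. (z + X \<omega>) powr p \<partial>M) has_field_derivative (\<integral>\<omega>. p * (z + X \<omega>) powr (p - 1) \<partial>M)) (at z)"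
  proof (rule has_field_derivative_integral[where r = "z / 2" and K = "\<lambda>_. \<bar>p\<bar> * (z / 2) powr (p - 1)"])
    show "integrable M (\<lambda>\<omega>. (x + X \<omega>) powr p)" if "x \<in> ball z (z / 2)" for x
    proof (rule integrable_shift_powr[OF _ X])
      show "0 < x" using that by (auto simp: dist_real_def abs_real_def split: if_splits)
    qed simp
    show "AE \<omega> in M. \<forall>x\<in>ball z (z / 2). ((\<lambda>x. (x + X \<omega>) powr p) has_real_derivative p * (x + X \<omega>) powr (p - 1)) (at x)
        \<and> norm (p * (x + X \<omega>) powr (p - 1)) \<le> \<bar>p\<bar> * (z / 2) powr (p - 1)"
      using X
    proof (eventually_elim, intro ballI conjI)
      case (elim \<omega>)
      fix x assume "x \<in> ball z (z / 2)"
      then have x: "z / 2 < x" by (auto simp: dist_real_def abs_real_def split: if_splits)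
      then show "((\<lambda>x. (x + X \<omega>) powr p) has_real_derivative p * (x + X \<omega>) powr (p - 1)) (at x)"
        using elim z by (auto intro!: derivative_eq_intros)
      have "(x + X \<omega>) powr (p - 1) \<le> (z / 2) powr (p - 1)"
        using elim z x p by (intro powr_mono2') auto
      then show "norm (p * (x + X \<omega>) powr (p - 1)) \<le> \<bar>p\<bar> * (z / 2) powr (p - 1)"
        by (simp add: abs_mult mult_left_mono)
    qed
  qed (use z in auto)
  then show ?thesis by simp
qed

end

context stick_breaking begin

lemma prob_\<eta>: "prob_space \<eta>"
  unfolding distr_Y[of 0, symmetric] by (rule prob_space_distr) measurable

lemma sets_\<eta> [measurable_cong, simp]: "sets \<eta> = sets borel"
  unfolding distr_Y[of 0, symmetric] by simp

lemma AE_\<eta>: "AE y in \<eta>. 0 \<le> y"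
  unfolding distr_Y[of 0, symmetric] by (subst AE_distr_iff) (auto simp: Y_nonneg)

lemma expectation_X_rec:
  assumes B: "0 \<le> B" and z: "0 < z"
  shows "expectation (\<lambda>\<omega>. (z + X B n \<omega>) powr (- (\<theta> + real n * \<alpha>) - 1))
    = (\<integral>y. (z + min y B) powr (\<alpha> - 1) \<partial>\<eta>) * expectation (\<lambda>\<omega>. (z + X B (Suc n) \<omega>) powr (- (\<theta> + real (Suc n) * \<alpha>)))"
proof -
  have Xb: "AE \<omega> in M. 0 \<le> X B n \<omega> \<and> X B n \<omega> \<le> B" for n
    using AE_X_bounds[OF B] by eventually_elim auto
  have int: "integrable M (\<lambda>\<omega>. (z + X B n \<omega>) powr p)" for n p
    by (intro integrable_shift_powr[OF _ Xb z]) simp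
  have intY: "integrable M (\<lambda>\<omega>. (z + Yt B n \<omega>) powr p)" for p
    by (rule integrable_shift_powr[OF _ _ z, of _ B]) (use Yt_bounds[OF B] in auto)
  have "ennreal (expectation (\<lambda>\<omega>. (z + X B n \<omega>) powr (- (\<theta> + real n * \<alpha>) - 1)))
    = ennreal (expectation (\<lambda>\<omega>. (z + Yt B n \<omega>) powr (\<alpha> - 1))) * ennreal (expectation (\<lambda>\<omega>. (z + X B (Suc n) \<omega>) powr (- (\<theta> + real (Suc n) * \<alpha>))))"
    using nn_integral_X_rec[OF B z, of n] int intY by (simp add: nn_integral_eq_integral del: of_nat_Suc)
  also have "expectation (\<lambda>\<omega>. (z + Yt B n \<omega>) powr (\<alpha> - 1)) = (\<integral>y. (z + min y B) powr (\<alpha> - 1) \<partial>\<eta>)"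
    unfolding distr_Y[of n, symmetric] Yt_def by (subst integral_distr) auto
  finally show ?thesis
    by (simp add: ennreal_mult[symmetric] integral_nonneg_AE del: of_nat_Suc)
qed

text \<open>By \<open>expectation_X_rec\<close> the derivative of each transform is a multiple of
  the next one times \<open>h\<close>, and \<open>\<alpha> * h\<close> is also the derivative of
  \<open>m\<close>. This common factor is what allows the transforms to be treated as functions of
  \<open>m\<close>.\<close>

theorem stieltjes_identity_truncated:
  assumes B: "0 \<le> B" and z: "0 < z"
  shows "expectation (\<lambda>\<omega>. (z + X B 0 \<omega>) powr (- \<theta>)) = (\<integral>y. (z + min y B) powr \<alpha> \<partial>\<eta>) powr (- \<theta> / \<alpha>)"
proof -
  interpret \<eta>: prob_space \<eta> by (rule prob_\<eta>)
  have Xb: "AE \<omega> in M. 0 \<le> X B n \<omega> \<and> X B n \<omega> \<le> B" for n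
    using AE_X_bounds[OF B] by eventually_elim auto
  have yb: "AE y in \<eta>. 0 \<le> min y B \<and> min y B \<le> B"
    using AE_\<eta> by eventually_elim (use B in auto)
  have intX: "integrable M (\<lambda>\<omega>. (z + X B n \<omega>) powr p)" if "z > 0" for n p z
    by (intro integrable_shift_powr[OF _ Xb that]) simp
  have inty: "integrable \<eta> (\<lambda>y. (z + min y B) powr p)" if "z > 0" for p z
    by (intro \<eta>.integrable_shift_powr[OF _ yb that]) simp
  define u where "u n z = expectation (\<lambda>\<omega>. (z + X B n \<omega>) powr (- (\<theta> + real n * \<alpha>)))" for n z
  define h where "h z = (\<integral>y. (z + min y B) powr (\<alpha> - 1) \<partial>\<eta>)" for z
  define m where "m z = (\<integral>y. (z + min y B) powr \<alpha> \<partial>\<eta>)" for z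
  have "u 0 z = m z powr (- \<theta> / \<alpha>)"
  proof (rule stieltjes_recursion_unique[OF \<alpha> \<theta> B _ _ _ _ _ _ _ _ _ z, of u h m])
    fix n and z :: real assume z: "z > 0"
    have th: "0 < \<theta> + real n * \<alpha>" using \<theta> \<alpha> by (intro add_pos_nonneg) auto
    show "(z + B) powr (- (\<theta> + real n * \<alpha>)) \<le> u n z"
      unfolding u_def
    proof (rule integral_ge_const[OF intX[OF z]])
      show "AE \<omega> in M. (z + B) powr (- (\<theta> + real n * \<alpha>)) \<le> (z + X B n \<omega>) powr (- (\<theta> + real n * \<alpha>))"
        using Xb[of n] by eventually_elim (use th z in \<open>auto intro!: powr_mono2'\<close>)
    qed
    show "u n z \<le> z powr (- (\<theta> + real n * \<alpha>))"
      unfolding u_def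
    proof (rule integral_le_const[OF intX[OF z]])
      show "AE \<omega> in M. (z + X B n \<omega>) powr (- (\<theta> + real n * \<alpha>)) \<le> z powr (- (\<theta> + real n * \<alpha>))"
        using Xb[of n] by eventually_elim (use th z in \<open>auto intro!: powr_mono2'\<close>)
    qed
    show "(u n has_real_derivative - (\<theta> + real n * \<alpha>) * h z * u (Suc n) z) (at z)"
      using has_real_derivative_expectation_powr[OF _ Xb z, of n "- (\<theta> + real n * \<alpha>)"] th
      unfolding expectation_X_rec[OF B z] u_def[symmetric] h_def[symmetric]
      by (simp add: u_def[abs_def] mult.assoc)
  next
    fix z :: real assume z: "z > 0"
    show "(m has_real_derivative \<alpha> * h z) (at z)"
      using \<eta>.has_real_derivative_expectation_powr[OF _ yb z, of \<alpha>] \<alpha>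
      by (simp add: m_def[abs_def] h_def)
    show "0 \<le> h z" unfolding h_def by (rule integral_nonneg_AE) auto
    show "h z \<le> z powr (\<alpha> - 1)"
      unfolding h_def
    proof (rule \<eta>.integral_le_const[OF inty[OF z]])
      show "AE y in \<eta>. (z + min y B) powr (\<alpha> - 1) \<le> z powr (\<alpha> - 1)"
        using yb by eventually_elim (use \<alpha> z in \<open>auto intro!: powr_mono2'\<close>)
    qed
    show "z powr \<alpha> \<le> m z"
      unfolding m_def
    proof (rule \<eta>.integral_ge_const[OF inty[OF z]])
      show "AE y in \<eta>. z powr \<alpha> \<le> (z + min y B) powr \<alpha>"
        using yb by eventually_elim (use \<alpha> z in \<open>auto intro!: powr_mono2\<close>)
    qed
    show "m z \<le> (z + B) powr \<alpha>"
      unfolding m_def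
    proof (rule \<eta>.integral_le_const[OF inty[OF z]])
      show "AE y in \<eta>. (z + min y B) powr \<alpha> \<le> (z + B) powr \<alpha>"
        using yb by eventually_elim (use \<alpha> z in \<open>auto intro!: powr_mono2\<close>)
    qed
  next
    fix z w :: real assume z: "0 < z" "z \<le> w"
    have "m w - m z = (\<integral>y. (w + min y B) powr \<alpha> - (z + min y B) powr \<alpha> \<partial>\<eta>)"
      unfolding m_def using z by (intro Bochner_Integration.integral_diff[symmetric] inty) auto
    also have "\<dots> \<le> w powr \<alpha> - z powr \<alpha>"
    proof (rule \<eta>.integral_le_const)
      show "AE y in \<eta>. (w + min y B) powr \<alpha> - (z + min y B) powr \<alpha> \<le> w powr \<alpha> - z powr \<alpha>"
        using yb by eventually_elim (use \<alpha> z in \<open>auto intro!: powr_increment_le\<close>)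
    qed (use z inty in auto)
    finally show "m w - m z \<le> w powr \<alpha> - z powr \<alpha>" .
  qed
  then show ?thesis by (simp add: u_def m_def)
qed

section \<open>Removal of the truncation and almost sure convergence of the series\<close>

abbreviation S :: "'a \<Rightarrow> real" where "S \<equiv> stick_sum V Y 0"

text \<open>\<open>suminf\<close> is unspecified where the series diverges, so the points of
  convergence are tracked until they are known to have full measure.\<close>

definition conv_event :: "'a set" where
  "conv_event = {\<omega>\<in>space M. summable (\<lambda>k. stick_weights V k \<omega> * Y k \<omega>)}"

lemma conv_event [measurable]: "conv_event \<in> sets M"
proof -
  have "{\<omega>\<in>space M. Cauchy (\<lambda>n. \<Sum>k<n. stick_weights V k \<omega> * Y k \<omega>)} \<in> sets M"
    unfolding stick_weights_def by (intro sets_Collect_Cauchy) measurable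
  then show ?thesis unfolding conv_event_def summable_iff_convergent Cauchy_convergent_iff .
qed

lemma S_measurable [measurable]: "S \<in> borel_measurable M"
  by measurable

text \<open>The indicator stems from the divergent case, where the truncated sums grow without bound
  and their negative power tends to 0. On the convergence event, dominated convergence over the
  index k applies.\<close>

lemma truncated_limit:
  assumes V: "\<And>k. 0 < V k \<omega> \<and> V k \<omega> < 1" and \<omega>: "\<omega> \<in> space M" and z: "0 < z"
  shows "(\<lambda>m. (z + X (real m) 0 \<omega>) powr (- \<theta>)) \<longlonglongrightarrow> indicator conv_event \<omega> * (z + S \<omega>) powr (- \<theta>)"
proof -
  define w where "w k = stick_weights V k \<omega>" for k
  have w: "0 \<le> w k" for k unfolding w_def by (intro stick_weights_nonneg V)
  have sm: "summable (\<lambda>k. w k * Yt (real m) k \<omega>)" for m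
    using stick_sum_bounded(1)[of V \<omega> "Yt (real m)" "real m" 0] V Yt_bounds[of "real m"] by (simp add: w_def)
  have X: "X (real m) 0 \<omega> = (\<Sum>k. w k * Yt (real m) k \<omega>)" for m
    by (simp add: stick_sum_def w_def)
  show ?thesis
  proof (cases "summable (\<lambda>k. w k * Y k \<omega>)")
    case True
    then have conv: "\<omega> \<in> conv_event" using \<omega> by (simp add: conv_event_def w_def)
    have S: "S \<omega> = (\<Sum>k. w k * Y k \<omega>)" by (simp add: stick_sum_def w_def)
    have "(\<lambda>m. \<integral>k. w k * Yt (real m) k \<omega> \<partial>count_space UNIV) \<longlonglongrightarrow> (\<integral>k. w k * Y k \<omega> \<partial>count_space UNIV)"
    proof (rule integral_dominated_convergence[where w = "\<lambda>k. w k * Y k \<omega>"])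
      show "integrable (count_space UNIV) (\<lambda>k. w k * Y k \<omega>)"
        using True w Y_nonneg by (simp add: integrable_count_space_nat_iff abs_mult)
      show "AE k in count_space UNIV. (\<lambda>m. w k * Yt (real m) k \<omega>) \<longlonglongrightarrow> w k * Y k \<omega>"
      proof (intro AE_I2 tendsto_mult tendsto_const)
        fix k
        have "\<forall>\<^sub>F m in sequentially. Y k \<omega> = Yt (real m) k \<omega>"
          using eventually_real_ge[of "Y k \<omega>"] by eventually_elim (auto simp: Yt_def)
        then show "(\<lambda>m. Yt (real m) k \<omega>) \<longlonglongrightarrow> Y k \<omega>"
          by (rule Lim_transform_eventually[OF tendsto_const])
      qed
      show "AE k in count_space UNIV. norm (w k * Yt (real m) k \<omega>) \<le> w k * Y k \<omega>" for m
        using w Y_nonneg by (intro AE_I2) (auto simp: Yt_def abs_mult intro!: mult_left_mono)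
    qed auto
    moreover have "(\<integral>k. w k * Yt (real m) k \<omega> \<partial>count_space UNIV) = X (real m) 0 \<omega>" for m
      unfolding X using sm[of m] w Yt_bounds[of "real m"]
      by (intro integral_count_space_nat) (simp add: integrable_count_space_nat_iff abs_mult)
    moreover have "(\<integral>k. w k * Y k \<omega> \<partial>count_space UNIV) = S \<omega>"
      unfolding S using True w Y_nonneg
      by (intro integral_count_space_nat) (simp add: integrable_count_space_nat_iff abs_mult)
    ultimately have lim: "(\<lambda>m. X (real m) 0 \<omega>) \<longlonglongrightarrow> S \<omega>" by simp
    have "0 \<le> S \<omega>" unfolding S using w Y_nonneg by (intro suminf_nonneg True) auto
    then have "(\<lambda>m. (z + X (real m) 0 \<omega>) powr (- \<theta>)) \<longlonglongrightarrow> (z + S \<omega>) powr (- \<theta>)"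
      using z by (intro tendsto_intros lim) auto
    then show ?thesis using conv by simp
  next
    case False
    then have conv: "\<omega> \<notin> conv_event" by (simp add: conv_event_def w_def)
    have "filterlim (\<lambda>m. z + X (real m) 0 \<omega>) at_top sequentially"
      unfolding filterlim_at_top
    proof
      \<comment> \<open>Finitely many terms already exceed C, and none of them is truncated once m
        has passed their values.\<close>
      fix C
      have "\<exists>N. \<not> (\<Sum>k<N. w k * Y k \<omega>) \<le> C"
        using False summableI_nonneg_bounded[of "\<lambda>k. w k * Y k \<omega>" C] w Y_nonneg by auto
      then obtain N where N: "C < (\<Sum>k<N. w k * Y k \<omega>)" by (meson not_le)
      have "\<forall>\<^sub>F m in sequentially. \<forall>k\<in>{..<N}. Y k \<omega> \<le> real m"
        by (subst eventually_ball_finite_distrib) (auto intro: eventually_real_ge)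
      then show "\<forall>\<^sub>F m in sequentially. C \<le> z + X (real m) 0 \<omega>"
      proof eventually_elim
        case (elim m)
        have "(\<Sum>k<N. w k * Y k \<omega>) = (\<Sum>k<N. w k * Yt (real m) k \<omega>)"
          using elim by (intro sum.cong) (auto simp: Yt_def)
        also have "\<dots> \<le> X (real m) 0 \<omega>"
          unfolding X using w Yt_bounds[of "real m"] by (intro sum_le_suminf sm) auto
        finally show ?case using N z by simp
      qed
    qed
    then have "(\<lambda>m. (z + X (real m) 0 \<omega>) powr (- \<theta>)) \<longlonglongrightarrow> 0"
      using \<theta> by (intro tendsto_neg_powr) auto
    then show ?thesis using conv by simp
  qed
qed

context
  assumes moment: "integrable \<eta> (\<lambda>y. y powr \<alpha>)"
begin

lemma integrable_shift_powr_\<eta>: "integrable \<eta> (\<lambda>y. (z + y) powr \<alpha>)" if "z \<ge> 0"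
proof (rule Bochner_Integration.integrable_bound)
  interpret \<eta>: prob_space \<eta> by (rule prob_\<eta>)
  show "integrable \<eta> (\<lambda>y. 2 powr \<alpha> * (z powr \<alpha> + y powr \<alpha>))" using moment by simp
  show "AE y in \<eta>. norm ((z + y) powr \<alpha>) \<le> norm (2 powr \<alpha> * (z powr \<alpha> + y powr \<alpha>))"
    using AE_\<eta> by eventually_elim (use that \<alpha> powr_add_le[of z _ \<alpha>] in auto)
qed measurable

text \<open>The truncation level tends to infinity on both sides. The integral on the right is at
  least z powr \<alpha>, so its negative power is continuous there.\<close>

lemma stieltjes_identity_conv_event:
  assumes z: "0 < z"
  shows "expectation (\<lambda>\<omega>. indicator conv_event \<omega> * (z + S \<omega>) powr (- \<theta>)) = (\<integral>y. (z + y) powr \<alpha> \<partial>\<eta>) powr (- \<theta> / \<alpha>)"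
proof (rule LIMSEQ_unique)
  interpret \<eta>: prob_space \<eta> by (rule prob_\<eta>)
  show "(\<lambda>m. expectation (\<lambda>\<omega>. (z + X (real m) 0 \<omega>) powr (- \<theta>))) \<longlonglongrightarrow> expectation (\<lambda>\<omega>. indicator conv_event \<omega> * (z + S \<omega>) powr (- \<theta>))"
  proof (rule integral_dominated_convergence[where w = "\<lambda>_. z powr (- \<theta>)"])
    show "AE \<omega> in M. (\<lambda>m. (z + X (real m) 0 \<omega>) powr (- \<theta>)) \<longlonglongrightarrow> indicator conv_event \<omega> * (z + S \<omega>) powr (- \<theta>)"
      using AE_V AE_space by eventually_elim (use truncated_limit z in auto)
    show "AE \<omega> in M. norm ((z + X (real m) 0 \<omega>) powr (- \<theta>)) \<le> z powr (- \<theta>)" for m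
      using AE_X_bounds[of "real m", OF of_nat_0_le_iff] by eventually_elim (use z \<theta> in \<open>auto intro!: powr_mono2'\<close>)
  qed auto
  have "(\<lambda>m. \<integral>y. (z + min y (real m)) powr \<alpha> \<partial>\<eta>) \<longlonglongrightarrow> (\<integral>y. (z + y) powr \<alpha> \<partial>\<eta>)"
  proof (rule integral_dominated_convergence[where w = "\<lambda>y. (z + y) powr \<alpha>"])
    show "integrable \<eta> (\<lambda>y. (z + y) powr \<alpha>)" using z by (intro integrable_shift_powr_\<eta>) auto
    show "AE y in \<eta>. (\<lambda>m. (z + min y (real m)) powr \<alpha>) \<longlonglongrightarrow> (z + y) powr \<alpha>"
    proof (intro AE_I2)
      fix y
      have "\<forall>\<^sub>F m in sequentially. (z + y) powr \<alpha> = (z + min y (real m)) powr \<alpha>"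
        using eventually_real_ge[of y] by eventually_elim (simp add: min_def)
      then show "(\<lambda>m. (z + min y (real m)) powr \<alpha>) \<longlonglongrightarrow> (z + y) powr \<alpha>"
        by (rule Lim_transform_eventually[OF tendsto_const])
    qed
    show "AE y in \<eta>. norm ((z + min y (real m)) powr \<alpha>) \<le> (z + y) powr \<alpha>" for m
      using AE_\<eta> by eventually_elim (use z \<alpha> in \<open>auto intro!: powr_mono2\<close>)
  qed auto
  moreover have "z powr \<alpha> \<le> (\<integral>y. (z + y) powr \<alpha> \<partial>\<eta>)"
  proof (rule \<eta>.integral_ge_const)
    show "AE y in \<eta>. z powr \<alpha> \<le> (z + y) powr \<alpha>"
      using AE_\<eta> by eventually_elim (use z \<alpha> in \<open>auto intro!: powr_mono2\<close>)
  qed (use z integrable_shift_powr_\<eta> in auto)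
  then have "(\<integral>y. (z + y) powr \<alpha> \<partial>\<eta>) \<noteq> 0" using z powr_gt_zero[of z \<alpha>] by linarith
  ultimately show "(\<lambda>m. expectation (\<lambda>\<omega>. (z + X (real m) 0 \<omega>) powr (- \<theta>))) \<longlonglongrightarrow> (\<integral>y. (z + y) powr \<alpha> \<partial>\<eta>) powr (- \<theta> / \<alpha>)"
    unfolding stieltjes_identity_truncated[OF of_nat_0_le_iff z] by (intro tendsto_powr tendsto_const) auto
qed

lemma AE_S_nonneg: "AE \<omega> in M. \<omega> \<in> conv_event \<longrightarrow> 0 \<le> S \<omega>"
  using AE_V
proof eventually_elim
  case (elim \<omega>)
  show ?case
    unfolding conv_event_def stick_sum_def
    by (auto intro!: suminf_nonneg mult_nonneg_nonneg stick_weights_nonneg Y_nonneg elim[rule_format])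
qed

text \<open>Multiplying the identity by \<open>z powr \<theta>\<close> and letting \<open>z\<close> tend to infinity gives the mass of the
  convergence event.\<close>
lemma prob_conv_event: "prob conv_event = 1"
proof -
  interpret \<eta>: prob_space \<eta> by (rule prob_\<eta>)
  have bound: "(\<integral>y. (1 + y / z) powr \<alpha> \<partial>\<eta>) powr (- \<theta> / \<alpha>) \<le> prob conv_event" if z: "z > 0" for z
  proof -
    have "(\<integral>y. (1 + y / z) powr \<alpha> \<partial>\<eta>) = (\<integral>y. z powr (-\<alpha>) * (z + y) powr \<alpha> \<partial>\<eta>)"
    proof (rule integral_cong_AE)
      show "AE y in \<eta>. (1 + y / z) powr \<alpha> = z powr (-\<alpha>) * (z + y) powr \<alpha>"
        using AE_\<eta>
      proof eventually_elim
        case (elim y)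
        have "1 + y / z = (z + y) / z" using z by (simp add: field_simps)
        then show ?case using z elim by (simp add: powr_divide powr_minus field_simps)
      qed
    qed auto
    then have "(\<integral>y. (1 + y / z) powr \<alpha> \<partial>\<eta>) powr (- \<theta> / \<alpha>) = z powr \<theta> * (\<integral>y. (z + y) powr \<alpha> \<partial>\<eta>) powr (- \<theta> / \<alpha>)"
      using \<alpha> z by (simp add: powr_mult powr_powr)
    also have "\<dots> = expectation (\<lambda>\<omega>. z powr \<theta> * (indicator conv_event \<omega> * (z + S \<omega>) powr (- \<theta>)))"
      using stieltjes_identity_conv_event[OF z] by simp
    also have "\<dots> \<le> expectation (indicator conv_event)"
    proof -
      have le: "AE \<omega> in M. z powr \<theta> * (indicator conv_event \<omega> * (z + S \<omega>) powr (- \<theta>)) \<le> indicator conv_event \<omega>"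
        using AE_S_nonneg
      proof eventually_elim
        case (elim \<omega>)
        have "z powr \<theta> * (z + S \<omega>) powr (- \<theta>) \<le> z powr \<theta> * z powr (- \<theta>)" if "\<omega> \<in> conv_event"
          using z \<theta> elim that by (intro mult_left_mono powr_mono2') auto
        also have "\<dots> = 1" using z by (simp add: powr_minus)
        finally show ?case by (auto simp: indicator_def)
      qed
      have i1: "integrable M (indicator conv_event :: 'a \<Rightarrow> real)"
        by (auto intro!: integrable_real_indicator simp: emeasure_eq_measure)
      have "integrable M (\<lambda>\<omega>. z powr \<theta> * (indicator conv_event \<omega> * (z + S \<omega>) powr (- \<theta>)))"
        by (rule Bochner_Integration.integrable_bound[OF i1 _ eventually_mono[OF le]]) (measurable, auto)
      then show ?thesis using i1 le by (rule integral_mono_AE)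
    qed
    finally show ?thesis by simp
  qed
  \<comment> \<open>At z = n + 1 the rescaled integrand tends to 1 and is dominated by (1 + y) powr
    \<alpha>, so the lower bound for the probability tends to 1.\<close>
  have "(\<lambda>n. \<integral>y. (1 + y / real (Suc n)) powr \<alpha> \<partial>\<eta>) \<longlonglongrightarrow> (\<integral>y. 1 \<partial>\<eta>)"
  proof (rule integral_dominated_convergence[where w = "\<lambda>y. (1 + y) powr \<alpha>"])
    show "integrable \<eta> (\<lambda>y. (1 + y) powr \<alpha>)" by (rule integrable_shift_powr_\<eta>) auto
    show "AE y in \<eta>. (\<lambda>n. (1 + y / real (Suc n)) powr \<alpha>) \<longlonglongrightarrow> 1"
    proof (intro AE_I2)
      fix y :: real
      have "(\<lambda>n. y / real (Suc n)) \<longlonglongrightarrow> 0"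
        using LIMSEQ_Suc[OF lim_const_over_n[of y]] by simp
      then have "(\<lambda>n. (1 + y / real (Suc n)) powr \<alpha>) \<longlonglongrightarrow> (1 + 0) powr \<alpha>"
        by (intro tendsto_intros) auto
      then show "(\<lambda>n. (1 + y / real (Suc n)) powr \<alpha>) \<longlonglongrightarrow> 1" by simp
    qed
    show "AE y in \<eta>. norm ((1 + y / real (Suc n)) powr \<alpha>) \<le> (1 + y) powr \<alpha>" for n
      using AE_\<eta>
    proof eventually_elim
      case (elim y)
      have "y / real (Suc n) \<le> y" using elim by (simp add: divide_le_eq mult_le_cancel_left1)
      then show ?case using elim \<alpha> by (auto intro!: powr_mono2)
    qed
  qed auto
  then have "(\<lambda>n. (\<integral>y. (1 + y / real (Suc n)) powr \<alpha> \<partial>\<eta>) powr (- \<theta> / \<alpha>)) \<longlonglongrightarrow> 1 powr (- \<theta> / \<alpha>)"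
    by (intro tendsto_intros) (auto simp: \<eta>.prob_space)
  then have "1 powr (- \<theta> / \<alpha>) \<le> prob conv_event"
    by (rule LIMSEQ_le_const2) (intro exI allI impI bound, simp)
  then have "1 \<le> prob conv_event" by simp
  then show ?thesis using prob_le_1[of conv_event] by simp
qed

lemma AE_conv: "AE \<omega> in M. \<omega> \<in> conv_event \<and> 0 \<le> S \<omega>"
  using AE_S_nonneg AE_prob_1[OF prob_conv_event] by eventually_elim auto

theorem stieltjes_identity:
  assumes z: "0 < z"
  shows "expectation (\<lambda>\<omega>. (z + S \<omega>) powr (- \<theta>)) = (\<integral>y. (z + y) powr \<alpha> \<partial>\<eta>) powr (- \<theta> / \<alpha>)"
  unfolding stieltjes_identity_conv_event[OF z, symmetric]
  by (rule integral_cong_AE) (use AE_conv in auto)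

text \<open>The weights sum to at most 1, whence S \<le> t almost surely. At z = 1 the transform
  equals that of the constant t, and ordered variables with equal expectations agree almost surely.
  This will exclude a point mass \<eta> when S has a density.\<close>

lemma AE_S_eq_const:
  assumes t: "AE y in \<eta>. y = t"
  shows "AE \<omega> in M. S \<omega> = t"
proof -
  interpret \<eta>: prob_space \<eta> by (rule prob_\<eta>)
  have t0: "0 \<le> t"
  proof -
    have "AE y in \<eta>. 0 \<le> t" using t AE_\<eta> by eventually_elim auto
    then show ?thesis by simp
  qed
  have "AE \<omega> in M. \<forall>k. Y k \<omega> = t"
    unfolding AE_all_countable
  proof
    fix k show "AE \<omega> in M. Y k \<omega> = t"
      using t unfolding distr_Y[of k, symmetric] by (subst (asm) AE_distr_iff) auto
  qed
  with AE_V AE_conv have le: "AE \<omega> in M. 0 \<le> S \<omega> \<and> S \<omega> \<le> t"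
  proof eventually_elim
    case (elim \<omega>)
    then show ?case using stick_sum_bounded(3)[of V \<omega> Y t 0] t0 by auto
  qed
  have "(\<integral>y. (1 + y) powr \<alpha> \<partial>\<eta>) = (\<integral>y. (1 + t) powr \<alpha> \<partial>\<eta>)"
    by (rule integral_cong_AE) (use t in auto)
  then have E: "expectation (\<lambda>\<omega>. (1 + S \<omega>) powr (- \<theta>)) = (1 + t) powr (- \<theta>)"
    using stieltjes_identity[of 1] \<alpha> by (simp add: \<eta>.prob_space powr_powr)
  have int: "integrable M (\<lambda>\<omega>. (1 + S \<omega>) powr (- \<theta>))"
    by (rule integrable_shift_powr[OF _ le]) auto
  have "expectation (\<lambda>\<omega>. (1 + S \<omega>) powr (- \<theta>) - (1 + t) powr (- \<theta>)) = 0"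
    using int E by (simp add: prob_space)
  moreover have "AE \<omega> in M. 0 \<le> (1 + S \<omega>) powr (- \<theta>) - (1 + t) powr (- \<theta>)"
    using le by eventually_elim (use \<theta> in \<open>auto intro!: powr_mono2'\<close>)
  ultimately have "AE \<omega> in M. (1 + S \<omega>) powr (- \<theta>) - (1 + t) powr (- \<theta>) = 0"
    using int by (subst (asm) integral_nonneg_eq_0_iff_AE) auto
  with le show ?thesis
  proof eventually_elim
    case (elim \<omega>)
    then have "(1 + S \<omega>) powr (- \<theta>) = (1 + t) powr (- \<theta>)" by simp
    then have "((1 + S \<omega>) powr (- \<theta>)) powr (- 1 / \<theta>) = ((1 + t) powr (- \<theta>)) powr (- 1 / \<theta>)" by simp
    then show ?case using elim \<theta> by (simp add: powr_powr)
  qed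
qed

end
end

section \<open>Analytic continuation and boundary values\<close>

text \<open>The principal branch has argument \<open>\<pi>\<close> on the negative axis, so \<open>Ln\<close> and \<open>powr\<close> are continuous
  up to that axis from above; multiplying by \<open>-\<i>\<close> moves the cut out of the closed upper half plane.\<close>

lemma Ln_upper_half_plane:
  fixes w :: complex
  assumes "Im w \<ge> 0" "w \<noteq> 0"
  shows "Ln w = Ln (- \<i> * w) + \<i> * pi / 2"
proof -
  \<comment> \<open>The point -i w lies in the closed right half plane. Adding the argument pi/2 of
    i stays in the principal range, so the logarithm of the product splits.\<close>
  have "\<bar>Im (Ln (- \<i> * w))\<bar> \<le> pi / 2"
    using assms by (subst Re_Ln_pos_le) auto
  moreover have "Im (Ln \<i>) = pi / 2" by simp
  ultimately have "- pi < Im (Ln (- \<i> * w)) + Im (Ln \<i>)" "Im (Ln (- \<i> * w)) + Im (Ln \<i>) \<le> pi"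
    using pi_gt_zero by linarith+
  then have "Ln (- \<i> * w * \<i>) = Ln (- \<i> * w) + Ln \<i>"
    using assms by (intro Ln_times_simple) auto
  moreover have "- \<i> * w * \<i> = w" by (simp add: complex_eq_iff)
  ultimately show ?thesis by simp
qed

lemma powr_upper_half_plane:
  fixes w c :: complex
  assumes "Im w \<ge> 0"
  shows "w powr c = (- \<i> * w) powr c * \<i> powr c"
  using Ln_upper_half_plane[of w] assms
  by (cases "w = 0") (simp_all add: powr_def exp_add[symmetric] algebra_simps)

lemma continuous_on_powr_upper_half_plane:
  fixes c :: complex
  assumes "S \<subseteq> {w. Im w \<ge> 0}" and "0 \<in> S \<Longrightarrow> Re c > 0"
  shows "continuous_on S (\<lambda>w. w powr c)"
proof -
  have "continuous_on S (\<lambda>w. (- \<i> * w) powr c * \<i> powr c)"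
    using assms by (intro continuous_intros continuous_on_powr_complex) auto
  moreover have "(- \<i> * w) powr c * \<i> powr c = w powr c" if "w \<in> S" for w
    using assms that by (intro powr_upper_half_plane[symmetric]) auto
  ultimately show ?thesis by (simp cong: continuous_on_cong)
qed

lemma strip_bounded:
  fixes g :: "complex \<Rightarrow> complex"
  assumes "continuous_on {z. Im z \<ge> 0} g"
  obtains K where "0 \<le> K" "\<And>z. 0 \<le> Im z \<Longrightarrow> Im z \<le> 1 \<Longrightarrow> a \<le> Re z \<Longrightarrow> Re z \<le> b \<Longrightarrow> norm (g z) \<le> K"
proof -
  have "continuous_on (cbox (Complex a 0) (Complex b 1)) g"
    by (rule continuous_on_subset[OF assms]) (auto simp: in_cbox_complex_iff)
  then have "bounded (g ` cbox (Complex a 0) (Complex b 1))"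
    by (intro compact_imp_bounded compact_continuous_image compact_cbox)
  then obtain K where K: "\<And>z. z \<in> cbox (Complex a 0) (Complex b 1) \<Longrightarrow> norm (g z) \<le> K"
    unfolding bounded_iff by auto
  show ?thesis
  proof (rule that[of "max K 0"])
    fix z assume "0 \<le> Im z" "Im z \<le> 1" "a \<le> Re z" "Re z \<le> b"
    then have "z \<in> cbox (Complex a 0) (Complex b 1)" by (simp add: in_cbox_complex_iff)
    from K[OF this] show "norm (g z) \<le> max K 0" by simp
  qed simp
qed

lemma norm_powr_of_real: "norm (w powr cr p) = norm w powr p"
  by (simp add: norm_powr_real_powr')

text \<open>When z is real the argument runs along the real line and may enter the cut, and an
  explicit formula by cases is used; otherwise it never meets the cut and the power is continuous in
  x.\<close>

lemma borel_measurable_shift_powr [measurable]: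
  "(\<lambda>x. spw z p x) \<in> borel_measurable borel"
proof (cases "Im z = 0")
  case True
  then have "z + cr x = cr (Re z + x)" for x by (simp add: complex_eq_iff)
  then show ?thesis by (simp only: powr_of_real_if) measurable
next
  case False
  then have "continuous_on UNIV (\<lambda>x. spw z p x)"
    by (intro continuous_intros) (auto simp: complex_nonpos_Reals_iff complex_eq_iff)
  then show ?thesis by (rule borel_measurable_continuous_onI)
qed

text \<open>If z' + x were too small, the point -x of the cut would come within e of z. The bound is
  uniform in z' near z and in x \<ge> 0, and supplies the constants that dominate powers with
  nonpositive exponent.\<close>

lemma slit_plane_distance:
  fixes z :: complex
  assumes "z \<notin> \<real>\<^sub>\<le>\<^sub>0"
  obtains d where "d > 0" "\<And>z' x. z' \<in> ball z d \<Longrightarrow> 0 \<le> x \<Longrightarrow> d \<le> norm (z' + cr x)"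
    "ball z d \<subseteq> - \<real>\<^sub>\<le>\<^sub>0"
proof -
  have "open (- (\<real>\<^sub>\<le>\<^sub>0 :: complex set))" by (simp add: open_Compl)
  then obtain e where e: "e > 0" "ball z e \<subseteq> - \<real>\<^sub>\<le>\<^sub>0" using assms by (meson ComplI openE)
  have "e / 2 \<le> norm (z' + cr x)" if z': "z' \<in> ball z (e / 2)" and x: "0 \<le> x" for z' x
  proof (rule ccontr)
    assume "\<not> ?thesis"
    then have "dist z' (- cr x) < e / 2" by (simp add: dist_norm)
    with z' have "dist z (- cr x) < e"
      using dist_triangle_half_l[of z z' e "- cr x"] by (simp add: dist_commute)
    then have "- cr x \<in> - \<real>\<^sub>\<le>\<^sub>0" using e(2) by auto
    then show False using x by (simp add: complex_nonpos_Reals_iff)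
  qed
  moreover have "ball z (e / 2) \<subseteq> ball z e" using e by auto
  ultimately show ?thesis using e that[of "e / 2"] by auto
qed

lemma shift_slit_plane:
  assumes "z \<notin> \<real>\<^sub>\<le>\<^sub>0" "0 \<le> x" shows "z + cr x \<notin> \<real>\<^sub>\<le>\<^sub>0"
  using assms by (auto simp: complex_nonpos_Reals_iff)

section \<open>Power transforms of a law on the half line\<close>

locale nonneg_law = prob_space \<nu> for \<nu> :: "real measure" +
  assumes sets_\<nu> [measurable_cong, simp]: "sets \<nu> = sets borel"
    and AE_nonneg: "AE x in \<nu>. 0 \<le> x"
begin

text \<open>One family covers all cases: p = -\<theta> under the law of X is its transform, p =
  \<alpha> under \<eta> is m, and p = \<alpha>-1 under \<eta> is the derivative of m up to the
  factor \<alpha>.\<close>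

definition pt :: "real \<Rightarrow> complex \<Rightarrow> complex" where
  "pt p z = (\<integral>x. spw z p x \<partial>\<nu>)"

lemma integrable_pt_neg:
  assumes "z \<notin> \<real>\<^sub>\<le>\<^sub>0" "p \<le> 0"
  shows "integrable \<nu> (\<lambda>x. spw z p x)"
proof -
  obtain d where d: "d > 0" "\<And>z' x. z' \<in> ball z d \<Longrightarrow> 0 \<le> x \<Longrightarrow> d \<le> norm (z' + cr x)"
    "ball z d \<subseteq> - \<real>\<^sub>\<le>\<^sub>0"
    using slit_plane_distance[OF assms(1)] by blast
  show ?thesis
  proof (rule integrable_const_bound[where B = "d powr p"])
    show "AE x in \<nu>. norm (spw z p x) \<le> d powr p"
      using AE_nonneg by eventually_elim (use d assms in \<open>auto simp: norm_powr_of_real intro!: powr_mono2'\<close>)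
  qed measurable
qed

lemma pt_bound_pos:
  assumes p: "0 \<le> p" and z: "norm z \<le> R" and x: "0 \<le> x"
  shows "norm (spw z p x) \<le> 2 powr p * (R powr p + x powr p)"
proof -
  have "norm (z + cr x) \<le> R + x"
    using norm_triangle_ineq[of z "cr x"] z x by simp
  then have "norm (z + cr x) powr p \<le> (R + x) powr p"
    using p by (intro powr_mono2) auto
  also have "\<dots> \<le> 2 powr p * (R powr p + x powr p)"
    using p x z norm_ge_zero[of z] by (intro powr_add_le) linarith+
  finally show ?thesis by (simp add: norm_powr_of_real)
qed

lemma integrable_pt_pos:
  assumes "0 \<le> p" "integrable \<nu> (\<lambda>x. x powr p)"
  shows "integrable \<nu> (\<lambda>x. spw z p x)"
proof (rule Bochner_Integration.integrable_bound)
  show "integrable \<nu> (\<lambda>x. 2 powr p * (norm z powr p + x powr p))" using assms by simp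
  show "AE x in \<nu>. norm (spw z p x) \<le> norm (2 powr p * (norm z powr p + x powr p))"
    using AE_nonneg by eventually_elim (use pt_bound_pos[OF assms(1) order_refl] in auto)
qed measurable

text \<open>Integrability is a hypothesis because it has two sources: the distance to the cut when p
  \<le> 0, and a moment when p = \<alpha>. The derivative has exponent p - 1 \<le> 0 and is bounded
  by a constant near z.\<close>

lemma pt_has_field_derivative:
  assumes int: "\<And>z. z \<notin> \<real>\<^sub>\<le>\<^sub>0 \<Longrightarrow> integrable \<nu> (\<lambda>x. spw z p x)"
    and p: "p \<le> 1" and z: "z \<notin> \<real>\<^sub>\<le>\<^sub>0"
  shows "(pt p has_field_derivative cr p * pt (p - 1) z) (at z)"
proof -
  obtain d where d: "d > 0" "\<And>z' x. z' \<in> ball z d \<Longrightarrow> 0 \<le> x \<Longrightarrow> d \<le> norm (z' + cr x)"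
    "ball z d \<subseteq> - \<real>\<^sub>\<le>\<^sub>0"
    using slit_plane_distance[OF z] by blast
  have "((\<lambda>z. \<integral>x. spw z p x \<partial>\<nu>) has_field_derivative
     (\<integral>x. cr p * spw z (p - 1) x \<partial>\<nu>)) (at z)"
  proof (rule has_field_derivative_integral[where K = "\<lambda>_. \<bar>p\<bar> * d powr (p - 1)", OF d(1)])
    show "integrable \<nu> (\<lambda>x. spw z' p x)" if "z' \<in> ball z d" for z'
      using d(3) that by (intro int) auto
    show "AE x in \<nu>. \<forall>z'\<in>ball z d. ((\<lambda>z. spw z p x) has_field_derivative
        cr p * spw z' (p - 1) x) (at z') \<and>
        norm (cr p * spw z' (p - 1) x) \<le> \<bar>p\<bar> * d powr (p - 1)"
      using AE_nonneg
    proof (eventually_elim, intro ballI conjI)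
      case (elim x)
      fix z' assume z': "z' \<in> ball z d"
      then have "z' + cr x \<notin> \<real>\<^sub>\<le>\<^sub>0" using d(3) elim by (intro shift_slit_plane) auto
      from has_field_derivative_powr[OF this, of "cr p"]
      show "((\<lambda>z. spw z p x) has_field_derivative
        cr p * spw z' (p - 1) x) (at z')"
        by (simp add: DERIV_shift)
      show "norm (cr p * spw z' (p - 1) x) \<le> \<bar>p\<bar> * d powr (p - 1)"
        unfolding norm_mult norm_powr_of_real norm_of_real
        using d(1) d(2)[OF z' elim] p by (intro mult_left_mono powr_mono2') auto
    qed
  qed auto
  then show ?thesis by (simp add: pt_def[abs_def])
qed

lemma pt_holomorphic:
  assumes "\<And>z. z \<notin> \<real>\<^sub>\<le>\<^sub>0 \<Longrightarrow> integrable \<nu> (\<lambda>x. spw z p x)" and "p \<le> 1"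
  shows "pt p holomorphic_on - \<real>\<^sub>\<le>\<^sub>0"
  unfolding holomorphic_on_def field_differentiable_def
  using pt_has_field_derivative[OF assms] has_field_derivative_at_within by blast

lemma pt_cnj:
  assumes z: "z \<notin> \<real>\<^sub>\<le>\<^sub>0"
  shows "pt p (cnj z) = cnj (pt p z)"
proof -
  have "pt p (cnj z) = (\<integral>x. cnj (spw z p x) \<partial>\<nu>)"
    unfolding pt_def
  proof (rule integral_cong_AE)
    show "AE x in \<nu>. (cnj z + cr x) powr cr p = cnj (spw z p x)"
      using AE_nonneg
    proof eventually_elim
      case (elim x)
      then show ?case using z by (subst cnj_powr) (auto simp: complex_nonpos_Reals_iff)
    qed
    show "(\<lambda>x. cnj (spw z p x)) \<in> borel_measurable \<nu>"
      by (rule borel_measurable_continuous_on[OF continuous_on_cnj[OF continuous_on_id]]) measurable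
  qed measurable
  then show ?thesis by (simp add: pt_def)
qed

lemma pt_of_real:
  assumes "0 \<le> z"
  shows "pt p (cr z) = cr (\<integral>x. (z + x) powr p \<partial>\<nu>)"
proof -
  have "pt p (cr z) = (\<integral>x. cr ((z + x) powr p) \<partial>\<nu>)"
    unfolding pt_def
  proof (rule integral_cong_AE)
    show "AE x in \<nu>. (cr z + cr x) powr cr p = cr ((z + x) powr p)"
      using AE_nonneg by eventually_elim (use assms in \<open>simp add: powr_of_real flip: of_real_add\<close>)
  qed measurable
  then show ?thesis by simp
qed

text \<open>The positive exponent makes the integrand continuous even where z + x vanishes, so the
  real axis is included; \<open>pt_bound_pos\<close> provides a local majorant.\<close>

lemma continuous_on_pt_pos:
  assumes p: "0 < p" "integrable \<nu> (\<lambda>x. x powr p)"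
  shows "continuous_on {z. Im z \<ge> 0} (pt p)"
  unfolding continuous_on_def
proof
  fix z0 :: complex assume z0: "z0 \<in> {z. Im z \<ge> 0}"
  define R where "R = norm z0 + 1"
  show "(pt p \<longlongrightarrow> pt p z0) (at z0 within {z. Im z \<ge> 0})"
    unfolding pt_def[abs_def]
  proof (rule integral_dominated_convergence_within)
    show "integrable \<nu> (\<lambda>x. 2 powr p * (R powr p + x powr p))" using p by simp
    show "AE x in \<nu>. ((\<lambda>z. spw z p x) \<longlongrightarrow> spw z0 p x) (at z0 within {z. Im z \<ge> 0})"
    proof (intro AE_I2)
      fix x
      have "continuous_on {z. Im z \<ge> 0} (\<lambda>z. spw z p x)"
        by (rule continuous_on_compose2[OF continuous_on_powr_upper_half_plane[of "{z. Im z \<ge> 0}"]])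
          (use p in \<open>auto intro!: continuous_intros\<close>)
      then show "((\<lambda>z. spw z p x) \<longlongrightarrow> spw z0 p x) (at z0 within {z. Im z \<ge> 0})"
        using z0 by (simp add: continuous_on_def)
    qed
    have "\<forall>\<^sub>F z in at z0 within {z. Im z \<ge> 0}. dist z z0 < 1"
      by (auto simp: eventually_at intro: exI[of _ 1])
    then show "\<forall>\<^sub>F z in at z0 within {z. Im z \<ge> 0}. AE x in \<nu>. norm (spw z p x) \<le> 2 powr p * (R powr p + x powr p)"
    proof eventually_elim
      case (elim z)
      then have "norm z \<le> R" using norm_triangle_sub[of z z0] by (simp add: R_def dist_norm)
      with AE_nonneg show ?case by (auto elim!: eventually_mono intro!: pt_bound_pos simp: p less_imp_le)
    qed
  qed measurable
qed

end

text \<open>From here on only the two laws and the identity on the positive axis matter. For a point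
  mass at t, excluded by \<open>nondegenerate\<close>, m would vanish at -t and m powr
  (-\<theta>/\<alpha>) would be discontinuous there.\<close>

locale stieltjes_pair = \<mu>: nonneg_law \<mu> + \<eta>: nonneg_law \<eta> for \<mu> \<eta> :: "real measure" +
  fixes \<alpha> \<theta> :: real
  assumes \<alpha>: "0 < \<alpha>" "\<alpha> < 1" and \<theta>: "0 < \<theta>"
    and moment: "integrable \<eta> (\<lambda>x. x powr \<alpha>)"
    and nondegenerate: "\<And>t. \<not> (AE y in \<eta>. y = t)"
    and identity: "\<And>z. 0 < z \<Longrightarrow> (\<integral>x. (z + x) powr (- \<theta>) \<partial>\<mu>) = (\<integral>y. (z + y) powr \<alpha> \<partial>\<eta>) powr (- \<theta> / \<alpha>)"
begin

abbreviation A :: "complex \<Rightarrow> complex" where "A \<equiv> \<eta>.pt \<alpha>"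
abbreviation St :: "complex \<Rightarrow> complex" where "St \<equiv> \<mu>.pt (- \<theta>)"

text \<open>A closed form that still makes sense on the negative axis, where the integral in
  \<open>St\<close> need not converge; there it supplies the boundary value from above.\<close>

definition Sh :: "complex \<Rightarrow> complex" where "Sh z = A z powr cr (- \<theta> / \<alpha>)"

lemma integrable_A: "integrable \<eta> (\<lambda>x. spw z \<alpha> x)"
  using \<alpha> moment by (intro \<eta>.integrable_pt_pos) auto

text \<open>On the closed upper half plane w powr \<alpha> has imaginary part |w| powr \<alpha> *
  sin (\<alpha> Arg w) \<ge> 0, since \<alpha> Arg w < pi. If A z were a nonpositive real, this
  would vanish almost everywhere and force z + x to be a nonnegative real. Then A z \<ge> 0, hence A
  z = 0, and x = -Re z almost everywhere, against \<open>nondegenerate\<close>.\<close>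

lemma A_upper:
  assumes z: "Im z \<ge> 0"
  shows "A z \<notin> \<real>\<^sub>\<le>\<^sub>0"
proof
  let ?f = "\<lambda>x. spw z \<alpha> x"
  assume "A z \<in> \<real>\<^sub>\<le>\<^sub>0"
  then have A: "Im (A z) = 0" "Re (A z) \<le> 0" by (auto simp: complex_nonpos_Reals_iff)
  have polar: "Im (w powr cr \<alpha>) = norm w powr \<alpha> * sin (\<alpha> * Arg w)" for w
  proof (cases "w = 0")
    case False
    then show ?thesis
      by (simp add: powr_def Im_exp Arg_eq_Im_Ln)
  qed simp
  have arg: "0 \<le> \<alpha> * Arg w \<and> \<alpha> * Arg w < pi" if "Im w \<ge> 0" for w
  proof -
    have "0 \<le> Arg w" using that Arg_less_0[of w] by linarith
    moreover have "\<alpha> * Arg w \<le> \<alpha> * pi" using Arg_le_pi[of w] \<alpha> by (intro mult_left_mono) auto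
    moreover have "\<alpha> * pi < pi" using \<alpha> by simp
    moreover have "0 \<le> \<alpha> * Arg w" using \<alpha> calculation(1) by simp
    ultimately show ?thesis by linarith
  qed
  have nn: "0 \<le> Im (?f x)" for x
    unfolding polar using arg[of "z + cr x"] z by (intro mult_nonneg_nonneg[OF powr_ge_zero sin_ge_zero]) auto
  have "(\<integral>x. Im (?f x) \<partial>\<eta>) = 0" using A(1) integrable_A[of z] by (simp add: \<eta>.pt_def)
  then have "AE x in \<eta>. Im (?f x) = 0"
    using integrable_A[of z] nn by (subst (asm) integral_nonneg_eq_0_iff_AE) auto
  then have pos: "AE x in \<eta>. Im z = 0 \<and> 0 \<le> Re z + x"
  proof eventually_elim
    case (elim x)
    let ?w = "z + cr x"
    show ?case
    proof (cases "?w = 0")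
      case True
      then show ?thesis by (auto simp: complex_eq_iff)
    next
      case False
      then have "sin (\<alpha> * Arg ?w) = 0" using elim unfolding polar by simp
      then have "\<alpha> * Arg ?w = 0" using arg[of ?w] z sin_gt_zero[of "\<alpha> * Arg ?w"] by (cases "\<alpha> * Arg ?w > 0") auto
      then have "Arg ?w = 0" using \<alpha> by simp
      then have "?w \<in> \<real>" "0 \<le> Re ?w" using Arg_eq_0 by blast+
      then show ?thesis by (auto simp: complex_is_Real_iff)
    qed
  qed
  then have Imz: "Im z = 0" using \<eta>.AE_const by (simp add: AE_conj_iff)
  have eq: "AE x in \<eta>. ?f x = cr ((Re z + x) powr \<alpha>)"
    using pos
  proof eventually_elim
    case (elim x)
    then have "z + cr x = cr (Re z + x)" by (simp add: complex_eq_iff)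
    then show ?case using elim powr_of_real[of "Re z + x" \<alpha>] by (simp only:)
  qed
  have "(\<integral>x. (Re z + x) powr \<alpha> \<partial>\<eta>) = (\<integral>x. Re (?f x) \<partial>\<eta>)"
  proof (rule integral_cong_AE)
    show "AE x in \<eta>. (Re z + x) powr \<alpha> = Re (?f x)" using eq by eventually_elim simp
    show "(\<lambda>x. Re (?f x)) \<in> borel_measurable \<eta>" using integrable_A[of z] by (intro borel_measurable_integrable integrable_Re)
  qed measurable
  also have "\<dots> = Re (A z)" using integrable_A[of z] by (simp add: \<eta>.pt_def)
  finally have "(\<integral>x. (Re z + x) powr \<alpha> \<partial>\<eta>) = 0"
    using A(2) integral_nonneg_AE[of "\<lambda>x. (Re z + x) powr \<alpha>" \<eta>] by auto
  moreover have "integrable \<eta> (\<lambda>x. (Re z + x) powr \<alpha>)"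
  proof (rule integrable_cong_AE_imp)
    show "integrable \<eta> (\<lambda>x. Re (?f x))" using integrable_A by (rule integrable_Re)
    show "AE x in \<eta>. Re (?f x) = (Re z + x) powr \<alpha>" using eq by eventually_elim simp
  qed measurable
  ultimately have "AE x in \<eta>. (Re z + x) powr \<alpha> = 0"
    by (subst (asm) integral_nonneg_eq_0_iff_AE) auto
  then have "AE x in \<eta>. x = - Re z" by eventually_elim auto
  then show False using nondegenerate by blast
qed

lemma A_slit:
  assumes "z \<notin> \<real>\<^sub>\<le>\<^sub>0" shows "A z \<notin> \<real>\<^sub>\<le>\<^sub>0"
proof (cases "Im z \<ge> 0")
  case False
  then have "A (cnj z) \<notin> \<real>\<^sub>\<le>\<^sub>0" by (intro A_upper) simp
  then show ?thesis unfolding \<eta>.pt_cnj[OF assms] by (simp add: complex_nonpos_Reals_iff)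
qed (rule A_upper)

lemma connected_slit: "connected (- \<real>\<^sub>\<le>\<^sub>0 :: complex set)"
proof -
  have "(\<real>\<^sub>\<le>\<^sub>0 :: complex set) = cr ` {..0}"
    by (auto simp: nonpos_Reals_def)
  then show ?thesis using starlike_slotted_complex_plane_left[of 0] by (simp add: starlike_imp_connected)
qed

theorem St_eq_Sh:
  assumes z: "z \<notin> \<real>\<^sub>\<le>\<^sub>0"
  shows "St z = Sh z"
proof -
  have A: "A holomorphic_on - \<real>\<^sub>\<le>\<^sub>0" by (rule \<eta>.pt_holomorphic) (use integrable_A \<alpha> in auto)
  have Sh: "Sh holomorphic_on - \<real>\<^sub>\<le>\<^sub>0"
    unfolding Sh_def[abs_def] using A_slit by (intro holomorphic_intros A) auto
  have St: "St holomorphic_on - \<real>\<^sub>\<le>\<^sub>0"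
    by (rule \<mu>.pt_holomorphic) (use \<mu>.integrable_pt_neg[of _ "- \<theta>"] \<theta> in auto)
  have "St z - Sh z = 0"
  proof (rule analytic_continuation[where f = "\<lambda>z. St z - Sh z" and w = z and S = "- \<real>\<^sub>\<le>\<^sub>0" and U = "cr ` {0<..}" and \<xi> = 1])
    show "(\<lambda>z. St z - Sh z) holomorphic_on - \<real>\<^sub>\<le>\<^sub>0" by (intro holomorphic_intros St Sh)
    show "1 islimpt cr ` {0<..}"
    proof -
      have "(1::real) islimpt {0<..}" by (intro interior_limit_point) (simp add: interior_open)
      then have "cr 1 islimpt cr ` {0<..}"
        by (rule islimpt_isCont_image) (auto simp: eventually_at_filter)
      then show ?thesis by simp
    qed
    fix w assume "w \<in> cr ` {0<..}"
    then obtain x where x: "x > 0" "w = cr x" by auto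
    have "0 \<le> (\<integral>y. (x + y) powr \<alpha> \<partial>\<eta>)" by (rule integral_nonneg_AE) auto
    then show "St w - Sh w = 0"
      using x identity[OF x(1)] powr_of_real[of "\<integral>y. (x + y) powr \<alpha> \<partial>\<eta>" "- \<theta> / \<alpha>"]
      unfolding Sh_def by (simp add: \<mu>.pt_of_real \<eta>.pt_of_real)
  qed (use z connected_slit in \<open>auto simp: open_Compl complex_nonpos_Reals_iff\<close>)
  then show ?thesis by simp
qed

lemma continuous_on_A: "continuous_on {z. Im z \<ge> 0} A"
  using \<alpha> moment by (intro \<eta>.continuous_on_pt_pos)

lemma continuous_on_Sh: "continuous_on {z. Im z \<ge> 0} Sh"
proof -
  have "A z \<noteq> 0 \<and> (0 \<le> Re (A z) \<or> Im (A z) \<noteq> 0)" if "Im z \<ge> 0" for z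
    using A_upper[OF that] by (auto simp: complex_nonpos_Reals_iff)
  then show ?thesis
    unfolding Sh_def[abs_def]
    by (intro continuous_on_powr_complex continuous_on_A continuous_on_const) auto
qed

text \<open>Only boundary values from above are needed: by conjugation symmetry the difference of the
  values below and above the axis is \<open>-2\<i>\<close> times the imaginary part of the latter.\<close>
definition \<delta> :: "real \<Rightarrow> real" where
  "\<delta> t = - Im (Sh (- cr t)) / pi"

lemma continuous_on_\<delta>: "continuous_on UNIV \<delta>"
  unfolding \<delta>_def[abs_def]
  by (intro continuous_intros continuous_on_compose2[OF continuous_on_Sh]) auto

lemma boundary_limit:
  "((\<lambda>\<epsilon>. (St (- cr t - \<i> * cr \<epsilon>) - St (- cr t + \<i> * cr \<epsilon>))
     / (2 * cr pi * \<i>)) \<longlongrightarrow> cr (\<delta> t)) (at_right 0)"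
proof -
  \<comment> \<open>Clamping the height at 0 extends the function continuously to all real
    \<epsilon>, so the one-sided limit becomes an instance of continuity.\<close>
  have "isCont (\<lambda>\<epsilon>. Sh (- cr t + \<i> * cr (max \<epsilon> 0))) 0"
  proof -
    have "continuous_on UNIV (\<lambda>\<epsilon>. Sh (- cr t + \<i> * cr (max \<epsilon> 0)))"
      by (intro continuous_intros continuous_on_compose2[OF continuous_on_Sh]) auto
    then show ?thesis by (simp add: continuous_on_eq_continuous_at)
  qed
  then have "((\<lambda>\<epsilon>. Sh (- cr t + \<i> * cr (max \<epsilon> 0))) \<longlongrightarrow> Sh (- cr t)) (at_right 0)"
    unfolding isCont_def by (auto intro: filterlim_mono[OF _ order_refl at_le])
  then have "((\<lambda>\<epsilon>. cr (- Im (Sh (- cr t + \<i> * cr (max \<epsilon> 0))) / pi)) \<longlongrightarrow> cr (\<delta> t)) (at_right 0)"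
    unfolding \<delta>_def by (intro tendsto_intros) auto
  moreover have "\<forall>\<^sub>F \<epsilon> in at_right 0. cr (- Im (Sh (- cr t + \<i> * cr (max \<epsilon> 0))) / pi)
     = (St (- cr t - \<i> * cr \<epsilon>) - St (- cr t + \<i> * cr \<epsilon>)) / (2 * cr pi * \<i>)"
  proof -
    have "\<forall>\<^sub>F \<epsilon> in at_right (0::real). 0 < \<epsilon>" by (simp add: eventually_at_right_less)
    then show ?thesis
    proof eventually_elim
      case (elim \<epsilon>)
      define z where "z = - cr t + \<i> * cr \<epsilon>"
      have z: "z \<notin> \<real>\<^sub>\<le>\<^sub>0" using elim by (simp add: z_def complex_nonpos_Reals_iff)
      have eqs: "max \<epsilon> 0 = \<epsilon>" "- cr t - \<i> * cr \<epsilon> = cnj z"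
        "- cr t + \<i> * cr \<epsilon> = z" using elim by (auto simp: z_def)
      have "cnj (Sh z) - Sh z = - 2 * \<i> * cr (Im (Sh z))"
        by (simp add: complex_eq_iff)
      then show ?case
        unfolding eqs \<mu>.pt_cnj[OF z] St_eq_Sh[OF z] by (simp add: field_simps)
    qed
  qed
  ultimately show ?thesis by (rule Lim_transform_eventually)
qed

end

section \<open>The distribution function\<close>

definition kern :: "real \<Rightarrow> real \<Rightarrow> real" where
  "kern \<theta> u = indicator {0<..} u * u powr (\<theta> - 1)"

lemma kern_nonneg: "0 \<le> kern \<theta> u"
  by (simp add: kern_def)

lemma borel_measurable_kern [measurable]: "kern \<theta> \<in> borel_measurable borel"
  unfolding kern_def[abs_def] by measurable

lemma tendsto_ereal_0: "((f \<circ> real_of_ereal) \<longlongrightarrow> c) (at_right 0) \<longleftrightarrow> (f \<longlongrightarrow> c) (at_right (0::real))"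
  unfolding zero_ereal_def by (rule ereal_tendsto_simps1)

text \<open>The function u powr \<theta> * (1 + u) powr (-\<theta>) increases from 0 to 1, and its
  derivative is \<theta> times this integrand, which is the majorant in the integrals over u that
  follow.\<close>

lemma kern_integrable:
  assumes \<theta>: "0 < \<theta>"
  shows "integrable lborel (\<lambda>u. kern \<theta> u * (1 + u) powr (- \<theta> - 1))"
proof -
  define f where "f u = \<theta> * (u powr (\<theta> - 1) * (1 + u) powr (- \<theta> - 1))" for u :: real
  have "set_integrable lborel (einterval 0 \<infinity>) f"
  proof (rule interval_integral_FTC_nonneg)
    fix u assume "0 < ereal u"
    then have u: "0 < u" by simp
    have "(1 + u) powr (- \<theta>) = (1 + u) powr (- \<theta> - 1) * (1 + u)"
      using u by (simp add: powr_diff)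
    moreover have "u powr \<theta> = u powr (\<theta> - 1) * u" using u by (simp add: powr_diff)
    ultimately have "\<theta> * u powr (\<theta> - 1) * (1 + u) powr (- \<theta>) + u powr \<theta> * (- \<theta> * (1 + u) powr (- \<theta> - 1)) = f u"
      by (simp add: f_def algebra_simps)
    moreover have "((\<lambda>u. u powr \<theta> * (1 + u) powr (- \<theta>)) has_real_derivative
        (\<theta> * u powr (\<theta> - 1) * (1 + u) powr (- \<theta>) + u powr \<theta> * (- \<theta> * (1 + u) powr (- \<theta> - 1)))) (at u)"
      using u by (auto intro!: derivative_eq_intros)
    ultimately show "((\<lambda>u. u powr \<theta> * (1 + u) powr (- \<theta>)) has_real_derivative f u) (at u)" by simp
    show "isCont f u" using u unfolding f_def by (intro continuous_intros) auto
  next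
    show "AE u in lborel. 0 < ereal u \<longrightarrow> ereal u < \<infinity> \<longrightarrow> 0 \<le> f u"
      using \<theta> by (auto simp: f_def)
    have "((\<lambda>u. u powr \<theta> * (1 + u) powr (- \<theta>)) \<longlongrightarrow> 0) (at_right (0::real))"
      using \<theta> by real_asymp
    then show "(((\<lambda>u. u powr \<theta> * (1 + u) powr (- \<theta>)) \<circ> real_of_ereal) \<longlongrightarrow> 0) (at_right 0)"
      by (simp add: tendsto_ereal_0)
    have "((\<lambda>u::real. u powr \<theta> * (1 + u) powr (- \<theta>)) \<longlongrightarrow> 1) at_top"
      using \<theta> by real_asymp
    then show "(((\<lambda>u. u powr \<theta> * (1 + u) powr (- \<theta>)) \<circ> real_of_ereal) \<longlongrightarrow> 1) (at_left \<infinity>)"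
      by (simp add: ereal_tendsto_simps1)
  qed simp
  then have "set_integrable lborel {0<..} f" by (simp add: zero_ereal_def)
  then have "integrable lborel (\<lambda>u. 1 / \<theta> * (indicator {0<..} u *\<^sub>R f u))"
    unfolding set_integrable_def by (rule integrable_mult_right)
  then show ?thesis using \<theta> by (simp add: f_def kern_def mult_ac)
qed

text \<open>Adding u - R \<le> |w + u| and 1 + R \<le> ((1 + R) / d) |w + u| gives a growth in u
  that is uniform over the region Im w \<ge> d, Re w \<ge> -R.\<close>

lemma one_plus_le_norm:
  assumes "0 < d" "d \<le> Im w" "- R \<le> Re w" "0 \<le> R" "0 \<le> u"
  shows "1 + u \<le> (1 + (1 + R) / d) * norm (w + cr u)"
proof -
  have 1: "u - R \<le> norm (w + cr u)"
    using complex_Re_le_cmod[of "w + cr u"] assms by simp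
  have "d \<le> norm (w + cr u)"
    using abs_Im_le_cmod[of "w + cr u"] assms by simp
  then have "(1 + R) / d * d \<le> (1 + R) / d * norm (w + cr u)"
    using assms by (intro mult_left_mono) auto
  then have "1 + R \<le> (1 + R) / d * norm (w + cr u)" using assms by simp
  with 1 show ?thesis by (simp add: algebra_simps)
qed

lemma norm_powr_bound:
  assumes "0 < d" "d \<le> Im w" "- R \<le> Re w" "0 \<le> R" "0 \<le> u" "0 < \<theta>"
  shows "norm (spw w (- \<theta> - 1) u) \<le> (1 + (1 + R) / d) powr (\<theta> + 1) * (1 + u) powr (- \<theta> - 1)"
proof -
  define C where "C = 1 + (1 + R) / d"
  have C: "C > 0" using assms by (auto simp: C_def intro!: add_pos_nonneg)
  have "(1 + u) / C \<le> norm (w + cr u)"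
    using one_plus_le_norm[OF assms(1-5)] C by (simp add: C_def[symmetric] divide_le_eq mult.commute)
  then have "norm (w + cr u) powr (- \<theta> - 1) \<le> ((1 + u) / C) powr (- \<theta> - 1)"
    using assms C by (intro powr_mono2') auto
  also have "\<dots> = C powr (\<theta> + 1) * (1 + u) powr (- \<theta> - 1)"
  proof -
    have e: "- \<theta> - 1 = - (\<theta> + 1)" by simp
    show ?thesis unfolding e powr_minus using assms C by (simp add: powr_divide field_simps)
  qed
  finally show ?thesis unfolding norm_powr_of_real C_def .
qed

text \<open>By the mean value inequality on a convex region a difference gains one order of decay in
  u; this is what makes the integral against \<open>kern\<close> converge at infinity.\<close>

lemma norm_powr_diff_bound:
  assumes "0 < d" "0 \<le> R" "0 \<le> u" "0 < \<theta>"
    and w: "d \<le> Im w" "- R \<le> Re w" and w': "d \<le> Im w'" "- R \<le> Re w'"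
  shows "norm (spw w (- \<theta>) u - spw w' (- \<theta>) u)
    \<le> \<theta> * ((1 + (1 + R) / d) powr (\<theta> + 1) * (1 + u) powr (- \<theta> - 1)) * norm (w - w')"
proof (rule field_differentiable_bound[where S = "{w. d \<le> Im w} \<inter> {w. - R \<le> Re w}"
    and f = "\<lambda>w. spw w (- \<theta>) u"
    and f' = "\<lambda>w. cr (- \<theta>) * spw w (- \<theta> - 1) u"])
  show "convex ({w. d \<le> Im w} \<inter> {w. - R \<le> Re w})"
    using convex_halfspace_Im_ge[of d] convex_halfspace_Re_ge[of "- R"] by (intro convex_Int) auto
  fix z assume z: "z \<in> {w. d \<le> Im w} \<inter> {w. - R \<le> Re w}"
  then have "z + cr u \<notin> \<real>\<^sub>\<le>\<^sub>0" using assms by (auto simp: complex_nonpos_Reals_iff)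
  from has_field_derivative_powr[OF this, of "cr (- \<theta>)"]
  have "((\<lambda>w. spw w (- \<theta>) u) has_field_derivative
      cr (- \<theta>) * spw z (- \<theta> - 1) u) (at z)"
    by (simp add: DERIV_shift)
  then show "((\<lambda>w. spw w (- \<theta>) u) has_field_derivative
      cr (- \<theta>) * spw z (- \<theta> - 1) u)
      (at z within {w. d \<le> Im w} \<inter> {w. - R \<le> Re w})"
    by (rule has_field_derivative_at_within)
  show "norm (cr (- \<theta>) * spw z (- \<theta> - 1) u)
      \<le> \<theta> * ((1 + (1 + R) / d) powr (\<theta> + 1) * (1 + u) powr (- \<theta> - 1))"
    using norm_powr_bound[of d z R u \<theta>] z assms
    unfolding norm_mult norm_of_real by (intro mult_mono norm_ge_zero) auto
qed (use w w' in auto)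

text \<open>The primitive of \<theta> times the integrand is u powr \<theta> * (w + u) powr
  (-\<theta>) / w, which runs from 0 to 1/w; its differentiation leaves the factor ((w + u) - u) / w
  = 1.\<close>

lemma kern_integral_inverse:
  assumes \<theta>: "0 < \<theta>" and w: "0 < Im w"
  shows "integrable lborel (\<lambda>u. cr (kern \<theta> u) * spw w (- \<theta> - 1) u)"
    and "(\<integral>u. cr (kern \<theta> u) * spw w (- \<theta> - 1) u \<partial>lborel) = 1 / (cr \<theta> * w)"
proof -
  let ?g = "\<lambda>u. cr (kern \<theta> u) * spw w (- \<theta> - 1) u"
  have [measurable]: "(\<lambda>u. spw w (- \<theta> - 1) u) \<in> borel_measurable borel"
    by (rule borel_measurable_shift_powr)
  define C where "C = (1 + (1 + \<bar>Re w\<bar>) / Im w) powr (\<theta> + 1)"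
  show int: "integrable lborel ?g"
  proof (rule Bochner_Integration.integrable_bound)
    show "integrable lborel (\<lambda>u. C * (kern \<theta> u * (1 + u) powr (- \<theta> - 1)))"
      by (intro integrable_mult_right kern_integrable \<theta>)
    show "AE u in lborel. norm (?g u) \<le> norm (C * (kern \<theta> u * (1 + u) powr (- \<theta> - 1)))"
    proof (intro AE_I2)
      fix u :: real
      show "norm (?g u) \<le> norm (C * (kern \<theta> u * (1 + u) powr (- \<theta> - 1)))"
      proof (cases "u > 0")
        case True
        have "norm (?g u) = kern \<theta> u * norm (spw w (- \<theta> - 1) u)"
          by (simp only: norm_mult norm_of_real abs_of_nonneg[OF kern_nonneg])
        also have "\<dots> \<le> kern \<theta> u * (C * (1 + u) powr (- \<theta> - 1))"
          unfolding C_def using True w \<theta>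
          by (intro mult_left_mono norm_powr_bound kern_nonneg) auto
        also have "\<dots> \<le> norm (C * (kern \<theta> u * (1 + u) powr (- \<theta> - 1)))"
          unfolding real_norm_def by (rule order.trans[OF _ abs_ge_self]) (simp add: mult_ac)
        finally show ?thesis .
      qed (simp add: kern_def)
    qed
  qed measurable
  define f where "f u = cr (\<theta> * u powr (\<theta> - 1)) * spw w (- \<theta> - 1) u" for u
  define F where "F u = cr (u powr \<theta>) * spw w (- \<theta>) u / w" for u
  have w0: "w \<noteq> 0" using w by auto
  have slit: "w + cr u \<notin> \<real>\<^sub>\<le>\<^sub>0" for u using w by (auto simp: complex_nonpos_Reals_iff)
  have gf: "indicator {0<..} u *\<^sub>R f u = cr \<theta> * ?g u" for u
    by (simp add: f_def kern_def indicator_def)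
  have "(LBINT u=0..\<infinity>. f u) = 1 / w - 0"
  proof (rule interval_integral_FTC_integrable)
    fix u assume "0 < ereal u"
    then have u: "0 < u" by simp
    define p where "p = spw w (- \<theta> - 1) u"
    have wu: "w + cr u \<noteq> 0" using slit[of u] by auto
    have p1: "spw w (- \<theta>) u = p * (w + cr u)"
    proof -
      have "(w + cr u) powr (cr (- \<theta> - 1) + 1) = p * (w + cr u) powr 1"
        unfolding p_def by (rule powr_add)
      then show ?thesis using wu by simp
    qed
    have p2: "u powr \<theta> = u powr (\<theta> - 1) * u" using u by (simp add: powr_diff)
    have d1: "((\<lambda>u. cr (u powr \<theta>)) has_vector_derivative cr (\<theta> * u powr (\<theta> - 1))) (at u)"
      using u by (intro has_vector_derivative_of_real) (auto intro!: derivative_eq_intros simp: has_real_derivative_iff_has_vector_derivative[symmetric])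
    have d2: "((\<lambda>u. spw w (- \<theta>) u) has_vector_derivative (cr (- \<theta>) * p)) (at u)"
    proof -
      have "((\<lambda>z. z powr cr (- \<theta>)) has_field_derivative cr (- \<theta>) * p) (at (w + cr u))"
        unfolding p_def using has_field_derivative_powr[OF slit[of u], of "cr (- \<theta>)"] by simp
      moreover have "((\<lambda>u. w + cr u) has_vector_derivative 1) (at u)"
        by (auto intro!: derivative_eq_intros)
      ultimately have "((\<lambda>z. z powr cr (- \<theta>)) \<circ> (\<lambda>u. w + cr u) has_vector_derivative 1 * (cr (- \<theta>) * p)) (at u)"
        by (rule field_vector_diff_chain_at[rotated])
      then show ?thesis by (simp add: comp_def)
    qed
    have "(F has_vector_derivative (cr (u powr \<theta>) * (cr (- \<theta>) * p)
      + cr (\<theta> * u powr (\<theta> - 1)) * spw w (- \<theta>) u) / w) (at u)"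
      unfolding F_def[abs_def] by (intro has_vector_derivative_divide has_vector_derivative_mult d1 d2)
    also have "(cr (u powr \<theta>) * (cr (- \<theta>) * p)
      + cr (\<theta> * u powr (\<theta> - 1)) * spw w (- \<theta>) u) / w = f u"
      unfolding f_def p_def[symmetric] p1 p2 using w0 by (simp add: field_simps)
    finally show "(F has_vector_derivative f u) (at u)" .
    show "isCont f u"
    proof -
      have "isCont (\<lambda>u. spw w (- \<theta> - 1) u) u"
        using slit[of u] by (intro continuous_intros) auto
      moreover have "isCont (\<lambda>u. cr (\<theta> * u powr (\<theta> - 1))) u"
        using u by (intro continuous_intros) auto
      ultimately show ?thesis unfolding f_def[abs_def] by (rule isCont_mult[rotated])
    qed
  next
    have "integrable lborel (\<lambda>u. cr \<theta> * ?g u)" using int by (rule integrable_mult_right)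
    then show "set_integrable lborel (einterval 0 \<infinity>) f"
      unfolding set_integrable_def zero_ereal_def by (simp only: einterval_eq gf)
    have "((\<lambda>u. cr (u powr \<theta>) * spw w (- \<theta>) u / w) \<longlongrightarrow> cr 0 * spw w (- \<theta>) 0 / w) (at_right 0)"
    proof (intro tendsto_intros)
      show "((\<lambda>u. u powr \<theta>) \<longlongrightarrow> 0) (at_right (0::real))" using \<theta> by real_asymp
    qed (use w w0 slit[of 0] in auto)
    then show "((F \<circ> real_of_ereal) \<longlongrightarrow> 0) (at_right 0)" by (simp add: tendsto_ereal_0 F_def[abs_def])
    \<comment> \<open>At infinity u is taken out of w + u. A positive factor does not move the
      argument, so the principal power splits and the two powers of u cancel.\<close>
    have "((\<lambda>u. (w / cr u + 1) powr cr (- \<theta>) / w) \<longlongrightarrow> (0 + 1) powr cr (- \<theta>) / w) at_top"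
    proof (intro tendsto_intros)
      show "((\<lambda>u. w / cr u) \<longlongrightarrow> 0) at_top"
      proof (rule tendsto_divide_0[OF tendsto_const])
        show "filterlim cr at_infinity at_top"
          by (rule filterlim_of_real_at_infinity)
      qed
    qed (use w0 in auto)
    moreover have "\<forall>\<^sub>F u in at_top. (w / cr u + 1) powr cr (- \<theta>) / w = F u"
      using eventually_gt_at_top[of 0]
    proof eventually_elim
      case (elim u)
      have nz: "w / cr u + 1 \<noteq> 0" using slit[of u] elim by (auto simp: field_simps)
      have "w + cr u = cr u * (w / cr u + 1)" using elim by (simp add: field_simps)
      moreover have "w + cr u \<noteq> 0" using slit[of u] by auto
      moreover have "(cr u * (w / cr u + 1)) powr cr (- \<theta>)
          = cr u powr cr (- \<theta>) * (w / cr u + 1) powr cr (- \<theta>)"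
        using elim nz Ln_times_of_real[OF elim nz] calculation(2)
        by (simp add: powr_def exp_add[symmetric] Ln_of_real ring_distribs del: add.commute)
      ultimately have "spw w (- \<theta>) u = cr (u powr (- \<theta>)) * (w / cr u + 1) powr cr (- \<theta>)"
        using elim powr_of_real[of u "- \<theta>"] by (simp only: less_imp_le)
      then have "F u = cr (u powr \<theta> * u powr (- \<theta>)) * (w / cr u + 1) powr cr (- \<theta>) / w"
        unfolding F_def by simp
      also have "u powr \<theta> * u powr (- \<theta>) = 1" using elim by (simp add: powr_minus)
      finally show ?case by simp
    qed
    ultimately have "(F \<longlongrightarrow> (0 + 1) powr cr (- \<theta>) / w) at_top" by (rule Lim_transform_eventually)
    then show "((F \<circ> real_of_ereal) \<longlongrightarrow> 1 / w) (at_left \<infinity>)" by (simp add: ereal_tendsto_simps1)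
  qed simp
  then have "(LINT u:{0<..}|lborel. f u) = 1 / w" unfolding interval_lebesgue_integral_0_infty by simp
  then have "cr \<theta> * (\<integral>u. ?g u \<partial>lborel) = 1 / w"
    unfolding set_lebesgue_integral_def gf by simp
  then show "(\<integral>u. ?g u \<partial>lborel) = 1 / (cr \<theta> * w)"
    using \<theta> w0 by (simp add: field_simps)
qed

text \<open>As functions of w both sides have derivative -1/w on the upper half plane, by
  \<open>kern_integral_inverse\<close>, and both vanish at w0.\<close>

lemma kern_log:
  assumes \<theta>: "0 < \<theta>" and w: "0 < Im w" and w0: "0 < Im w0"
  shows "(\<integral>u. cr (kern \<theta> u) * (spw w (- \<theta>) u - spw w0 (- \<theta>) u) \<partial>lborel)
    = Ln w0 - Ln w"
proof -
  define F where "F z u = cr (kern \<theta> u) * (spw z (- \<theta>) u - spw w0 (- \<theta>) u)" for z u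
  define F' where "F' z u = cr (- \<theta>) * (cr (kern \<theta> u) * spw z (- \<theta> - 1) u)" for z u
  have [measurable]: "(\<lambda>u. spw z p u) \<in> borel_measurable borel" for z p
    by (rule borel_measurable_shift_powr)
  have F_int: "integrable lborel (F z)" if z: "Im z > 0" for z
  proof -
    define d where "d = min (Im z) (Im w0)"
    define R where "R = \<bar>Re z\<bar> + \<bar>Re w0\<bar>"
    define C where "C = \<theta> * (1 + (1 + R) / d) powr (\<theta> + 1) * norm (z - w0)"
    show ?thesis
    proof (rule Bochner_Integration.integrable_bound)
      show "integrable lborel (\<lambda>u. C * (kern \<theta> u * (1 + u) powr (- \<theta> - 1)))"
        by (intro integrable_mult_right kern_integrable \<theta>)
      show "AE u in lborel. norm (F z u) \<le> norm (C * (kern \<theta> u * (1 + u) powr (- \<theta> - 1)))"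
      proof (intro AE_I2)
        fix u :: real
        show "norm (F z u) \<le> norm (C * (kern \<theta> u * (1 + u) powr (- \<theta> - 1)))"
        proof (cases "u > 0")
          case True
          have "norm (spw z (- \<theta>) u - spw w0 (- \<theta>) u)
            \<le> \<theta> * ((1 + (1 + R) / d) powr (\<theta> + 1) * (1 + u) powr (- \<theta> - 1)) * norm (z - w0)"
            using True z w0 \<theta> by (intro norm_powr_diff_bound) (auto simp: d_def R_def)
          then have "norm (F z u) \<le> kern \<theta> u * (\<theta> * ((1 + (1 + R) / d) powr (\<theta> + 1) * (1 + u) powr (- \<theta> - 1)) * norm (z - w0))"
            unfolding F_def norm_mult norm_of_real abs_of_nonneg[OF kern_nonneg]
            by (intro mult_left_mono kern_nonneg)
          also have "\<dots> = C * (kern \<theta> u * (1 + u) powr (- \<theta> - 1))" by (simp add: C_def mult_ac)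
          finally show ?thesis by (simp add: order.trans[OF _ abs_ge_self])
        qed (simp add: F_def kern_def)
      qed
    qed (unfold F_def, measurable)
  qed
  define G where "G z = (\<integral>u. F z u \<partial>lborel)" for z
  have G_deriv: "(G has_field_derivative - 1 / z) (at z)" if z: "Im z > 0" for z
  proof -
    define r where "r = Im z / 2"
    define R where "R = norm z + r"
    define C where "C = \<theta> * (1 + (1 + R) / r) powr (\<theta> + 1)"
    have r: "r > 0" using z by (simp add: r_def)
    have ball: "r \<le> Im z' \<and> - R \<le> Re z'" if "z' \<in> ball z r" for z'
    proof -
      have "norm (z - z') < r" using that by (simp add: dist_norm)
      moreover have "\<bar>Im (z - z')\<bar> \<le> norm (z - z')" "\<bar>Re (z - z')\<bar> \<le> norm (z - z')" "\<bar>Re z\<bar> \<le> norm z"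
        by (rule abs_Im_le_cmod abs_Re_le_cmod)+
      ultimately show ?thesis unfolding R_def r_def by (simp, linarith)
    qed
    have "((\<lambda>z. \<integral>u. F z u \<partial>lborel) has_field_derivative (\<integral>u. F' z u \<partial>lborel)) (at z)"
    proof (rule has_field_derivative_integral[OF r, where K = "\<lambda>u. C * (kern \<theta> u * (1 + u) powr (- \<theta> - 1))"])
      show "F z \<in> borel_measurable lborel" for z unfolding F_def by measurable
      show "F' z \<in> borel_measurable lborel" unfolding F'_def by measurable
      show "integrable lborel (F z')" if "z' \<in> ball z r" for z'
        using ball[OF that] r by (intro F_int) auto
      show "integrable lborel (\<lambda>u. C * (kern \<theta> u * (1 + u) powr (- \<theta> - 1)))"
        by (intro integrable_mult_right kern_integrable \<theta>)
      show "AE u in lborel. \<forall>z'\<in>ball z r. ((\<lambda>z. F z u) has_field_derivative F' z' u) (at z') \<and>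
          norm (F' z' u) \<le> C * (kern \<theta> u * (1 + u) powr (- \<theta> - 1))"
      proof (intro AE_I2 ballI conjI)
        fix u z' assume z': "z' \<in> ball z r"
        then have "z' + cr u \<notin> \<real>\<^sub>\<le>\<^sub>0" using ball[OF z'] r by (auto simp: complex_nonpos_Reals_iff)
        from has_field_derivative_powr[OF this, of "cr (- \<theta>)"]
        have d: "((\<lambda>w. spw w (- \<theta>) u) has_field_derivative
          cr (- \<theta>) * spw z' (- \<theta> - 1) u) (at z')"
          by (simp add: DERIV_shift)
        have "((\<lambda>z. F z u) has_field_derivative cr (kern \<theta> u) * (cr (- \<theta>) * spw z' (- \<theta> - 1) u - 0)) (at z')"
          unfolding F_def by (intro DERIV_cmult DERIV_diff d DERIV_const)
        then show "((\<lambda>z. F z u) has_field_derivative F' z' u) (at z')" by (simp add: F'_def mult_ac)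
        show "norm (F' z' u) \<le> C * (kern \<theta> u * (1 + u) powr (- \<theta> - 1))"
        proof (cases "u > 0")
          case True
          have "norm (spw z' (- \<theta> - 1) u) \<le> (1 + (1 + R) / r) powr (\<theta> + 1) * (1 + u) powr (- \<theta> - 1)"
            using True ball[OF z'] r \<theta> by (intro norm_powr_bound) (auto simp: R_def)
          then have "norm (F' z' u) \<le> \<theta> * (kern \<theta> u * ((1 + (1 + R) / r) powr (\<theta> + 1) * (1 + u) powr (- \<theta> - 1)))"
            unfolding F'_def norm_mult norm_of_real abs_of_nonneg[OF kern_nonneg] using \<theta>
            by (intro mult_mono mult_left_mono kern_nonneg mult_nonneg_nonneg) auto
          then show ?thesis by (simp add: C_def mult_ac)
        qed (simp add: F'_def kern_def)
      qed
    qed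
    moreover have "(\<integral>u. F' z u \<partial>lborel) = - 1 / z"
      unfolding F'_def using kern_integral_inverse[OF \<theta> z] \<theta> by simp
    ultimately show ?thesis by (simp add: G_def[abs_def])
  qed
  have "\<exists>c. \<forall>z\<in>{z. 0 < Im z}. G z + Ln z = c"
  proof (rule has_field_derivative_zero_constant)
    show "convex {z. 0 < Im z}" by (rule convex_halfspace_Im_gt)
    fix z assume z: "z \<in> {z. 0 < Im z}"
    then have z': "z \<notin> \<real>\<^sub>\<le>\<^sub>0" "Im z > 0" by (auto simp: complex_nonpos_Reals_iff)
    have "((\<lambda>z. G z + Ln z) has_field_derivative - 1 / z + inverse z) (at z)"
      by (intro DERIV_add G_deriv has_field_derivative_Ln z')
    then show "((\<lambda>z. G z + Ln z) has_field_derivative 0) (at z within {z. 0 < Im z})"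
      by (rule has_field_derivative_at_within[OF DERIV_cong]) (simp add: field_simps)
  qed
  then have "G w + Ln w = G w0 + Ln w0" using w w0 by auto
  moreover have "G w0 = 0" by (simp add: G_def F_def)
  ultimately show ?thesis by (simp add: G_def F_def algebra_simps)
qed

lemma tendsto_Im_Ln_upper:
  assumes "x \<noteq> 0"
  shows "((\<lambda>\<epsilon>. Im (Ln (cpt x \<epsilon>))) \<longlongrightarrow> (if x < 0 then pi else 0)) (at_right 0)"
proof -
  have "- \<i> * cr x \<notin> \<real>\<^sub>\<le>\<^sub>0" using assms by (simp add: complex_nonpos_Reals_iff)
  then have "((\<lambda>\<epsilon>. Im (Ln (- \<i> * (cpt x \<epsilon>)) + \<i> * pi / 2))
      \<longlongrightarrow> Im (Ln (- \<i> * (cpt x 0)) + \<i> * pi / 2)) (at_right 0)"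
    by (intro tendsto_intros) auto
  moreover have "Im (Ln (- \<i> * (cpt x 0)) + \<i> * pi / 2) = Im (Ln (cr x))"
    using Ln_upper_half_plane[of "cr x"] assms by simp
  moreover have "Im (Ln (cr x)) = (if x < 0 then pi else 0)"
    using assms by (auto simp: Ln_of_real Im_Ln_eq_pi)
  moreover have "\<forall>\<^sub>F \<epsilon> in at_right 0. Im (Ln (- \<i> * (cpt x \<epsilon>)) + \<i> * pi / 2)
      = Im (Ln (cpt x \<epsilon>))"
  proof -
    have "\<forall>\<^sub>F \<epsilon> in at_right (0::real). 0 < \<epsilon>" by (simp add: eventually_at_right_less)
    then show ?thesis
    proof eventually_elim
      case (elim \<epsilon>)
      have "cpt x \<epsilon> \<noteq> 0" using elim by (simp add: complex_eq_iff)
      then show ?case using Ln_upper_half_plane[of "cpt x \<epsilon>"] elim by simp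
    qed
  qed
  ultimately show ?thesis using Lim_transform_eventually by (simp only:)
qed

context stieltjes_pair begin

lemma Sh_of_real:
  assumes "0 \<le> z" shows "Im (Sh (cr z)) = 0"
proof -
  have "0 \<le> (\<integral>y. (z + y) powr \<alpha> \<partial>\<eta>)" by (rule integral_nonneg_AE) auto
  then show ?thesis
    using powr_of_real[of "\<integral>y. (z + y) powr \<alpha> \<partial>\<eta>" "- \<theta> / \<alpha>"]
    unfolding Sh_def \<eta>.pt_of_real[OF assms] by (simp only: Im_complex_of_real)
qed

lemma \<delta>_nonpos: "t \<le> 0 \<Longrightarrow> \<delta> t = 0"
  using Sh_of_real[of "- t"] by (simp add: \<delta>_def)

text \<open>This is \<open>kern_log\<close> with w = x - c + i\<epsilon> and reference point x + 1 +
  i\<epsilon>, averaged over x. Fubini moves the average inside the integral over u, where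
  \<open>St_eq_Sh\<close> identifies it.\<close>

lemma kern_Sh_integral:
  assumes c: "0 \<le> c" and \<epsilon>: "0 < \<epsilon>"
  shows "integrable \<mu> (\<lambda>x. Ln (cpt (x + 1) \<epsilon>) - Ln (cpt (x - c) \<epsilon>))"
    and "(\<integral>u. cr (kern \<theta> u) * (Sh (cpt (u - c) \<epsilon>) - Sh (cpt (u + 1) \<epsilon>)) \<partial>lborel)
    = (\<integral>x. Ln (cpt (x + 1) \<epsilon>) - Ln (cpt (x - c) \<epsilon>) \<partial>\<mu>)"
proof -
  interpret P: pair_sigma_finite lborel \<mu> ..
  define z1 where "z1 = - cr c + \<i> * cr \<epsilon>"
  define z2 where "z2 = 1 + \<i> * cr \<epsilon>"
  define f where "f u x = cr (kern \<theta> u) *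
     (spw z1 (- \<theta>) (u + x) - spw z2 (- \<theta>) (u + x))" for u x
  define C where "C = \<theta> * (1 + (1 + c) / \<epsilon>) powr (\<theta> + 1) * norm (z1 - z2)"
  have [measurable]: "(\<lambda>x. spw z (- \<theta>) x) \<in> borel_measurable borel" for z
    by (rule borel_measurable_shift_powr)
  have [measurable]: "(\<lambda>(u, x). f u x) \<in> borel_measurable (borel \<Otimes>\<^sub>M borel)" unfolding f_def by measurable
  \<comment> \<open>A shift by x \<ge> 0 moves both points to the right, so the bound with R = c and
    d = \<epsilon> is uniform in x.\<close>
  have f_le: "norm (f u x) \<le> C * (kern \<theta> u * (1 + u) powr (- \<theta> - 1))" if x: "0 \<le> x" for u x
  proof (cases "u > 0")
    case True
    have "norm ((z1 + cr x + cr u) powr cr (- \<theta>) - (z2 + cr x + cr u) powr cr (- \<theta>))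
      \<le> \<theta> * ((1 + (1 + c) / \<epsilon>) powr (\<theta> + 1) * (1 + u) powr (- \<theta> - 1)) * norm ((z1 + cr x) - (z2 + cr x))"
      using True x \<epsilon> c \<theta> by (intro norm_powr_diff_bound) (auto simp: z1_def z2_def)
    then have "norm (f u x) \<le> kern \<theta> u * (\<theta> * ((1 + (1 + c) / \<epsilon>) powr (\<theta> + 1) * (1 + u) powr (- \<theta> - 1)) * norm (z1 - z2))"
      unfolding f_def norm_mult norm_of_real abs_of_nonneg[OF kern_nonneg]
      by (intro mult_left_mono kern_nonneg) (simp add: algebra_simps)
    also have "\<dots> = C * (kern \<theta> u * (1 + u) powr (- \<theta> - 1))" by (simp add: C_def mult_ac)
    finally show ?thesis .
  qed (simp add: f_def kern_def)
  have f_AE: "AE x in \<mu>. norm (f u x) \<le> C * (kern \<theta> u * (1 + u) powr (- \<theta> - 1))" for u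
    using \<mu>.AE_nonneg by eventually_elim (rule f_le)
  have i1: "integrable \<mu> (f u)" for u
    by (rule \<mu>.integrable_const_bound[OF f_AE]) measurable
  have int: "integrable (lborel \<Otimes>\<^sub>M \<mu>) (\<lambda>(u, x). f u x)"
  proof (rule P.Fubini_integrable)
    show "AE u in lborel. integrable \<mu> (\<lambda>x. (\<lambda>(u, x). f u x) (u, x))" using i1 by simp
    show "integrable lborel (\<lambda>u. \<integral>x. norm ((\<lambda>(u, x). f u x) (u, x)) \<partial>\<mu>)"
    proof (rule Bochner_Integration.integrable_bound)
      show "integrable lborel (\<lambda>u. C * (kern \<theta> u * (1 + u) powr (- \<theta> - 1)))"
        by (intro integrable_mult_right kern_integrable \<theta>)
      show "AE u in lborel. norm (\<integral>x. norm ((\<lambda>(u, x). f u x) (u, x)) \<partial>\<mu>) \<le> norm (C * (kern \<theta> u * (1 + u) powr (- \<theta> - 1)))"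
      proof (intro AE_I2)
        fix u
        have "(\<integral>x. norm (f u x) \<partial>\<mu>) \<le> C * (kern \<theta> u * (1 + u) powr (- \<theta> - 1))"
          by (rule \<mu>.integral_le_const[OF integrable_norm[OF i1] f_AE])
        moreover have "0 \<le> (\<integral>x. norm (f u x) \<partial>\<mu>)" by (rule integral_nonneg_AE) auto
        ultimately show "norm (\<integral>x. norm ((\<lambda>(u, x). f u x) (u, x)) \<partial>\<mu>) \<le> norm (C * (kern \<theta> u * (1 + u) powr (- \<theta> - 1)))"
          by simp
      qed
    qed measurable
  qed measurable
  have f_Ln: "(\<integral>u. f u x \<partial>lborel) = Ln (cpt (x + 1) \<epsilon>) - Ln (cpt (x - c) \<epsilon>)" for x
  proof -
    have eq: "f u x = cr (kern \<theta> u) * (spw (cpt (x - c) \<epsilon>) (- \<theta>) u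
        - spw (cpt (x + 1) \<epsilon>) (- \<theta>) u)" for u
      by (simp add: f_def z1_def z2_def algebra_simps)
    show ?thesis unfolding eq by (rule kern_log) (use \<theta> \<epsilon> in auto)
  qed
  show "integrable \<mu> (\<lambda>x. Ln (cpt (x + 1) \<epsilon>) - Ln (cpt (x - c) \<epsilon>))"
    using P.integrable_snd[OF int] unfolding f_Ln .
  have "(\<integral>u. cr (kern \<theta> u) * (Sh (cpt (u - c) \<epsilon>) - Sh (cpt (u + 1) \<epsilon>)) \<partial>lborel)
     = (\<integral>u. \<integral>x. f u x \<partial>\<mu> \<partial>lborel)"
  proof (rule Bochner_Integration.integral_cong[OF refl])
    fix u
    have *: "Sh z = (\<integral>x. spw z (- \<theta>) x \<partial>\<mu>)"
        "integrable \<mu> (\<lambda>x. spw z (- \<theta>) x)" if "Im z = \<epsilon>" for z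
    proof -
      have "z \<notin> \<real>\<^sub>\<le>\<^sub>0" using that \<epsilon> by (auto simp: complex_nonpos_Reals_iff)
      then show "Sh z = (\<integral>x. spw z (- \<theta>) x \<partial>\<mu>)"
        "integrable \<mu> (\<lambda>x. spw z (- \<theta>) x)"
        using St_eq_Sh[of z] \<mu>.integrable_pt_neg[of z "- \<theta>"] \<theta> by (auto simp: \<mu>.pt_def)
    qed
    have e: "cpt (u - c) \<epsilon> + cr x = z1 + cr (u + x)"
      "cpt (u + 1) \<epsilon> + cr x = z2 + cr (u + x)" for x
      by (auto simp: z1_def z2_def)
    have Im: "Im (cpt (u - c) \<epsilon>) = \<epsilon>" "Im (cpt (u + 1) \<epsilon>) = \<epsilon>"
      by auto
    show "cr (kern \<theta> u) * (Sh (cpt (u - c) \<epsilon>) - Sh (cpt (u + 1) \<epsilon>))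
      = (\<integral>x. f u x \<partial>\<mu>)"
      unfolding f_def *(1)[OF Im(1), unfolded e] *(1)[OF Im(2), unfolded e]
      using *(2)[OF Im(1), unfolded e] *(2)[OF Im(2), unfolded e]
      by (simp add: Bochner_Integration.integral_diff)
  qed
  also have "\<dots> = (\<integral>x. \<integral>u. f u x \<partial>lborel \<partial>\<mu>)"
    using P.Fubini_integral[OF int] by simp
  finally show "(\<integral>u. cr (kern \<theta> u) * (Sh (cpt (u - c) \<epsilon>) - Sh (cpt (u + 1) \<epsilon>)) \<partial>lborel)
    = (\<integral>x. Ln (cpt (x + 1) \<epsilon>) - Ln (cpt (x - c) \<epsilon>) \<partial>\<mu>)"
    unfolding f_Ln .
qed

text \<open>The constant in \<open>norm_powr_diff_bound\<close> blows up as the height tends to 0,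
  so uniformity in \<epsilon> needs another argument. For u \<le> c + 1 continuity up to the axis
  bounds both values. For larger u both points lie in a half plane at distance at least u - c from
  the cut, whatever \<epsilon> is, and the mean value inequality gives the decay.\<close>

lemma Sh_diff_bound:
  assumes c: "0 \<le> c"
  obtains K where "\<And>u \<epsilon>. 0 < u \<Longrightarrow> 0 < \<epsilon> \<Longrightarrow> \<epsilon> \<le> 1 \<Longrightarrow>
    norm (Sh (cpt (u - c) \<epsilon>) - Sh (cpt (u + 1) \<epsilon>)) \<le> K * (1 + u) powr (- \<theta> - 1)"
proof -
  \<comment> \<open>For 0 < u \<le> c + 1 both arguments have real part in [-c, c + 2].\<close>
  obtain K0 where K0: "0 \<le> K0" "\<And>z. 0 \<le> Im z \<Longrightarrow> Im z \<le> 1 \<Longrightarrow> - c \<le> Re z \<Longrightarrow> Re z \<le> c + 2 \<Longrightarrow> norm (Sh z) \<le> K0"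
    using strip_bounded[OF continuous_on_Sh, of "- c" "c + 2"] by metis
  define L where "L = (c + 2) powr (\<theta> + 1)"
  define K where "K = 2 * K0 * L + \<theta> * (c + 1) * L"
  have ineq: "((1 + u) / (c + 2)) powr (- \<theta> - 1) = L * (1 + u) powr (- \<theta> - 1)" if "u > 0" for u
  proof -
    have e: "- \<theta> - 1 = - (\<theta> + 1)" by simp
    show ?thesis unfolding e powr_minus L_def using that c by (simp add: powr_divide field_simps)
  qed
  have L: "0 \<le> L" by (simp add: L_def)
  show ?thesis
  proof (rule that[of K])
    fix u \<epsilon> :: real assume u: "0 < u" and \<epsilon>: "0 < \<epsilon>" "\<epsilon> \<le> 1"
    define z where "z = cr (u - c) + \<i> * cr \<epsilon>"
    define w where "w = cr (u + 1) + \<i> * cr \<epsilon>"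
    show "norm (Sh z - Sh w) \<le> K * (1 + u) powr (- \<theta> - 1)"
    proof (cases "u \<le> c + 1")
      case True
      have "norm (Sh z - Sh w) \<le> norm (Sh z) + norm (Sh w)" by (rule norm_triangle_ineq4)
      also have "\<dots> \<le> 2 * K0"
        using K0(2)[of z] K0(2)[of w] u c True \<epsilon> by (simp add: z_def w_def)
      also have "\<dots> = 2 * K0 * 1" by simp
      also have "\<dots> \<le> 2 * K0 * (L * (1 + u) powr (- \<theta> - 1))"
      proof (rule mult_left_mono)
        have "(1 + u) / (c + 2) \<le> 1" using True c by (simp add: divide_le_eq)
        then have "1 powr (- \<theta> - 1) \<le> ((1 + u) / (c + 2)) powr (- \<theta> - 1)" using u c \<theta> by (intro powr_mono2') auto
        then show "1 \<le> L * (1 + u) powr (- \<theta> - 1)" using ineq[OF u] by simp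
      qed (use K0 in auto)
      also have "\<dots> \<le> K * (1 + u) powr (- \<theta> - 1)"
        unfolding K_def using L \<theta> c by (simp add: algebra_simps)
      finally show ?thesis .
    next
      case False
      \<comment> \<open>The difference (u - c)(c + 2) - (1 + u) equals (c + 1)(u - c - 1).\<close>
      have uc: "(1 + u) / (c + 2) \<le> u - c"
      proof -
        have "(c + 1) * (u - c - 1) \<ge> 0" using False c by (intro mult_nonneg_nonneg) auto
        then have "1 + u \<le> (u - c) * (c + 2)" by (simp add: algebra_simps)
        then show ?thesis using c by (intro mult_imp_div_pos_le) auto
      qed
      have zw: "z \<notin> \<real>\<^sub>\<le>\<^sub>0" "w \<notin> \<real>\<^sub>\<le>\<^sub>0" using \<epsilon> by (auto simp: z_def w_def complex_nonpos_Reals_iff)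
      have D: "norm (St z - St w) \<le> \<theta> * (L * (1 + u) powr (- \<theta> - 1)) * norm (z - w)"
      proof (rule field_differentiable_bound[where S = "{v. u - c \<le> Re v}" and f = St
            and f' = "\<lambda>v. cr (- \<theta>) * \<mu>.pt (- \<theta> - 1) v"])
        show "convex {v. u - c \<le> Re v}" using convex_halfspace_Re_ge[of "u - c"] by simp
        fix v assume v: "v \<in> {v. u - c \<le> Re v}"
        then have vs: "v \<notin> \<real>\<^sub>\<le>\<^sub>0" using False by (auto simp: complex_nonpos_Reals_iff)
        have "(St has_field_derivative cr (- \<theta>) * \<mu>.pt (- \<theta> - 1) v) (at v)"
          by (rule \<mu>.pt_has_field_derivative) (use \<mu>.integrable_pt_neg[of _ "- \<theta>"] \<theta> vs in auto)
        then show "(St has_field_derivative cr (- \<theta>) * \<mu>.pt (- \<theta> - 1) v) (at v within {v. u - c \<le> Re v})"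
          by (rule has_field_derivative_at_within)
        have "norm (\<mu>.pt (- \<theta> - 1) v) \<le> (\<integral>x. norm (spw v (- \<theta> - 1) x) \<partial>\<mu>)"
          unfolding \<mu>.pt_def by (rule integral_norm_bound)
        also have "\<dots> \<le> L * (1 + u) powr (- \<theta> - 1)"
        proof (rule \<mu>.integral_le_const)
          show "integrable \<mu> (\<lambda>x. norm (spw v (- \<theta> - 1) x))"
            using \<theta> vs by (intro integrable_norm \<mu>.integrable_pt_neg) auto
          show "AE x in \<mu>. norm (spw v (- \<theta> - 1) x) \<le> L * (1 + u) powr (- \<theta> - 1)"
            using \<mu>.AE_nonneg
          proof eventually_elim
            case (elim x)
            have "(1 + u) / (c + 2) \<le> norm (v + cr x)"
              using complex_Re_le_cmod[of "v + cr x"] elim v uc by simp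
            then have "norm (v + cr x) powr (- \<theta> - 1) \<le> ((1 + u) / (c + 2)) powr (- \<theta> - 1)"
              using u c \<theta> by (intro powr_mono2') auto
            then show ?case unfolding norm_powr_of_real ineq[OF u] .
          qed
        qed
        finally show "norm (cr (- \<theta>) * \<mu>.pt (- \<theta> - 1) v) \<le> \<theta> * (L * (1 + u) powr (- \<theta> - 1))"
          using \<theta> by (simp add: norm_mult mult_left_mono)
      qed (use c in \<open>auto simp: z_def w_def\<close>)
      have "z - w = cr (- (c + 1))" by (simp add: z_def w_def)
      then have "norm (z - w) = c + 1" using c by (simp only: norm_of_real)
      with D have "norm (Sh z - Sh w) \<le> \<theta> * (c + 1) * L * (1 + u) powr (- \<theta> - 1)"
        by (simp add: St_eq_Sh[OF zw(1)] St_eq_Sh[OF zw(2)] mult_ac)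
      also have "\<dots> \<le> K * (1 + u) powr (- \<theta> - 1)"
        unfolding K_def using L K0 by (intro mult_right_mono) auto
      finally show ?thesis .
    qed
  qed
qed

lemma borel_measurable_Sh_line: "(\<lambda>u. Sh (cpt (u + a) (max \<epsilon> 0))) \<in> borel_measurable borel"
  by (intro borel_measurable_continuous_onI continuous_on_compose2[OF continuous_on_Sh])
     (auto intro!: continuous_intros)

text \<open>Imaginary parts are taken in \<open>kern_Sh_integral\<close> and \<epsilon> tends to 0.
  The left side is dominated by \<open>Sh_diff_bound\<close>, the right side by 2 pi. The difference
  of logarithms tends to -pi for x < c and to 0 for x > c; the limit at x = c itself is avoided by
  \<open>atom\<close>.\<close>

theorem cdf_formula:
  assumes c: "0 \<le> c" and atom: "AE x in \<mu>. x \<noteq> c"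
  shows "measure \<mu> {..c} = (\<integral>u. indicator {0..c} u * (u powr (\<theta> - 1) * \<delta> (c - u)) \<partial>lborel)"
proof -
  define D where "D \<epsilon> u = Sh (cpt (u - c) (max \<epsilon> 0)) - Sh (cpt (u + 1) (max \<epsilon> 0))" for \<epsilon> u
  have [measurable]: "D \<epsilon> \<in> borel_measurable borel" for \<epsilon>
    unfolding D_def[abs_def] using borel_measurable_Sh_line[of "- c" \<epsilon>] borel_measurable_Sh_line[of 1 \<epsilon>]
    by (intro borel_measurable_diff) auto
  obtain K where K: "\<And>u \<epsilon>. 0 < u \<Longrightarrow> 0 < \<epsilon> \<Longrightarrow> \<epsilon> \<le> 1 \<Longrightarrow>
    norm (Sh (cpt (u - c) \<epsilon>) - Sh (cpt (u + 1) \<epsilon>)) \<le> K * (1 + u) powr (- \<theta> - 1)"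
    using Sh_diff_bound[OF c] by metis
  have ev: "\<forall>\<^sub>F \<epsilon> in at_right (0::real). 0 < \<epsilon> \<and> \<epsilon> \<le> 1"
    using eventually_at_right_real[of 0 1] by (auto elim: eventually_mono)
  have D_bound: "norm (cr (kern \<theta> u) * D \<epsilon> u) \<le> K * (kern \<theta> u * (1 + u) powr (- \<theta> - 1))" if \<epsilon>: "0 < \<epsilon> \<and> \<epsilon> \<le> 1" for \<epsilon> u
  proof (cases "u > 0")
    case True
    have "norm (D \<epsilon> u) \<le> K * (1 + u) powr (- \<theta> - 1)"
      using K[OF True, of \<epsilon>] \<epsilon> unfolding D_def by (simp add: max_def)
    then have "kern \<theta> u * norm (D \<epsilon> u) \<le> kern \<theta> u * (K * (1 + u) powr (- \<theta> - 1))"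
      by (intro mult_left_mono kern_nonneg)
    then show ?thesis
      unfolding norm_mult norm_of_real abs_of_nonneg[OF kern_nonneg] by (simp add: mult_ac)
  qed (simp add: kern_def)
  have K_int: "integrable lborel (\<lambda>u. K * (kern \<theta> u * (1 + u) powr (- \<theta> - 1)))"
    by (intro integrable_mult_right kern_integrable \<theta>)
  have D_int: "integrable lborel (\<lambda>u. cr (kern \<theta> u) * D \<epsilon> u)" if "0 < \<epsilon> \<and> \<epsilon> \<le> 1" for \<epsilon>
    by (rule Bochner_Integration.integrable_bound[OF K_int])
       (use D_bound[OF that] in \<open>auto intro!: AE_I2 order.trans[OF _ abs_ge_self]\<close>)
  have lim1: "((\<lambda>\<epsilon>. \<integral>u. Im (cr (kern \<theta> u) * D \<epsilon> u) \<partial>lborel) \<longlongrightarrow> (\<integral>u. Im (cr (kern \<theta> u) * D 0 u) \<partial>lborel)) (at_right 0)"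
  proof (rule integral_dominated_convergence_within[OF _ _ K_int])
    show "AE u in lborel. ((\<lambda>\<epsilon>. Im (cr (kern \<theta> u) * D \<epsilon> u)) \<longlongrightarrow> Im (cr (kern \<theta> u) * D 0 u)) (at_right 0)"
    proof (intro AE_I2 tendsto_Im tendsto_mult tendsto_const)
      fix u
      have "continuous_on UNIV (\<lambda>\<epsilon>. D \<epsilon> u)"
        unfolding D_def by (intro continuous_intros continuous_on_compose2[OF continuous_on_Sh]) auto
      then have "((\<lambda>\<epsilon>. D \<epsilon> u) \<longlongrightarrow> D 0 u) (at 0)" by (simp add: continuous_on_def)
      then show "((\<lambda>\<epsilon>. D \<epsilon> u) \<longlongrightarrow> D 0 u) (at_right 0)" by (rule filterlim_mono[OF _ order_refl at_le]) simp
    qed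
    show "\<forall>\<^sub>F \<epsilon> in at_right 0. AE u in lborel. norm (Im (cr (kern \<theta> u) * D \<epsilon> u)) \<le> K * (kern \<theta> u * (1 + u) powr (- \<theta> - 1))"
      using ev
    proof eventually_elim
      case (elim \<epsilon>)
      show ?case
        unfolding real_norm_def by (intro AE_I2 order.trans[OF abs_Im_le_cmod D_bound] elim)
    qed
    show "(\<lambda>u. Im (cr (kern \<theta> u) * D \<epsilon> u)) \<in> borel_measurable lborel" for \<epsilon>
      by measurable
  qed measurable
  define E where "E \<epsilon> x = Im (Ln (cpt (x + 1) \<epsilon>)) - Im (Ln (cpt (x - c) \<epsilon>))" for \<epsilon> x
  \<comment> \<open>The value 0 for \<epsilon> \<le> 0 makes the function measurable for every
    \<epsilon>, as the convergence lemma asks, without touching the one-sided limit.\<close>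
  define E' where "E' \<epsilon> x = (if 0 < \<epsilon> then E \<epsilon> x else 0)" for \<epsilon> x
  have Lnm: "(\<lambda>x. Ln (cpt (x + a) \<epsilon>)) \<in> borel_measurable borel" if "0 < \<epsilon>" for a \<epsilon>
    using that by (intro borel_measurable_continuous_onI continuous_intros) (auto simp: complex_nonpos_Reals_iff)
  have Em: "E \<epsilon> \<in> borel_measurable borel" if "0 < \<epsilon>" for \<epsilon>
    unfolding E_def[abs_def] using Lnm[OF that, of 1] Lnm[OF that, of "- c"]
    by (intro borel_measurable_diff) (auto intro: measurable_compose[OF _ borel_measurable_Im])
  have E'm: "E' \<epsilon> \<in> borel_measurable \<mu>" for \<epsilon>
    using Em by (cases "0 < \<epsilon>") (auto simp: E'_def[abs_def])
  have Eb: "\<bar>E \<epsilon> x\<bar> \<le> 2 * pi" if "0 < \<epsilon>" for \<epsilon> x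
  proof -
    have nz: "cpt (x + 1) \<epsilon> \<noteq> 0" "cpt (x - c) \<epsilon> \<noteq> 0"
      using that by (auto simp: complex_eq_iff)
    show ?thesis
      using mpi_less_Im_Ln[OF nz(1)] Im_Ln_le_pi[OF nz(1)] mpi_less_Im_Ln[OF nz(2)] Im_Ln_le_pi[OF nz(2)]
      unfolding E_def by linarith
  qed
  have lim2: "((\<lambda>\<epsilon>. \<integral>x. E' \<epsilon> x \<partial>\<mu>) \<longlongrightarrow> (\<integral>x. - pi * indicator {..c} x \<partial>\<mu>)) (at_right 0)"
  proof (rule integral_dominated_convergence_within)
    show "integrable \<mu> (\<lambda>x. 2 * pi)" by simp
    show "AE x in \<mu>. ((\<lambda>\<epsilon>. E' \<epsilon> x) \<longlongrightarrow> - pi * indicator {..c} x) (at_right 0)"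
      using \<mu>.AE_nonneg atom
    proof eventually_elim
      case (elim x)
      have "((\<lambda>\<epsilon>. E \<epsilon> x) \<longlongrightarrow> (if x + 1 < 0 then pi else 0) - (if x - c < 0 then pi else 0)) (at_right 0)"
        unfolding E_def using elim by (intro tendsto_diff tendsto_Im_Ln_upper) auto
      moreover have "(if x + 1 < 0 then pi else 0) - (if x - c < 0 then pi else 0) = - pi * indicator {..c} x"
        using elim by (auto simp: indicator_def)
      moreover have "\<forall>\<^sub>F \<epsilon> in at_right 0. E \<epsilon> x = E' \<epsilon> x" using ev by eventually_elim (simp add: E'_def)
      ultimately show ?case using Lim_transform_eventually by (simp only:)
    qed
    show "\<forall>\<^sub>F \<epsilon> in at_right 0. AE x in \<mu>. norm (E' \<epsilon> x) \<le> 2 * pi"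
      using ev by eventually_elim (use Eb in \<open>auto simp: E'_def\<close>)
  qed (use E'm in auto)
  have "\<forall>\<^sub>F \<epsilon> in at_right 0. (\<integral>u. Im (cr (kern \<theta> u) * D \<epsilon> u) \<partial>lborel) = (\<integral>x. E' \<epsilon> x \<partial>\<mu>)"
    using ev
  proof eventually_elim
    case (elim \<epsilon>)
    then have \<epsilon>: "0 < \<epsilon>" by simp
    let ?g = "\<lambda>x. Ln (cpt (x + 1) \<epsilon>) - Ln (cpt (x - c) \<epsilon>)"
    have "(\<integral>u. cr (kern \<theta> u) * D \<epsilon> u \<partial>lborel) = (\<integral>x. ?g x \<partial>\<mu>)"
      using kern_Sh_integral(2)[OF c \<epsilon>] \<epsilon> by (simp add: D_def max_def)
    moreover have "(\<integral>x. Im (?g x) \<partial>\<mu>) = Im (\<integral>x. ?g x \<partial>\<mu>)"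
      using kern_Sh_integral(1)[OF c \<epsilon>] by (rule integral_Im)
    moreover have "(\<integral>u. Im (cr (kern \<theta> u) * D \<epsilon> u) \<partial>lborel) = Im (\<integral>u. cr (kern \<theta> u) * D \<epsilon> u \<partial>lborel)"
      using D_int[OF elim] by (rule integral_Im)
    moreover have "Im (?g x) = E' \<epsilon> x" for x using \<epsilon> by (simp add: E'_def E_def)
    ultimately show ?case by simp
  qed
  with lim1 have "((\<lambda>\<epsilon>. \<integral>x. E' \<epsilon> x \<partial>\<mu>) \<longlongrightarrow> (\<integral>u. Im (cr (kern \<theta> u) * D 0 u) \<partial>lborel)) (at_right 0)"
    by (rule Lim_transform_eventually)
  from tendsto_unique[OF _ this lim2]
  have "- pi * measure \<mu> {..c} = (\<integral>u. Im (cr (kern \<theta> u) * D 0 u) \<partial>lborel)" by simp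
  also have "\<dots> = (\<integral>u. - pi * (indicator {0..c} u * (u powr (\<theta> - 1) * \<delta> (c - u))) \<partial>lborel)"
  proof (rule Bochner_Integration.integral_cong[OF refl])
    fix u
    \<comment> \<open>The reference term is real because u + 1 > 0. As \<delta> vanishes at
      nonpositive arguments, the integral is cut off at u = c.\<close>
    have "Im (D 0 u) = - pi * \<delta> (c - u)" if "0 < u"
      using Sh_of_real[of "u + 1"] that by (simp add: D_def \<delta>_def)
    then show "Im (cr (kern \<theta> u) * D 0 u) = - pi * (indicator {0..c} u * (u powr (\<theta> - 1) * \<delta> (c - u)))"
      using \<delta>_nonpos[of "c - u"] by (cases "0 < u") (auto simp: kern_def indicator_def)
  qed
  finally show ?thesis by simp
qed

end

section \<open>The boundary density and its derivative\<close>

lemma has_bochner_integral_powr_Icc: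
  fixes \<rho> c :: real
  assumes "0 < \<rho>" "0 \<le> c"
  shows "has_bochner_integral lborel (\<lambda>v. indicator {0..c} v * v powr (\<rho> - 1)) (c powr \<rho> / \<rho>)"
proof (rule has_bochner_integral_nn_integral)
  have "((\<lambda>v. v powr (\<rho> - 1)) has_integral (c powr (\<rho> - 1 + 1) / (\<rho> - 1 + 1))) {0..c}"
    using assms by (intro has_integral_powr_from_0) auto
  then have "((\<lambda>v. if v \<in> {0..c} then v powr (\<rho> - 1) else 0) has_integral (c powr \<rho> / \<rho>)) UNIV"
    by (simp only: has_integral_restrict_UNIV) simp
  moreover have "(\<lambda>v. if v \<in> {0..c} then v powr (\<rho> - 1) else 0) = (\<lambda>v. indicator {0..c} v * v powr (\<rho> - 1))"
    by (auto simp: indicator_def fun_eq_iff)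
  ultimately show "(\<integral>\<^sup>+v. ennreal (indicator {0..c} v * v powr (\<rho> - 1)) \<partial>lborel) = ennreal (c powr \<rho> / \<rho>)"
    by (intro nn_integral_has_integral_lborel) auto
qed (use assms in auto)

text \<open>Within distance 1 the singularity at s = x contributes at most 1/\<rho> on either side;
  farther away the integrand is at most 1 and contributes at most T. The bound is independent of x
  and so survives averaging over \<eta>.\<close>

lemma nn_integral_abs_powr_le:
  fixes \<rho> T x :: real
  assumes \<rho>: "0 < \<rho>" "\<rho> < 1" and T: "0 \<le> T"
  shows "(\<integral>\<^sup>+s. ennreal (indicator {0..T} s * \<bar>x - s\<bar> powr (\<rho> - 1)) \<partial>lborel) \<le> ennreal (2 / \<rho> + T)"
proof -
  define g where "g v = indicator {0..1} v * v powr (\<rho> - 1)" for v :: real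
  have g: "(\<integral>\<^sup>+v. ennreal (g v) \<partial>lborel) = ennreal (1 / \<rho>)"
    using has_bochner_integral_powr_Icc[of \<rho> 1] \<rho> unfolding has_bochner_integral_iff g_def
    by (subst nn_integral_eq_integral) auto
  have [measurable]: "g \<in> borel_measurable borel" unfolding g_def by measurable
  have gx: "(\<integral>\<^sup>+s. ennreal (g (x + (-1) * s)) \<partial>lborel) = ennreal (1 / \<rho>)"
    using nn_integral_real_affine[of "\<lambda>v. ennreal (g v)" "-1" x] g by simp
  have gy: "(\<integral>\<^sup>+s. ennreal (g (- x + 1 * s)) \<partial>lborel) = ennreal (1 / \<rho>)"
    using nn_integral_real_affine[of "\<lambda>v. ennreal (g v)" 1 "- x"] g by simp
  have "(\<integral>\<^sup>+s. ennreal (indicator {0..T} s * \<bar>x - s\<bar> powr (\<rho> - 1)) \<partial>lborel)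
     \<le> (\<integral>\<^sup>+s. ennreal (g (x + (-1) * s)) + ennreal (g (- x + 1 * s)) + indicator {0..T} s \<partial>lborel)"
  proof (rule nn_integral_mono)
    fix s
    have "\<bar>x - s\<bar> powr (\<rho> - 1) \<le> g (x - s) + g (s - x) + 1"
    proof (cases "\<bar>x - s\<bar> \<le> 1")
      case True
      then show ?thesis by (cases "x \<ge> s") (auto simp: g_def indicator_def)
    next
      case False
      then have "\<bar>x - s\<bar> powr (\<rho> - 1) \<le> 1 powr (\<rho> - 1)" using \<rho> by (intro powr_mono2') auto
      then show ?thesis by (auto simp: g_def indicator_def)
    qed
    moreover have "0 \<le> g v" for v by (simp add: g_def)
    ultimately have "indicator {0..T} s * \<bar>x - s\<bar> powr (\<rho> - 1) \<le> g (x - s) + g (s - x) + indicator {0..T} s"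
      by (auto simp: indicator_def add_nonneg_nonneg)
    then have "ennreal (indicator {0..T} s * \<bar>x - s\<bar> powr (\<rho> - 1)) \<le> ennreal (g (x - s) + g (s - x) + indicator {0..T} s)"
      by (rule ennreal_leI)
    also have "\<dots> = ennreal (g (x + (-1) * s)) + ennreal (g (- x + 1 * s)) + indicator {0..T} s"
      using \<open>\<And>v. 0 \<le> g v\<close> by (simp add: ennreal_plus add_nonneg_nonneg ennreal_indicator algebra_simps)
    finally show "ennreal (indicator {0..T} s * \<bar>x - s\<bar> powr (\<rho> - 1)) \<le> ennreal (g (x + (-1) * s)) + ennreal (g (- x + 1 * s)) + indicator {0..T} s" .
  qed
  also have "\<dots> = ennreal (1 / \<rho>) + ennreal (1 / \<rho>) + ennreal T"
    using T by (simp add: nn_integral_add gx[simplified] gy[simplified])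
  also have "\<dots> = ennreal (2 / \<rho> + T)" using \<rho> T by (simp add: ennreal_plus[symmetric] del: ennreal_plus)
  finally show ?thesis .
qed

section \<open>Boundary behaviour of the derivative of the transform\<close>

context stieltjes_pair begin

text \<open>Up to the factor \<alpha>, the derivative of m. At a point of the negative axis the
  integral may diverge and is then 0 by convention; this affects only a null set.\<close>

definition P :: "complex \<Rightarrow> complex" where "P = \<eta>.pt (\<alpha> - 1)"

text \<open>A Riesz-type potential of \<eta>: a majorant of \<open>P\<close> on the vertical line
  above -s that does not depend on the height. It may be infinite at some s but is locally
  integrable by Tonelli.\<close>

definition potential :: "real \<Rightarrow> ennreal" where
  "potential s = (\<integral>\<^sup>+x. ennreal (\<bar>x - s\<bar> powr (\<alpha> - 1)) \<partial>\<eta>)"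

lemma potential_measurable [measurable]: "potential \<in> borel_measurable borel"
proof -
  have "(\<lambda>s. \<integral>\<^sup>+x. ennreal (\<bar>x - s\<bar> powr (\<alpha> - 1)) \<partial>\<eta>) \<in> borel_measurable borel"
    by (rule \<eta>.borel_measurable_nn_integral) measurable
  then show ?thesis by (simp add: potential_def[abs_def])
qed

lemma nn_integral_potential:
  assumes T: "0 \<le> T"
  shows "(\<integral>\<^sup>+s. indicator {0..T} s * potential s \<partial>lborel) < \<infinity>"
proof -
  interpret Q: pair_sigma_finite lborel \<eta> ..
  have "(\<integral>\<^sup>+s. indicator {0..T} s * potential s \<partial>lborel) = (\<integral>\<^sup>+s. \<integral>\<^sup>+x. ennreal (indicator {0..T} s * \<bar>x - s\<bar> powr (\<alpha> - 1)) \<partial>\<eta> \<partial>lborel)"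
    unfolding potential_def
    by (intro nn_integral_cong) (auto simp: nn_integral_cmult[symmetric] indicator_def)
  also have "\<dots> = (\<integral>\<^sup>+x. \<integral>\<^sup>+s. ennreal (indicator {0..T} s * \<bar>x - s\<bar> powr (\<alpha> - 1)) \<partial>lborel \<partial>\<eta>)"
    by (intro Q.Fubini'[symmetric]) measurable
  also have "\<dots> \<le> (\<integral>\<^sup>+x. ennreal (2 / \<alpha> + T) \<partial>\<eta>)"
    by (intro nn_integral_mono nn_integral_abs_powr_le \<alpha> T)
  also have "\<dots> < \<infinity>" by (simp add: \<eta>.emeasure_space_1)
  finally show ?thesis .
qed

lemma integrable_potential:
  assumes "0 \<le> T"
  shows "integrable lborel (\<lambda>s. indicator {0..T} s * enn2real (potential s))"
proof (rule integrableI_nonneg)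
  have "(\<integral>\<^sup>+s. ennreal (indicator {0..T} s * enn2real (potential s)) \<partial>lborel) \<le> (\<integral>\<^sup>+s. indicator {0..T} s * potential s \<partial>lborel)"
    by (intro nn_integral_mono) (auto simp: indicator_def ennreal_enn2real_if)
  then show "(\<integral>\<^sup>+s. ennreal (indicator {0..T} s * enn2real (potential s)) \<partial>lborel) < \<infinity>"
    using nn_integral_potential[OF assms] by (rule order.strict_trans1)
qed auto

text \<open>Since \<open>0 powr a = 0\<close>, an atom of \<eta> at s adds nothing to the potential,
  and finiteness does not rule it out. The atoms are removed separately, as a countable set.\<close>

lemma AE_potential_finite:
  assumes "0 \<le> T"
  shows "AE s in lborel. s \<in> {0..T} \<longrightarrow> potential s < \<infinity> \<and> (AE x in \<eta>. x \<noteq> s)"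
proof -
  have "AE s in lborel. indicator {0..T} s * potential s \<noteq> \<infinity>"
    using nn_integral_potential[OF assms] by (intro nn_integral_PInf_AE) auto
  moreover have "AE s in lborel. s \<notin> {s. measure \<eta> {s} \<noteq> 0}"
    by (intro AE_not_in countable_imp_null_set_lborel \<eta>.countable_support)
  ultimately show ?thesis
  proof eventually_elim
    case (elim s)
    have "AE x in \<eta>. x \<noteq> s"
      using elim(2) by (intro AE_I[where N = "{s}"]) (auto simp: \<eta>.emeasure_eq_measure)
    then show ?case using elim(1) by (auto simp: less_top)
  qed
qed

context
  fixes s :: real
  assumes fin: "potential s < \<infinity>" and atom: "AE x in \<eta>. x \<noteq> s"
begin

lemma integrable_abs_powr: "integrable \<eta> (\<lambda>x. \<bar>x - s\<bar> powr (\<alpha> - 1))"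
  using fin by (intro integrableI_nonneg) (auto simp: potential_def)

lemma shifted_norm_le:
  assumes "x \<noteq> s" "0 \<le> \<epsilon>"
  shows "norm (spw (cpt (- s) \<epsilon>) (\<alpha> - 1) x) \<le> \<bar>x - s\<bar> powr (\<alpha> - 1)"
proof -
  have "\<bar>x - s\<bar> \<le> norm (cpt (- s) \<epsilon> + cr x)"
    using abs_Re_le_cmod[of "cpt (- s) \<epsilon> + cr x"] by simp
  then show ?thesis unfolding norm_powr_of_real using assms \<alpha> by (intro powr_mono2') auto
qed

lemma P_bound:
  assumes "0 < \<epsilon>"
  shows "norm (P (cpt (- s) \<epsilon>)) \<le> enn2real (potential s)"
proof -
  have z: "cpt (- s) \<epsilon> \<notin> \<real>\<^sub>\<le>\<^sub>0" using assms by (simp add: complex_nonpos_Reals_iff)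
  have "norm (P (cpt (- s) \<epsilon>))
     \<le> (\<integral>x. norm (spw (cpt (- s) \<epsilon>) (\<alpha> - 1) x) \<partial>\<eta>)"
    unfolding P_def \<eta>.pt_def by (rule integral_norm_bound)
  also have "\<dots> \<le> (\<integral>x. \<bar>x - s\<bar> powr (\<alpha> - 1) \<partial>\<eta>)"
  proof (rule integral_mono_AE)
    show "integrable \<eta> (\<lambda>x. norm (spw (cpt (- s) \<epsilon>) (\<alpha> - 1) x))"
      using \<alpha> by (intro integrable_norm \<eta>.integrable_pt_neg z) auto
    show "AE x in \<eta>. norm (spw (cpt (- s) \<epsilon>) (\<alpha> - 1) x) \<le> \<bar>x - s\<bar> powr (\<alpha> - 1)"
      using atom by eventually_elim (use shifted_norm_le assms in \<open>simp only: less_imp_le not_False_eq_True\<close>)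
  qed (rule integrable_abs_powr)
  also have "\<dots> = enn2real (potential s)"
    unfolding potential_def by (intro integral_eq_nn_integral) auto
  finally show ?thesis .
qed

lemma P_limit:
  "((\<lambda>\<epsilon>. P (cpt (- s) \<epsilon>)) \<longlongrightarrow> P (cr (- s))) (at_right 0)"
  unfolding P_def \<eta>.pt_def
proof (rule integral_dominated_convergence_within[OF _ _ integrable_abs_powr])
  have ev: "\<forall>\<^sub>F \<epsilon> in at_right (0::real). 0 < \<epsilon>" by (simp add: eventually_at_right_less)
  show "\<forall>\<^sub>F \<epsilon> in at_right 0. AE x in \<eta>. norm (spw (cpt (- s) \<epsilon>) (\<alpha> - 1) x) \<le> \<bar>x - s\<bar> powr (\<alpha> - 1)"
    using ev
  proof eventually_elim
    case (elim \<epsilon>)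
    then have "0 \<le> \<epsilon>" by simp
    show ?case using atom by eventually_elim (rule shifted_norm_le[OF _ \<open>0 \<le> \<epsilon>\<close>])
  qed
  show "AE x in \<eta>. ((\<lambda>\<epsilon>. spw (cpt (- s) \<epsilon>) (\<alpha> - 1) x)
      \<longlongrightarrow> (cr (- s) + cr x) powr cr (\<alpha> - 1)) (at_right 0)"
    using atom
  proof eventually_elim
    case (elim x)
    have "continuous_on {0..} (\<lambda>\<epsilon>. spw (cpt (- s) \<epsilon>) (\<alpha> - 1) x)"
      by (rule continuous_on_compose2[OF continuous_on_powr_upper_half_plane[of "{w. 0 \<le> Im w} - {0}"]])
         (use elim in \<open>auto intro!: continuous_intros simp: complex_eq_iff\<close>)
    from this[unfolded continuous_on_def, rule_format, of 0]
    have "((\<lambda>\<epsilon>. spw (cpt (- s) \<epsilon>) (\<alpha> - 1) x)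
      \<longlongrightarrow> spw (cpt (- s) 0) (\<alpha> - 1) x) (at 0 within {0..})"
      by simp
    then have "((\<lambda>\<epsilon>. spw (cpt (- s) \<epsilon>) (\<alpha> - 1) x)
      \<longlongrightarrow> spw (cpt (- s) 0) (\<alpha> - 1) x) (at_right 0)"
      by (rule tendsto_within_subset) auto
    then show ?case by simp
  qed
  show "(\<lambda>x. (cr (- s) + cr x) powr cr (\<alpha> - 1)) \<in> borel_measurable \<eta>"
    by measurable
  show "(\<lambda>x. spw (cpt (- s) \<epsilon>) (\<alpha> - 1) x) \<in> borel_measurable \<eta>" for \<epsilon>
    by measurable
qed

end

definition Aq :: "complex \<Rightarrow> complex" where "Aq z = A z powr cr (- \<theta> / \<alpha> - 1)"

text \<open>The boundary value of the derivative of \<open>Sh\<close>; the sign in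
  \<open>\<delta>\<close> cancels that of the inner map from s to -s. It has a value at every s, but
  is the derivative of \<open>\<delta>\<close> only almost everywhere.\<close>

definition \<delta>' :: "real \<Rightarrow> real" where
  "\<delta>' s = Im (cr (- \<theta>) * Aq (cr (- s)) * P (cr (- s))) / pi"

lemma continuous_on_Aq: "continuous_on {z. Im z \<ge> 0} Aq"
proof -
  have "A z \<noteq> 0 \<and> (0 \<le> Re (A z) \<or> Im (A z) \<noteq> 0)" if "Im z \<ge> 0" for z
    using A_upper[OF that] by (auto simp: complex_nonpos_Reals_iff)
  then show ?thesis
    unfolding Aq_def[abs_def]
    by (intro continuous_on_powr_complex continuous_on_A continuous_on_const) auto
qed

lemma P_holomorphic: "P holomorphic_on - \<real>\<^sub>\<le>\<^sub>0"
  unfolding P_def by (rule \<eta>.pt_holomorphic, rule \<eta>.integrable_pt_neg) (use \<alpha> in auto)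

lemma Sh_has_field_derivative:
  assumes z: "z \<notin> \<real>\<^sub>\<le>\<^sub>0"
  shows "(Sh has_field_derivative cr (- \<theta>) * Aq z * P z) (at z)"
proof -
  have A: "(A has_field_derivative cr \<alpha> * P z) (at z)"
    unfolding P_def by (rule \<eta>.pt_has_field_derivative) (use integrable_A \<alpha> z in auto)
  have "(Sh has_field_derivative (cr (- \<theta> / \<alpha>) * A z powr (cr (- \<theta> / \<alpha>) - 1)) * (cr \<alpha> * P z)) (at z)"
    unfolding Sh_def[abs_def] by (rule DERIV_chain2[OF has_field_derivative_powr[OF A_slit[OF z]] A])
  moreover have "cr (- \<theta> / \<alpha>) * cr \<alpha> = cr (- \<theta>)"
  proof -
    have "- \<theta> / \<alpha> * \<alpha> = - \<theta>" using \<alpha> by simp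
    then show ?thesis by (simp only: of_real_mult[symmetric])
  qed
  moreover have "cr (- \<theta> / \<alpha>) - 1 = cr (- \<theta> / \<alpha> - 1)" by simp
  ultimately show ?thesis unfolding Aq_def by (metis mult.assoc mult.commute)
qed

lemma Sh_line_integral:
  assumes \<epsilon>: "0 < \<epsilon>" and t: "0 \<le> t"
  shows "has_bochner_integral lborel (\<lambda>s. Im (cr (- \<theta>) * Aq (cpt (- s) \<epsilon>) * P (cpt (- s) \<epsilon>)) / pi * indicator {0..t} s)
     (- Im (Sh (cpt (- t) \<epsilon>)) / pi - (- Im (Sh (cpt (- 0) \<epsilon>)) / pi))"
proof (rule has_bochner_integral_FTC_Icc_real)
  show "0 \<le> t" by fact
next
  fix s
  let ?z = "cpt (- s) \<epsilon>"
  let ?H = "cr (- \<theta>) * Aq ?z * P ?z"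
  have z: "?z \<notin> \<real>\<^sub>\<le>\<^sub>0" using \<epsilon> by (simp add: complex_nonpos_Reals_iff)
  have "((\<lambda>s. cr (- s) + \<i> * cr \<epsilon>) has_vector_derivative - 1) (at s)"
    by (auto intro!: derivative_eq_intros)
  from field_vector_diff_chain_at[OF this Sh_has_field_derivative[OF z]]
  have "((\<lambda>s. Sh (cpt (- s) \<epsilon>)) has_vector_derivative - ?H) (at s)"
    by (simp add: comp_def)
  then have "((\<lambda>s. Im (Sh (cpt (- s) \<epsilon>))) has_vector_derivative Im (- ?H)) (at s)"
    by (rule bounded_linear.has_vector_derivative[OF bounded_linear_Im])
  then have "((\<lambda>s. Im (Sh (cpt (- s) \<epsilon>))) has_real_derivative Im (- ?H)) (at s)"
    by (simp add: has_real_derivative_iff_has_vector_derivative)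
  from DERIV_cdivide[OF DERIV_minus[OF this], of pi]
  show "((\<lambda>s. - Im (Sh (cpt (- s) \<epsilon>)) / pi) has_real_derivative Im ?H / pi) (at s)"
    by simp
  have cP: "continuous_on UNIV (\<lambda>s. P (cpt (- s) \<epsilon>))"
    by (rule continuous_on_compose2[OF holomorphic_on_imp_continuous_on[OF P_holomorphic]])
       (use \<epsilon> in \<open>auto intro!: continuous_intros simp: complex_nonpos_Reals_iff\<close>)
  have cA: "continuous_on UNIV (\<lambda>s. Aq (cpt (- s) \<epsilon>))"
    by (rule continuous_on_compose2[OF continuous_on_Aq]) (use \<epsilon> in \<open>auto intro!: continuous_intros\<close>)
  have "continuous_on UNIV (\<lambda>s. Im (cr (- \<theta>) * Aq (cpt (- s) \<epsilon>) * P (cpt (- s) \<epsilon>)) / pi)"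
    by (intro continuous_on_divide continuous_on_Im continuous_on_mult cP cA continuous_on_const) auto
  then show "isCont (\<lambda>s. Im (cr (- \<theta>) * Aq (cpt (- s) \<epsilon>) * P (cpt (- s) \<epsilon>)) / pi) s"
    by (simp add: continuous_on_eq_continuous_at)
qed

lemma \<delta>'_measurable [measurable]: "\<delta>' \<in> borel_measurable borel"
proof -
  have P_meas: "(\<lambda>s. P (cr (- s))) \<in> borel_measurable borel"
    unfolding P_def \<eta>.pt_def
  proof (rule \<eta>.borel_measurable_lebesgue_integral)
    have "(\<lambda>p. spw 0 (\<alpha> - 1) (- fst p + snd p)) \<in> borel_measurable (borel \<Otimes>\<^sub>M \<eta>)"
      by (rule measurable_compose[OF _ borel_measurable_shift_powr]) measurable
    then show "(\<lambda>(s, x). (cr (- s) + cr x) powr cr (\<alpha> - 1)) \<in> borel_measurable (borel \<Otimes>\<^sub>M \<eta>)"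
      by (simp add: case_prod_beta')
  qed
  have A_meas: "(\<lambda>s. Aq (cr (- s))) \<in> borel_measurable borel"
    by (intro borel_measurable_continuous_onI continuous_on_compose2[OF continuous_on_Aq]) (auto intro!: continuous_intros)
  show ?thesis
    unfolding \<delta>'_def[abs_def]
    by (intro borel_measurable_divide measurable_compose[OF _ borel_measurable_Im] borel_measurable_times P_meas A_meas) auto
qed

theorem \<delta>_integral:
  assumes T: "0 \<le> T"
  shows "integrable lborel (\<lambda>s. indicator {0..T} s * \<delta>' s)"
    and "\<delta> T = (\<integral>s. indicator {0..T} s * \<delta>' s \<partial>lborel)"
proof -
  define De where "De \<epsilon> s = Im (cr (- \<theta>) * Aq (cpt (- s) \<epsilon>) * P (cpt (- s) \<epsilon>)) / pi" for \<epsilon> s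
  obtain K where K: "0 \<le> K" "\<And>z. 0 \<le> Im z \<Longrightarrow> Im z \<le> 1 \<Longrightarrow> - T \<le> Re z \<Longrightarrow> Re z \<le> 0 \<Longrightarrow> norm (Aq z) \<le> K"
    using strip_bounded[OF continuous_on_Aq, of "- T" 0] by metis
  define X where "X n = 1 / real (Suc n)" for n
  have X: "0 < X n" "X n \<le> 1" for n by (auto simp: X_def)
  have Xlim: "X \<longlonglongrightarrow> 0" unfolding X_def by (rule LIMSEQ_Suc[OF lim_1_over_n])
  have Xr: "filterlim X (at_right 0) sequentially"
    using Xlim by (auto simp: filterlim_at X_def)
  have AqX: "(\<lambda>n. Aq (cpt (- s) (X n))) \<longlonglongrightarrow> Aq (cr (- s))"
     and ShX: "(\<lambda>n. Sh (cpt (- s) (X n))) \<longlonglongrightarrow> Sh (cr (- s))" for s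
  proof -
    have l: "(\<lambda>n. cr (- s) + \<i> * cr (X n)) \<longlonglongrightarrow> cr (- s) + \<i> * cr 0"
      by (intro tendsto_intros Xlim)
    show "(\<lambda>n. Aq (cpt (- s) (X n))) \<longlonglongrightarrow> Aq (cr (- s))"
      by (rule continuous_on_tendsto_compose[OF continuous_on_Aq]) (use l X(1) in \<open>auto intro!: always_eventually intro: less_imp_le\<close>)
    show "(\<lambda>n. Sh (cpt (- s) (X n))) \<longlonglongrightarrow> Sh (cr (- s))"
      by (rule continuous_on_tendsto_compose[OF continuous_on_Sh]) (use l X(1) in \<open>auto intro!: always_eventually intro: less_imp_le\<close>)
  qed
  have lim: "AE s in lborel. (\<lambda>n. indicator {0..T} s * De (X n) s) \<longlonglongrightarrow> indicator {0..T} s * \<delta>' s"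
    using AE_potential_finite[OF T]
  proof eventually_elim
    case (elim s)
    show ?case
    proof (cases "s \<in> {0..T}")
      case True
      then have "potential s < \<infinity>" "AE x in \<eta>. x \<noteq> s" using elim by auto
      from filterlim_compose[OF P_limit[OF this] Xr]
      have "(\<lambda>n. P (cpt (- s) (X n))) \<longlonglongrightarrow> P (cr (- s))" .
      then show ?thesis unfolding De_def \<delta>'_def by (intro tendsto_intros AqX) auto
    qed simp
  qed
  \<comment> \<open>\<open>Aq\<close> is continuous up to the axis and hence bounded on the
    rectangle in question. The whole singularity sits in \<open>P\<close>, which the potential
    dominates uniformly in the height.\<close>
  have bound: "AE s in lborel. norm (indicator {0..T} s * De (X n) s) \<le> \<theta> * K / pi * (indicator {0..T} s * enn2real (potential s))" for n
    using AE_potential_finite[OF T]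
  proof eventually_elim
    case (elim s)
    show ?case
    proof (cases "s \<in> {0..T}")
      case True
      then have "potential s < \<infinity>" "AE x in \<eta>. x \<noteq> s" using elim by auto
      from P_bound[OF this X(1)[of n]]
      have "norm (P (cpt (- s) (X n))) \<le> enn2real (potential s)" .
      moreover have "norm (Aq (cpt (- s) (X n))) \<le> K"
        using True X[of n] by (intro K(2)) (auto intro: less_imp_le)
      ultimately have nb: "norm (cr (- \<theta>) * Aq (cpt (- s) (X n)) * P (cpt (- s) (X n)))
         \<le> \<theta> * K * enn2real (potential s)"
        unfolding norm_mult norm_of_real using \<theta> K(1) by (intro mult_mono mult_nonneg_nonneg) auto
      have "\<bar>De (X n) s\<bar> \<le> \<theta> * K * enn2real (potential s) / pi"
        unfolding De_def abs_divide abs_of_pos[OF pi_gt_zero]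
        by (rule divide_right_mono[OF order.trans[OF abs_Im_le_cmod nb]]) simp
      then show ?thesis using True by simp
    qed simp
  qed
  have hb: "has_bochner_integral lborel (\<lambda>s. indicator {0..T} s * De (X n) s)
     (- Im (Sh (cpt (- T) (X n))) / pi - (- Im (Sh (cpt (- 0) (X n))) / pi))" for n
    using Sh_line_integral[OF X(1)[of n] T] unfolding De_def[symmetric] by (simp only: mult.commute[of _ "indicator _ _"])
  have [measurable]: "(\<lambda>s. indicator {0..T} s * De (X n) s) \<in> borel_measurable lborel" for n
    using hb[of n] by (intro borel_measurable_integrable) (simp only: has_bochner_integral_iff)
  have w: "integrable lborel (\<lambda>s. \<theta> * K / pi * (indicator {0..T} s * enn2real (potential s)))"
    by (intro integrable_mult_right integrable_potential T)
  show "integrable lborel (\<lambda>s. indicator {0..T} s * \<delta>' s)"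
    by (rule integrable_dominated_convergence[OF _ _ w lim bound]) measurable
  have "(\<lambda>n. \<integral>s. indicator {0..T} s * De (X n) s \<partial>lborel) \<longlonglongrightarrow> (\<integral>s. indicator {0..T} s * \<delta>' s \<partial>lborel)"
    by (rule integral_dominated_convergence[OF _ _ w lim bound]) measurable
  moreover have "(\<integral>s. indicator {0..T} s * De (X n) s \<partial>lborel) = - Im (Sh (cpt (- T) (X n))) / pi - (- Im (Sh (cpt (- 0) (X n))) / pi)" for n
    using hb[of n] by (simp add: has_bochner_integral_iff)
  moreover have "(\<lambda>n. - Im (Sh (cpt (- T) (X n))) / pi - (- Im (Sh (cpt (- 0) (X n))) / pi)) \<longlonglongrightarrow> - Im (Sh (cr (- T))) / pi - (- Im (Sh (cr (- 0))) / pi)"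
    by (intro tendsto_intros ShX) auto
  ultimately have "(\<integral>s. indicator {0..T} s * \<delta>' s \<partial>lborel) = - Im (Sh (cr (- T))) / pi - (- Im (Sh (cr (- 0))) / pi)"
    by (auto intro: LIMSEQ_unique)
  \<comment> \<open>The lower end point contributes nothing because \<open>Sh 0\<close> is
    real.\<close>
  then show "\<delta> T = (\<integral>s. indicator {0..T} s * \<delta>' s \<partial>lborel)"
    using Sh_of_real[of 0] by (simp add: \<delta>_def)
qed

end

section \<open>The density\<close>

text \<open>Two kernels share the integral (c - s) powr \<rho> / \<rho> over [s, c]: |t - s| powr
  (\<rho>-1) and |c - t| powr (\<rho>-1). Abstracting this value lets one application of Fubini on
  the triangle 0 \<le> s \<le> t \<le> c serve both.\<close>

lemma triangle_Fubini:
  fixes k :: "real \<Rightarrow> real \<Rightarrow> real" and D :: "real \<Rightarrow> real"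
  assumes c: "0 \<le> c" and \<rho>: "0 < \<rho>"
    and k [measurable]: "(\<lambda>(s, t). k s t) \<in> borel_measurable (borel \<Otimes>\<^sub>M borel)" and k_nonneg: "\<And>s t. 0 \<le> k s t"
    and kint: "\<forall>s\<in>{0..c}. has_bochner_integral lborel (\<lambda>t. indicator {s..c} t * k s t) ((c - s) powr \<rho> / \<rho>)"
    and D [measurable]: "D \<in> borel_measurable borel" and D_int: "integrable lborel (\<lambda>s. indicator {0..c} s * D s)"
  defines "f \<equiv> \<lambda>s t. indicator {0..c} s * D s * (indicator {s..c} t * k s t)"
  shows "AE t in lborel. integrable lborel (\<lambda>s. f s t)"
    and "integrable lborel (\<lambda>t. \<integral>s. f s t \<partial>lborel)"
    and "(\<integral>t. \<integral>s. f s t \<partial>lborel \<partial>lborel) = (\<integral>s. indicator {0..c} s * (D s * ((c - s) powr \<rho> / \<rho>)) \<partial>lborel)"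
proof -
  have ind: "indicator {s..c} t = (if s \<le> t \<and> t \<le> c then 1 else 0 :: real)" for s t by (simp add: indicator_def)
  have f_meas [measurable]: "(\<lambda>(s, t). f s t) \<in> borel_measurable (borel \<Otimes>\<^sub>M borel)"
    unfolding f_def ind by measurable
  have f_int: "integrable lborel (\<lambda>t. f s t)" and f_val: "(\<integral>t. f s t \<partial>lborel) = indicator {0..c} s * (D s * ((c - s) powr \<rho> / \<rho>))"
    and f_norm: "(\<integral>t. norm (f s t) \<partial>lborel) = norm (indicator {0..c} s * D s) * ((c - s) powr \<rho> / \<rho>)" for s
  proof -
    have *: "has_bochner_integral lborel (\<lambda>t. a * (indicator {s..c} t * k s t)) (a * ((c - s) powr \<rho> / \<rho>))" if "a \<noteq> 0 \<Longrightarrow> 0 \<le> s \<and> s \<le> c" for a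
    proof (cases "a = 0")
      case False
      then show ?thesis using bspec[OF kint, of s] that by (intro has_bochner_integral_mult_right) auto
    qed (auto intro: has_bochner_integral_zero)
    have "has_bochner_integral lborel (f s) (indicator {0..c} s * D s * ((c - s) powr \<rho> / \<rho>))"
      unfolding f_def by (rule *) (auto simp: indicator_def split: if_splits)
    then show "integrable lborel (\<lambda>t. f s t)" "(\<integral>t. f s t \<partial>lborel) = indicator {0..c} s * (D s * ((c - s) powr \<rho> / \<rho>))"
      by (auto simp: has_bochner_integral_iff)
    have "norm (f s t) = norm (indicator {0..c} s * D s) * (indicator {s..c} t * k s t)" for t
      using k_nonneg by (simp add: f_def abs_mult)
    moreover have "has_bochner_integral lborel (\<lambda>t. norm (indicator {0..c} s * D s) * (indicator {s..c} t * k s t)) (norm (indicator {0..c} s * D s) * ((c - s) powr \<rho> / \<rho>))"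
      by (rule *) (auto simp: indicator_def split: if_splits)
    ultimately show "(\<integral>t. norm (f s t) \<partial>lborel) = norm (indicator {0..c} s * D s) * ((c - s) powr \<rho> / \<rho>)"
      by (simp only: has_bochner_integral_iff)
  qed
  have int: "integrable (lborel \<Otimes>\<^sub>M lborel) (\<lambda>(s, t). f s t)"
  proof (rule lborel_pair.Fubini_integrable)
    show "integrable lborel (\<lambda>s. \<integral>t. norm ((\<lambda>(s, t). f s t) (s, t)) \<partial>lborel)"
    proof (rule Bochner_Integration.integrable_bound)
      show "integrable lborel (\<lambda>s. c powr \<rho> / \<rho> * (indicator {0..c} s * D s))"
        by (intro integrable_mult_right D_int)
      show "AE s in lborel. norm (\<integral>t. norm ((\<lambda>(s, t). f s t) (s, t)) \<partial>lborel) \<le> norm (c powr \<rho> / \<rho> * (indicator {0..c} s * D s))"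
      proof (intro AE_I2)
        fix s
        have "(c - s) powr \<rho> / \<rho> \<le> c powr \<rho> / \<rho>" if "s \<in> {0..c}"
          using that \<rho> by (intro divide_right_mono powr_mono2) auto
        then have "norm (indicator {0..c} s * D s) * ((c - s) powr \<rho> / \<rho>) \<le> norm (indicator {0..c} s * D s) * (c powr \<rho> / \<rho>)"
          by (cases "s \<in> {0..c}") (simp only: mult_left_mono norm_ge_zero, simp)
        then show "norm (\<integral>t. norm ((\<lambda>(s, t). f s t) (s, t)) \<partial>lborel) \<le> norm (c powr \<rho> / \<rho> * (indicator {0..c} s * D s))"
          using \<rho> by (simp add: f_norm[unfolded real_norm_def] abs_mult mult_ac)
      qed
    qed measurable
    show "AE s in lborel. integrable lborel (\<lambda>t. (\<lambda>(s, t). f s t) (s, t))" using f_int by simp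
  qed measurable
  show "AE t in lborel. integrable lborel (\<lambda>s. f s t)" using lborel_pair.AE_integrable_snd[OF int] .
  show "integrable lborel (\<lambda>t. \<integral>s. f s t \<partial>lborel)" using lborel_pair.integrable_snd[OF int] .
  show "(\<integral>t. \<integral>s. f s t \<partial>lborel \<partial>lborel) = (\<integral>s. indicator {0..c} s * (D s * ((c - s) powr \<rho> / \<rho>)) \<partial>lborel)"
    using lborel_pair.Fubini_integral[OF int] by (simp add: f_val)
qed

text \<open>The Riemann-Liouville fractional integral of order \<rho>, without its factor 1 / Gamma
  \<rho>.\<close>

definition frac_int :: "real \<Rightarrow> (real \<Rightarrow> real) \<Rightarrow> real \<Rightarrow> real" where
  "frac_int \<rho> D y = (\<integral>t. indicator {0..y} t * ((y - t) powr (\<rho> - 1) * D t) \<partial>lborel)"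

lemma has_bochner_integral_powr_right:
  fixes \<rho> s c :: real
  assumes "0 < \<rho>" "s \<le> c"
  shows "has_bochner_integral lborel (\<lambda>t. indicator {s..c} t * \<bar>t - s\<bar> powr (\<rho> - 1)) ((c - s) powr \<rho> / \<rho>)"
proof -
  have "has_bochner_integral lborel (\<lambda>v. indicator {0..c - s} v * v powr (\<rho> - 1)) ((c - s) powr \<rho> / \<rho>)"
    using assms by (intro has_bochner_integral_powr_Icc) auto
  from lborel_has_bochner_integral_real_affine_iff[THEN iffD1, OF _ this, of 1 "- s"]
  have "has_bochner_integral lborel (\<lambda>t. indicator {0..c - s} (- s + t) * (- s + t) powr (\<rho> - 1)) ((c - s) powr \<rho> / \<rho>)"
    by simp
  moreover have "indicator {0..c - s} (- s + t) * (- s + t) powr (\<rho> - 1) = indicator {s..c} t * \<bar>t - s\<bar> powr (\<rho> - 1)" for t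
    by (auto simp: indicator_def)
  ultimately show ?thesis by simp
qed

lemma has_bochner_integral_powr_left:
  fixes \<rho> s c :: real
  assumes "0 < \<rho>" "s \<le> c"
  shows "has_bochner_integral lborel (\<lambda>t. indicator {s..c} t * \<bar>c - t\<bar> powr (\<rho> - 1)) ((c - s) powr \<rho> / \<rho>)"
proof -
  have "has_bochner_integral lborel (\<lambda>v. indicator {0..c - s} v * v powr (\<rho> - 1)) ((c - s) powr \<rho> / \<rho>)"
    using assms by (intro has_bochner_integral_powr_Icc) auto
  from lborel_has_bochner_integral_real_affine_iff[THEN iffD1, OF _ this, of "-1" c]
  have "has_bochner_integral lborel (\<lambda>t. indicator {0..c - s} (c - t) * (c - t) powr (\<rho> - 1)) ((c - s) powr \<rho> / \<rho>)"
    by simp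
  moreover have "indicator {0..c - s} (c - t) * (c - t) powr (\<rho> - 1) = indicator {s..c} t * \<bar>c - t\<bar> powr (\<rho> - 1)" for t
    by (auto simp: indicator_def)
  ultimately show ?thesis by simp
qed

text \<open>The kernel here is |t - s| powr (\<rho>-1), singular on the diagonal. Integrability of
  the sections comes from Fubini and is therefore known only for almost every y.\<close>

lemma frac_int_props:
  fixes c \<rho> :: real and D :: "real \<Rightarrow> real"
  assumes c: "0 \<le> c" and \<rho>: "0 < \<rho>" and D [measurable]: "D \<in> borel_measurable borel"
    and D_int: "integrable lborel (\<lambda>s. indicator {0..c} s * D s)"
  shows "AE y in lborel. y \<in> {0..c} \<longrightarrow> integrable lborel (\<lambda>t. indicator {0..y} t * ((y - t) powr (\<rho> - 1) * D t))"
    and "integrable lborel (\<lambda>y. indicator {0..c} y * frac_int \<rho> D y)"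
    and "(\<integral>y. indicator {0..c} y * frac_int \<rho> D y \<partial>lborel) = (\<integral>s. indicator {0..c} s * (D s * ((c - s) powr \<rho> / \<rho>)) \<partial>lborel)"
proof -
  have kint: "\<forall>s\<in>{0..c}. has_bochner_integral lborel (\<lambda>t. indicator {s..c} t * \<bar>t - s\<bar> powr (\<rho> - 1)) ((c - s) powr \<rho> / \<rho>)"
    by (intro ballI has_bochner_integral_powr_right \<rho>) simp
  have kmeas: "(\<lambda>(s, t). \<bar>t - s\<bar> powr (\<rho> - 1)) \<in> borel_measurable (borel \<Otimes>\<^sub>M borel)" by measurable
  note T = triangle_Fubini[OF c \<rho> kmeas powr_ge_zero kint D D_int]
  have eq: "indicator {0..c} s * D s * (indicator {s..c} y * \<bar>y - s\<bar> powr (\<rho> - 1)) = indicator {0..c} y * (indicator {0..y} s * ((y - s) powr (\<rho> - 1) * D s))" for s y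
    by (auto simp: indicator_def)
  have J: "(\<integral>s. indicator {0..c} s * D s * (indicator {s..c} y * \<bar>y - s\<bar> powr (\<rho> - 1)) \<partial>lborel) = indicator {0..c} y * frac_int \<rho> D y" for y
    unfolding eq frac_int_def by simp
  show "AE y in lborel. y \<in> {0..c} \<longrightarrow> integrable lborel (\<lambda>t. indicator {0..y} t * ((y - t) powr (\<rho> - 1) * D t))"
    using T(1) unfolding eq by eventually_elim auto
  show "integrable lborel (\<lambda>y. indicator {0..c} y * frac_int \<rho> D y)"
    using T(2) unfolding J .
  show "(\<integral>y. indicator {0..c} y * frac_int \<rho> D y \<partial>lborel) = (\<integral>s. indicator {0..c} s * (D s * ((c - s) powr \<rho> / \<rho>)) \<partial>lborel)"
    using T(3) unfolding J by simp
qed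

text \<open>The kernel here is |c - t| powr (\<rho>-1). The result is the same integral as in
  \<open>frac_int_props\<close>, which makes the two comparable.\<close>

lemma iterated_primitive:
  fixes c \<rho> :: real and D :: "real \<Rightarrow> real"
  assumes c: "0 \<le> c" and \<rho>: "0 < \<rho>" and D [measurable]: "D \<in> borel_measurable borel"
    and D_int: "integrable lborel (\<lambda>s. indicator {0..c} s * D s)"
  shows "(\<integral>t. indicator {0..c} t * ((c - t) powr (\<rho> - 1) * (\<integral>s. indicator {0..t} s * D s \<partial>lborel)) \<partial>lborel)
    = (\<integral>s. indicator {0..c} s * (D s * ((c - s) powr \<rho> / \<rho>)) \<partial>lborel)"
proof -
  have kint: "\<forall>s\<in>{0..c}. has_bochner_integral lborel (\<lambda>t. indicator {s..c} t * \<bar>c - t\<bar> powr (\<rho> - 1)) ((c - s) powr \<rho> / \<rho>)"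
    by (intro ballI has_bochner_integral_powr_left \<rho>) simp
  have kmeas: "(\<lambda>(s, t). \<bar>c - t\<bar> powr (\<rho> - 1)) \<in> borel_measurable (borel \<Otimes>\<^sub>M borel)" by measurable
  note T = triangle_Fubini(3)[OF c \<rho> kmeas powr_ge_zero kint D D_int]
  have eq: "indicator {0..c} s * D s * (indicator {s..c} t * \<bar>c - t\<bar> powr (\<rho> - 1)) = (indicator {0..c} t * (c - t) powr (\<rho> - 1)) * (indicator {0..t} s * D s)" for s t
    by (auto simp: indicator_def)
  show ?thesis using T unfolding eq by (simp add: mult.assoc)
qed

text \<open>Lebesgue differentiation needs global integrability, so f and g are cut to [0, n]; one
  null set serves all n, and derivatives are unique.\<close>

lemma AE_eq_of_primitives:
  fixes f g :: "real \<Rightarrow> real"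
  assumes f: "\<And>c. 0 \<le> c \<Longrightarrow> integrable lborel (\<lambda>y. indicator {0..c} y * f y)"
    and g: "\<And>c. 0 \<le> c \<Longrightarrow> integrable lborel (\<lambda>y. indicator {0..c} y * g y)"
    and eq: "\<And>c. 0 \<le> c \<Longrightarrow> (\<integral>y. indicator {0..c} y * f y \<partial>lborel) = (\<integral>y. indicator {0..c} y * g y \<partial>lborel)"
  shows "AE y in lborel. 0 < y \<longrightarrow> f y = g y"
proof -
  have "AE y in lborel. \<forall>n::nat. ((\<lambda>y. LINT t:{..y}|lborel. indicator {0..real n} t * f t) has_real_derivative indicator {0..real n} y * f y) (at y)"
    unfolding AE_all_countable using lebesgue_differentiation[OF f] by simp
  moreover have "AE y in lborel. \<forall>n::nat. ((\<lambda>y. LINT t:{..y}|lborel. indicator {0..real n} t * g t) has_real_derivative indicator {0..real n} y * g y) (at y)"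
    unfolding AE_all_countable using lebesgue_differentiation[OF g] by simp
  ultimately show ?thesis
  proof eventually_elim
    case (elim y)
    show ?case
    proof
      assume y: "0 < y"
      obtain n :: nat where n: "y < real n" using reals_Archimedean2 by blast
      have "(LINT t:{..x}|lborel. indicator {0..real n} t * f t) = (LINT t:{..x}|lborel. indicator {0..real n} t * g t)" for x
      proof -
        \<comment> \<open>The cut primitive at x is an integral over [0, min x n], to which the
          assumed equality applies.\<close>
        have *: "(LINT t:{..x}|lborel. indicator {0..real n} t * h t) = (if x < 0 then 0 else \<integral>t. indicator {0..min x (real n)} t * h t \<partial>lborel)" for h :: "real \<Rightarrow> real"
          unfolding set_lebesgue_integral_def
          by (auto intro!: Bochner_Integration.integral_cong integral_eq_zero_AE simp: indicator_def)
        show ?thesis unfolding * using eq by simp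
      qed
      then have "(\<lambda>y. LINT t:{..y}|lborel. indicator {0..real n} t * f t) = (\<lambda>y. LINT t:{..y}|lborel. indicator {0..real n} t * g t)"
        by (rule ext)
      then have "indicator {0..real n} y * f y = indicator {0..real n} y * g y"
        using DERIV_unique elim by metis
      then show "f y = g y" using y n by (simp add: indicator_def)
    qed
  qed
qed

section \<open>Identification of the density\<close>

context stieltjes_pair begin

lemma \<delta>_AE_derivative: "AE t in lborel. 0 < t \<longrightarrow> (\<delta> has_real_derivative \<delta>' t) (at t)"
proof -
  have "AE y in lborel. \<forall>n::nat. ((\<lambda>y. LINT t:{..y}|lborel. indicator {0..real n} t * \<delta>' t) has_real_derivative indicator {0..real n} y * \<delta>' y) (at y)"
    unfolding AE_all_countable using lebesgue_differentiation[OF \<delta>_integral(1)] by simp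
  then show ?thesis
  proof eventually_elim
    case (elim t)
    show ?case
    proof
      assume t: "0 < t"
      obtain n :: nat where n: "t < real n" using reals_Archimedean2 by blast
      have "((\<lambda>y. LINT t:{..y}|lborel. indicator {0..real n} t * \<delta>' t) has_real_derivative \<delta>' t) (at t)"
        using elim[rule_format, of n] t n by (simp add: indicator_def)
      then show "(\<delta> has_real_derivative \<delta>' t) (at t)"
      proof (rule has_field_derivative_transform_within_open[where S = "{0<..<real n}"])
        fix y assume y: "y \<in> {0<..<real n}"
        have "(LINT t:{..y}|lborel. indicator {0..real n} t * \<delta>' t) = (\<integral>s. indicator {0..y} s * \<delta>' s \<partial>lborel)"
          unfolding set_lebesgue_integral_def using y
          by (intro Bochner_Integration.integral_cong) (auto simp: indicator_def)
        also have "\<dots> = \<delta> y" using \<delta>_integral(2)[of y] y by simp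
        finally show "(LINT t:{..y}|lborel. indicator {0..real n} t * \<delta>' t) = \<delta> y" .
      qed (use t n in auto)
    qed
  qed
qed

lemma \<delta>_integrable: "integrable lborel (\<lambda>s. indicator {0..c} s * \<delta> s)"
proof -
  have "integrable lborel (\<lambda>s. indicator {0..c} s *\<^sub>R \<delta> s)"
    by (rule borel_integrable_compact[OF compact_Icc continuous_on_subset[OF continuous_on_\<delta>]]) auto
  then show ?thesis by simp
qed

context
  fixes q :: "real \<Rightarrow> real"
  assumes q [measurable]: "q \<in> borel_measurable borel" and q_nonneg: "\<And>y. 0 \<le> q y"
    and \<mu>_q: "\<mu> = density lborel (\<lambda>y. ennreal (q y))"
begin

lemma q_integral:
  assumes c: "0 \<le> c"
  shows "integrable lborel (\<lambda>y. indicator {0..c} y * q y)"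
    and "(\<integral>y. indicator {0..c} y * q y \<partial>lborel) = (\<integral>t. indicator {0..c} t * ((c - t) powr (\<theta> - 1) * \<delta> t) \<partial>lborel)"
proof -
  have nn: "(\<integral>\<^sup>+y. ennreal (indicator {0..c} y * q y) \<partial>lborel) = ennreal (measure \<mu> {0..c})"
  proof -
    have "(\<integral>\<^sup>+y. ennreal (indicator {0..c} y * q y) \<partial>lborel) = emeasure \<mu> {0..c}"
      unfolding \<mu>_q by (subst emeasure_density) (auto intro!: nn_integral_cong simp: indicator_def)
    then show ?thesis by (simp add: \<mu>.emeasure_eq_measure)
  qed
  show int: "integrable lborel (\<lambda>y. indicator {0..c} y * q y)"
    by (rule integrableI_nonneg) (use nn q_nonneg in auto)
  have "(\<integral>y. indicator {0..c} y * q y \<partial>lborel) = measure \<mu> {0..c}"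
    using nn q_nonneg by (subst integral_eq_nn_integral) auto
  also have "\<dots> = measure \<mu> {..c}"
    by (rule measure_eq_AE) (use \<mu>.AE_nonneg in auto)
  also have "\<dots> = (\<integral>u. indicator {0..c} u * (u powr (\<theta> - 1) * \<delta> (c - u)) \<partial>lborel)"
  proof (rule cdf_formula[OF c])
    have "AE x in lborel. x \<noteq> c" by (rule AE_lborel_singleton)
    then show "AE x in \<mu>. x \<noteq> c" unfolding \<mu>_q by (subst AE_density) auto
  qed
  also have "\<dots> = (\<integral>t. indicator {0..c} (c + (-1) * t) * ((c + (-1) * t) powr (\<theta> - 1) * \<delta> (c - (c + (-1) * t))) \<partial>lborel)"
    by (subst lborel_integral_real_affine[of "-1" _ c]) auto
  also have "\<dots> = (\<integral>t. indicator {0..c} t * ((c - t) powr (\<theta> - 1) * \<delta> t) \<partial>lborel)"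
    by (intro Bochner_Integration.integral_cong) (auto simp: indicator_def)
  finally show "(\<integral>y. indicator {0..c} y * q y \<partial>lborel) = (\<integral>t. indicator {0..c} t * ((c - t) powr (\<theta> - 1) * \<delta> t) \<partial>lborel)" .
qed

text \<open>The distribution function integrates (c - t) powr (\<theta>-1) against \<delta>, itself
  a primitive of \<open>\<delta>'\<close>. Exchanging integrals gives \<open>\<delta>'\<close>
  integrated against (c - s) powr \<theta> / \<theta>, which is also the primitive of the fractional
  integral.\<close>

lemma AE_q_eq: "AE y in lborel. 0 < y \<longrightarrow> q y = frac_int \<theta> \<delta>' y"
proof (rule AE_eq_of_primitives[OF q_integral(1)])
  fix c :: real assume c: "0 \<le> c"
  note D = \<delta>_integral(1)[OF c]
  show "integrable lborel (\<lambda>y. indicator {0..c} y * frac_int \<theta> \<delta>' y)"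
    by (intro frac_int_props(2) c \<theta> D \<delta>'_measurable)
  have "(\<integral>y. indicator {0..c} y * q y \<partial>lborel) = (\<integral>t. indicator {0..c} t * ((c - t) powr (\<theta> - 1) * (\<integral>s. indicator {0..t} s * \<delta>' s \<partial>lborel)) \<partial>lborel)"
    unfolding q_integral(2)[OF c]
    by (intro Bochner_Integration.integral_cong refl) (auto simp: indicator_def \<delta>_integral(2))
  also have "\<dots> = (\<integral>s. indicator {0..c} s * (\<delta>' s * ((c - s) powr \<theta> / \<theta>)) \<partial>lborel)"
    by (intro iterated_primitive c \<theta> D \<delta>'_measurable)
  also have "\<dots> = (\<integral>y. indicator {0..c} y * frac_int \<theta> \<delta>' y \<partial>lborel)"
    by (intro frac_int_props(3)[symmetric] c \<theta> D \<delta>'_measurable)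
  finally show "(\<integral>y. indicator {0..c} y * q y \<partial>lborel) = (\<integral>y. indicator {0..c} y * frac_int \<theta> \<delta>' y \<partial>lborel)" .
qed

lemma \<delta>_measurable [measurable]: "\<delta> \<in> borel_measurable borel"
  by (intro borel_measurable_continuous_onI continuous_on_\<delta>)

text \<open>For order \<theta>-1 > 0 the primitive of the fractional integral of \<delta> is the
  distribution function divided by \<theta>-1; no derivative of \<delta> enters.\<close>

lemma AE_q_eq':
  assumes "1 < \<theta>"
  shows "AE y in lborel. 0 < y \<longrightarrow> q y = (\<theta> - 1) * frac_int (\<theta> - 1) \<delta> y"
proof (rule AE_eq_of_primitives[OF q_integral(1)])
  have \<rho>: "0 < \<theta> - 1" using assms by simp
  fix c :: real assume c: "0 \<le> c"
  have "integrable lborel (\<lambda>y. (\<theta> - 1) * (indicator {0..c} y * frac_int (\<theta> - 1) \<delta> y))"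
    by (intro integrable_mult_right frac_int_props(2) c \<rho> \<delta>_integrable \<delta>_measurable)
  then show "integrable lborel (\<lambda>y. indicator {0..c} y * ((\<theta> - 1) * frac_int (\<theta> - 1) \<delta> y))" by (simp add: mult_ac)
  have "(\<integral>y. indicator {0..c} y * ((\<theta> - 1) * frac_int (\<theta> - 1) \<delta> y) \<partial>lborel) = (\<theta> - 1) * (\<integral>y. indicator {0..c} y * frac_int (\<theta> - 1) \<delta> y \<partial>lborel)"
    by (simp add: mult.left_commute)
  also have "\<dots> = (\<theta> - 1) * (\<integral>s. indicator {0..c} s * (\<delta> s * ((c - s) powr (\<theta> - 1) / (\<theta> - 1))) \<partial>lborel)"
    by (simp only: frac_int_props(3)[OF c \<rho> \<delta>_measurable \<delta>_integrable])
  also have "\<dots> = (\<integral>t. indicator {0..c} t * ((c - t) powr (\<theta> - 1) * \<delta> t) \<partial>lborel)"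
    using \<rho> by (subst integral_mult_right_zero[symmetric]) (auto intro!: Bochner_Integration.integral_cong simp: mult_ac)
  finally show "(\<integral>y. indicator {0..c} y * q y \<partial>lborel) = (\<integral>y. indicator {0..c} y * ((\<theta> - 1) * frac_int (\<theta> - 1) \<delta> y) \<partial>lborel)"
    using q_integral(2)[OF c] by simp
qed

text \<open>Passage to the gauge integral of complex functions. \<open>vector_derivative\<close> is
  unspecified where \<Delta> is not differentiable, and such points are discarded as a negligible
  set.\<close>

lemma frac_int_eq_integral:
  assumes int: "integrable lborel (\<lambda>t. indicator {0..y} t * ((y - t) powr (\<rho> - 1) * D t))"
    and neg: "negligible N" and eq: "\<And>t. t \<in> {0..y} - N \<Longrightarrow> G t = cr (D t)"
  shows "integral {0..y} (\<lambda>t. cr ((y - t) powr (\<rho> - 1)) * G t) = cr (frac_int \<rho> D y)"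
proof -
  let ?h = "\<lambda>t. cr ((y - t) powr (\<rho> - 1) * D t)"
  have ind: "indicator {0..y} t *\<^sub>R ?h t = cr (indicator {0..y} t * ((y - t) powr (\<rho> - 1) * D t))" for t
    by (simp add: indicator_def)
  have "set_integrable lborel {0..y} ?h"
    unfolding set_integrable_def ind using int by (rule integrable_of_real)
  then have "integral {0..y} ?h = (LINT t:{0..y}|lborel. ?h t)"
    by (rule set_borel_integral_eq_integral(2)[symmetric])
  also have "\<dots> = cr (frac_int \<rho> D y)"
    unfolding set_lebesgue_integral_def ind frac_int_def by (rule integral_complex_of_real)
  finally have 1: "integral {0..y} ?h = cr (frac_int \<rho> D y)" .
  have "integral {0..y} (\<lambda>t. cr ((y - t) powr (\<rho> - 1)) * G t) = integral {0..y} ?h"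
    by (rule integral_spike[OF neg]) (use eq in auto)
  with 1 show ?thesis by simp
qed

theorem AE_density_formula:
  assumes \<Delta>: "\<And>t. \<Delta> t = cr (\<delta> t)"
  shows "AE y in lborel. 0 < y \<longrightarrow>
      cr (q y) = integral {0..y} (\<lambda>t. cr ((y - t) powr (\<theta> - 1)) * vector_derivative \<Delta> (at t))
    \<and> (1 < \<theta> \<longrightarrow> cr (q y) = cr (\<theta> - 1) * integral {0..y} (\<lambda>t. cr ((y - t) powr (\<theta> - 2)) * \<Delta> t))"
proof -
  obtain N where N: "N \<in> null_sets lborel" "\<And>t. t \<notin> N \<Longrightarrow> 0 < t \<Longrightarrow> (\<delta> has_real_derivative \<delta>' t) (at t)"
    using \<delta>_AE_derivative unfolding eventually_ae_filter by force
  have "negligible N" using N(1) by (simp add: negligible_iff_null_sets null_sets_completionI)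
  \<comment> \<open>The point 0 is added because differentiability of \<delta> is known only at
    positive points.\<close>
  then have neg: "negligible (insert 0 N)" by simp
  have vd: "vector_derivative \<Delta> (at t) = cr (\<delta>' t)" if "t \<in> {0..y} - insert 0 N" for t y
  proof (rule vector_derivative_at)
    have "(\<delta> has_real_derivative \<delta>' t) (at t)" using that by (intro N(2)) auto
    moreover have "\<Delta> = (\<lambda>t. cr (\<delta> t))" using \<Delta> by (rule ext)
    ultimately show "(\<Delta> has_vector_derivative cr (\<delta>' t)) (at t)"
      by (simp add: has_vector_derivative_of_real)
  qed
  have int1: "AE y in lborel. \<forall>n::nat. y \<in> {0..real n} \<longrightarrow> integrable lborel (\<lambda>t. indicator {0..y} t * ((y - t) powr (\<theta> - 1) * \<delta>' t))"
    unfolding AE_all_countable by (intro allI frac_int_props(1) \<theta> \<delta>'_measurable \<delta>_integral(1)) auto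
  have int2: "AE y in lborel. 1 < \<theta> \<longrightarrow> (\<forall>n::nat. y \<in> {0..real n} \<longrightarrow> integrable lborel (\<lambda>t. indicator {0..y} t * ((y - t) powr (\<theta> - 1 - 1) * \<delta> t)))"
  proof (cases "1 < \<theta>")
    case True
    have "AE y in lborel. (\<forall>n::nat. y \<in> {0..real n} \<longrightarrow> integrable lborel (\<lambda>t. indicator {0..y} t * ((y - t) powr (\<theta> - 1 - 1) * \<delta> t)))"
      unfolding AE_all_countable by (intro allI frac_int_props(1) \<delta>_measurable \<delta>_integrable) (use True in auto)
    then show ?thesis by eventually_elim simp
  qed simp
  have q2: "AE y in lborel. 1 < \<theta> \<longrightarrow> 0 < y \<longrightarrow> q y = (\<theta> - 1) * frac_int (\<theta> - 1) \<delta> y"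
    by (cases "1 < \<theta>") (use AE_q_eq' in auto)
  from int1 int2 AE_q_eq q2 show ?thesis
  proof eventually_elim
    case (elim y)
    show ?case
    proof (intro impI conjI)
      assume y: "0 < y"
      obtain n :: nat where n: "y < real n" using reals_Archimedean2 by blast
      have "integral {0..y} (\<lambda>t. cr ((y - t) powr (\<theta> - 1)) * vector_derivative \<Delta> (at t)) = cr (frac_int \<theta> \<delta>' y)"
        using elim(1)[rule_format, of n] y n by (intro frac_int_eq_integral[OF _ neg vd]) auto
      then show "cr (q y) = integral {0..y} (\<lambda>t. cr ((y - t) powr (\<theta> - 1)) * vector_derivative \<Delta> (at t))"
        using elim(3) y by simp
      assume \<theta>1: "1 < \<theta>"
      have "integral {0..y} (\<lambda>t. cr ((y - t) powr (\<theta> - 1 - 1)) * \<Delta> t) = cr (frac_int (\<theta> - 1) \<delta> y)"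
        using elim(2)[rule_format, of n] y n \<theta>1 by (intro frac_int_eq_integral[OF _ negligible_empty \<Delta>]) auto
      then show "cr (q y) = cr (\<theta> - 1) * integral {0..y} (\<lambda>t. cr ((y - t) powr (\<theta> - 2)) * \<Delta> t)"
        using elim(4) y \<theta>1 by simp
    qed
  qed
qed

end
end

text \<open>The ball of radius -x around a negative x misses the half line that carries \<eta>, so x
  is outside the support.\<close>

lemma measure_support_hull_nonneg:
  assumes "AE x in \<eta>. 0 \<le> x" "sets \<eta> = sets borel"
  shows "convex hull (measure_support \<eta>) \<subseteq> {0..}"
proof (rule hull_minimal)
  show "measure_support \<eta> \<subseteq> {0..}"
  proof
    fix x assume x: "x \<in> measure_support \<eta>"
    show "x \<in> {0..}"
    proof (rule ccontr)
      assume "x \<notin> {0..}"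
      then have "- x > 0" by simp
      then have "emeasure \<eta> (ball x (- x)) > 0" using x unfolding measure_support_def by blast
      moreover have "emeasure \<eta> (ball x (- x)) = 0"
      proof -
        have "space \<eta> = UNIV" using sets_eq_imp_space_eq[OF assms(2)] by simp
        moreover have "emeasure \<eta> {y \<in> space \<eta>. y \<in> ball x (- x)} = 0"
          using assms(1)
          by (intro emeasure_eq_0_AE) (auto elim!: eventually_mono simp: dist_real_def abs_real_def split: if_splits)
        ultimately show ?thesis by (simp add: ball_def)
      qed
      ultimately show False by simp
    qed
  qed
qed simp

text \<open>A density is determined only up to null sets and q is an arbitrary one, hence the
  equality for almost every y. The values are complex because \<open>Delta_fun\<close> is a limit of
  complex quotients; it turns out to be real.\<close>

theorem theorem3p1:
  fixes \<alpha> \<theta> :: real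
    and H :: "'x::polish_space measure"
    and f :: "'x \<Rightarrow> real"
    and M :: "'a measure"
    and V :: "nat \<Rightarrow> 'a \<Rightarrow> real"
    and Z :: "nat \<Rightarrow> 'a \<Rightarrow> 'x"
    and q :: "real \<Rightarrow> real"
  assumes "0 < \<alpha>" and "\<alpha> < 1" and "0 < \<theta>"
    and "prob_space H" and "sets H = sets borel"
    and "\<And>x. emeasure H {x} = 0"
    and "f \<in> borel_measurable H" and "\<And>x. 0 \<le> f x"
    and "integrable H (\<lambda>x. f x powr \<alpha>)"
    and "PD_representation M \<alpha> \<theta> H V Z"
    and "\<And>y. 0 \<le> q y"
    and "distributed M lborel (PD_functional V Z f) (\<lambda>y. ennreal (q y))"
  shows "AE y in lborel. y \<in> convex hull (measure_support (distr H borel f)) \<longrightarrow>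
           complex_of_real (q y) =
             integral {0..y} (\<lambda>t. complex_of_real ((y - t) powr (\<theta> - 1))
                * vector_derivative (Delta_fun M \<theta> (PD_functional V Z f)) (at t))
           \<and> (1 < \<theta> \<longrightarrow> complex_of_real (q y) =
                complex_of_real (\<theta> - 1) * integral {0..y} (\<lambda>t. complex_of_real ((y - t) powr (\<theta> - 2))
                   * Delta_fun M \<theta> (PD_functional V Z f) t))"
proof -
  let ?X = "PD_functional V Z f"
  note PD = \<open>PD_representation M \<alpha> \<theta> H V Z\<close>[unfolded PD_representation_def]
  interpret prob_space M using PD by blast
  define \<eta> where "\<eta> = distr H borel f"
  define Y where "Y k \<omega> = f (Z k \<omega>)" for k \<omega>
  have f [measurable]: "f \<in> borel_measurable H" by fact
  have Z [measurable]: "Z k \<in> measurable M H" for k using PD by blast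
  have indep: "indep_vars (\<lambda>_. borel) (case_sum V Y) UNIV"
    unfolding Y_def[abs_def] by (rule indep_vars_case_sum[OF _ _ f]) (use PD in blast)+
  have distr_Y: "distr M borel (Y k) = \<eta>" for k
  proof -
    have "distr M borel (Y k) = distr (distr M H (Z k)) borel f"
      unfolding Y_def[abs_def] by (subst distr_distr) (auto simp: comp_def)
    then show ?thesis using PD by (simp add: \<eta>_def)
  qed
  interpret SB: stick_breaking M \<alpha> \<theta> V Y \<eta>
  proof
    show "distr M borel (V k) = beta_measure (1 - \<alpha>) (\<theta> + real (Suc k) * \<alpha>)" for k using PD by blast
    show "0 \<le> Y k \<omega>" for k \<omega> unfolding Y_def by fact
  qed (fact distr_Y indep assms)+
  have S: "stick_sum V Y 0 = ?X"
    by (simp add: fun_eq_iff stick_sum_def PD_functional_def Y_def)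
  have X [measurable]: "?X \<in> borel_measurable M" using SB.S_measurable unfolding S .
  have moment: "integrable \<eta> (\<lambda>y. y powr \<alpha>)"
    unfolding \<eta>_def using assms(9) by (subst integrable_distr_eq) auto
  have q_ennreal [measurable]: "(\<lambda>y. ennreal (q y)) \<in> borel_measurable borel"
    using \<open>distributed M lborel ?X (\<lambda>y. ennreal (q y))\<close> by (auto simp: distributed_def)
  \<comment> \<open>\<open>distributed\<close> gives measurability only after coercion to
    \<open>ennreal\<close>; \<open>enn2real\<close> undoes it because q is nonnegative.\<close>
  have "(\<lambda>y. enn2real (ennreal (q y))) \<in> borel_measurable borel" by measurable
  then have q [measurable]: "q \<in> borel_measurable borel"
    using \<open>\<And>y. 0 \<le> q y\<close> by simp
  define \<mu> where "\<mu> = distr M borel ?X"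
  have \<mu>_q: "\<mu> = density lborel (\<lambda>y. ennreal (q y))"
  proof -
    have "\<mu> = distr M lborel ?X" unfolding \<mu>_def by (intro distr_cong) auto
    then show ?thesis using \<open>distributed M lborel ?X (\<lambda>y. ennreal (q y))\<close> by (simp add: distributed_def)
  qed
  interpret \<mu>: prob_space \<mu> unfolding \<mu>_def by (rule prob_space_distr) measurable
  interpret \<eta>: prob_space \<eta> by (rule SB.prob_\<eta>)
  interpret SP: stieltjes_pair \<mu> \<eta> \<alpha> \<theta>
  proof
    show "sets \<mu> = sets borel" by (simp add: \<mu>_def)
    show "AE x in \<mu>. 0 \<le> x"
      unfolding \<mu>_def using SB.AE_conv[OF moment] unfolding S
      by (subst AE_distr_iff) (auto elim: eventually_mono)
    show "sets \<eta> = sets borel" by (rule SB.sets_\<eta>)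
    show "AE x in \<eta>. 0 \<le> x" by (rule SB.AE_\<eta>)
    show "\<not> (AE y in \<eta>. y = t)" for t
    proof
      \<comment> \<open>X would then equal t almost surely, which a law with a density
        excludes.\<close>
      assume "AE y in \<eta>. y = t"
      from SB.AE_S_eq_const[OF moment this] have "AE x in \<mu>. x = t"
        unfolding \<mu>_def S by (subst AE_distr_iff) auto
      moreover have "AE x in \<mu>. x \<noteq> t"
        unfolding \<mu>_q using AE_lborel_singleton[of t] by (subst AE_density) auto
      ultimately have "AE x in \<mu>. False" by eventually_elim simp
      then show False by simp
    qed
    show "(\<integral>x. (z + x) powr (- \<theta>) \<partial>\<mu>) = (\<integral>y. (z + y) powr \<alpha> \<partial>\<eta>) powr (- \<theta> / \<alpha>)" if "0 < z" for z
      unfolding \<mu>_def using SB.stieltjes_identity[OF moment that] unfolding S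
      by (subst integral_distr) auto
  qed (fact assms moment)+
  have gs: "gen_stieltjes M \<theta> ?X z = SP.St z" for z
  proof -
    have "(\<lambda>x. (z + complex_of_real x) powr complex_of_real (- \<theta>)) \<in> borel_measurable borel"
      by (rule borel_measurable_shift_powr)
    then have "(\<integral>x. (z + complex_of_real x) powr complex_of_real (- \<theta>) \<partial>\<mu>)
        = (\<integral>\<omega>. (z + complex_of_real (?X \<omega>)) powr complex_of_real (- \<theta>) \<partial>M)"
      unfolding \<mu>_def by (subst integral_distr) auto
    then show ?thesis by (simp add: gen_stieltjes_def SP.\<mu>.pt_def)
  qed
  have \<Delta>: "Delta_fun M \<theta> ?X t = complex_of_real (SP.\<delta> t)" for t
    unfolding Delta_fun_def gs by (rule tendsto_Lim[OF _ SP.boundary_limit]) simp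
  have hull: "convex hull (measure_support (distr H borel f)) \<subseteq> {0..}"
    using measure_support_hull_nonneg[OF SB.AE_\<eta> SB.sets_\<eta>] unfolding \<eta>_def .
  show ?thesis
    using SP.AE_density_formula[OF q \<open>\<And>y. 0 \<le> q y\<close> \<mu>_q \<Delta>] AE_lborel_singleton[of 0]
  proof eventually_elim
    case (elim y)
    show ?case
    proof
      assume "y \<in> convex hull (measure_support (distr H borel f))"
      then have "0 < y" using hull elim(2) by auto
      then show "complex_of_real (q y) =
             integral {0..y} (\<lambda>t. complex_of_real ((y - t) powr (\<theta> - 1))
                * vector_derivative (Delta_fun M \<theta> (PD_functional V Z f)) (at t))
           \<and> (1 < \<theta> \<longrightarrow> complex_of_real (q y) =
                complex_of_real (\<theta> - 1) * integral {0..y} (\<lambda>t. complex_of_real ((y - t) powr (\<theta> - 2))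
                   * Delta_fun M \<theta> (PD_functional V Z f) t))"
        using elim(1) by blast
    qed
  qed
qed

end
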